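(* Let $n,m,Q\ge 1$ and $k\ge 0$ be integers, $q\in[1,\infty)$, $\lambda\in(0,\infty)$, $A>0$. Suppose $\Omega\subset\mathbb{R}^n$ is a convex $A$-weighted domain and $u\in\mathcal{L}^{q,\lambda}_k(\Omega;\mathcal{A}_Q(\mathbb{R}^m))$. Suppose that $n+\ell q<\lambda<n+(\ell+1)q$ for some $\ell\in\{0,1,\dots,k\}$. Then $u\in C^{\ell,\alpha}(\overline{\Omega};\mathcal{A}_Q(\mathbb{R}^m))$, with the estimate $$[u]_{\ell,\alpha}\le C\,|||u|||_{\ell,q,\lambda},$$ where $\alpha:=\frac{\lambda-n-\ell q}{q}$ and $C=C(n,m,k,\ell,q,Q,A,\lambda)$. Moreover, $\mathcal{L}^{q,\lambda}_k(\Omega;\mathcal{A}_Q(\mathbb{R}^m))$ is continuously isomorphic to $\mathcal{L}^{q,\lambda}_\ell(\Omega;\mathcal{A}_Q(\mathbb{R}^m))$.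
   Context: $\mathcal{A}_Q(\mathbb{R}^m)$ is the set of unordered $Q$-tuples $\sum_{i=1}^Q[\![T_i]\!]$, $T_i\in\mathbb{R}^m$ ($[\![T]\!]$ is the Dirac mass at $T$), with the complete metric $\mathcal{G}(\sum_i[\![R_i]\!],\sum_i[\![T_i]\!])=\min_{\sigma\in S_Q}(\sum_i|R_i-T_{\sigma(i)}|^2)^{1/2}$. A $Q$-valued function is $u:\Omega\to\mathcal{A}_Q(\mathbb{R}^m)$, $u(x)=\sum_i[\![u_i(x)]\!]$; $|u|=\mathcal{G}(u,Q[\![0]\!])$, and $u\in L^q(\Omega;\mathcal{A}_Q(\mathbb{R}^m))$ if $\|u\|_q:=\|\,|u|\,\|_{L^q(\Omega)}<\infty$. As usual, elements of $L^q$ are identified when equal a.e. $u$ is differentiable at $x_0$ if there are matrices $A_1,\dots,A_Q\in\mathbb{R}^{m\times n}$ with $\lim_{h\to0}\mathcal{G}(u(x_0+h),\sum_i[\![u_i(x_0)+A_ih]\!])/|h|=0$; then $Du(x_0)=\sum_i[\![A_i]\!]$, $Du_i(x_0)=A_i$. The spaces $C^{\ell}$, $C^{\ell,\alpha}$ are defined in the natural way: $u,Du,\dots,D^\ell u$ exist and are continuous as unordered-tuple-valued functions; $u\in C^{\ell,\alpha}(\overline\Omega;\mathcal{A}_Q(\mathbb{R}^m))$ if these extend continuously to $\overline\Omega$ and $[u]_{\ell,\alpha}:=\sup_{x\ne y}\mathcal{G}(D^\ell u(x),D^\ell u(y))/|x-y|^\alpha<\infty$. A $Q$-valued polynomial is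 $p=\sum_{i=1}^Q[\![p_i]\!]$ with each $p_i:\mathbb{R}^n\to\mathbb{R}^m$ having polynomial components; its degree is the maximum of the degrees of all components. $\mathcal{P}_k$ is the set of $Q$-valued polynomials $\mathbb{R}^n\to\mathcal{A}_Q(\mathbb{R}^m)$ of degree $\le k$. $\mathcal{L}^{q,\lambda}_k(\Omega;\mathcal{A}_Q(\mathbb{R}^m))$ is the set of $u\in L^q(\Omega;\mathcal{A}_Q(\mathbb{R}^m))$ with $$|||u|||_{k,q,\lambda}:=\sup_{x_0\in\overline\Omega,\ \rho\in(0,\mathrm{diam}(\Omega)]}\Big[\rho^{-\lambda}\inf_{P\in\mathcal{P}_k}\int_{\Omega\cap B_\rho(x_0)}\mathcal{G}(u(x),P(x))^q\,dx\Big]^{1/q}<\infty,$$ and one sets $\|u\|_{k,q,\lambda}^q:=\|u\|_q^q+|||u|||_{k,q,\lambda}^q$ (called a "norm" although there is no vector space structure). "Continuously isomorphic" means: the two sets of functions coincide and the "norms" $\|\cdot\|_{k,q,\lambda}$ and $\|\cdot\|_{\ell,q,\lambda}$ bound each other up to multiplicative constants independent of the function. A bounded domain $\Omega\subset\mathbb{R}^n$ is $A$-weighted if $\mathcal{H}^n(\Omega\cap B_\rho(x))\ge A\rho^n$ for all $x\in\overline\Omega$, $\rho\in(0,\mathrm{diam}(\Omega)]$. *)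

theory Defs
  imports "HOL-Analysis.Analysis"
begin

definition Qtuples :: "nat \<Rightarrow> 'c set \<Rightarrow> 'c multiset set" where
  "Qtuples Q S = {T. size T = Q \<and> set_mset T \<subseteq> S}"

text \<open>
  The minimum also ranges over all enumerations r of R and t of T. This adds no values, since
  any two enumerations of a multiset differ by a permutation. The value 0 for multisets of a size
  other than Q is a dummy; the locale Metric_space demands symmetry and nonnegativity there too.
\<close>

definition Qdist :: "('c \<Rightarrow> 'c \<Rightarrow> real) \<Rightarrow> nat \<Rightarrow> 'c multiset \<Rightarrow> 'c multiset \<Rightarrow> real" where
  "Qdist d Q R T =
     (if size R = Q \<and> size T = Q
      then Min {sqrt (\<Sum>i<Q. (d (r i) (t (\<sigma> i)))\<^sup>2) | r t \<sigma>.
                  R = (\<Sum>i<Q. {#r i#}) \<and> T = (\<Sum>i<Q. {#t i#}) \<and> \<sigma> permutes {..<Q}}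
      else 0)"

abbreviation Qtopology :: "'c set \<Rightarrow> ('c \<Rightarrow> 'c \<Rightarrow> real) \<Rightarrow> nat \<Rightarrow> 'c multiset topology" where
  "Qtopology S d Q \<equiv> Metric_space.mtopology (Qtuples Q S) (Qdist d Q)"

lemma sum_single_mset: "(\<Sum>i<Q. {#f i#}) = image_mset f (mset_set {..<Q::nat})"
  by (induction Q) (auto simp: lessThan_Suc)

lemma size_sum_single [simp]: "size (\<Sum>i<Q. {#f i#}) = (Q::nat)"
  by (simp add: sum_single_mset)

lemma ex_enumeration:
  assumes "size R = Q" obtains r where "R = (\<Sum>i<Q. {#r i#})"
proof -
  obtain xs where xs: "mset xs = R" using ex_mset by blast
  then have l: "length xs = Q" using assms by auto
  have "R = mset (map ((!) xs) [0..<Q])" using xs l map_nth[of xs] by simp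
  also have "\<dots> = image_mset ((!) xs) (mset_set {..<Q})"
    by (simp only: mset_map mset_upt atLeast0LessThan)
  finally show ?thesis using that by (simp only: sum_single_mset)
qed

lemma Qtuples_enumeration:
  assumes "R \<in> Qtuples Q S"
  obtains r where "R = (\<Sum>i<Q. {#r i#})" "\<And>i. i < Q \<Longrightarrow> r i \<in> S"
proof -
  have R: "size R = Q" "set_mset R \<subseteq> S" using assms by (simp_all add: Qtuples_def)
  obtain r where r: "R = (\<Sum>i<Q. {#r i#})" using R(1) by (rule ex_enumeration)
  then have "set_mset R = r ` {..<Q}" by (simp add: sum_single_mset)
  then show ?thesis using that r R(2) by blast
qed

lemma enumeration_permutes:
  assumes "(\<Sum>i<Q. {#r i#}) = (\<Sum>i<Q. {#s i#})"
  obtains p where "p permutes {..<Q::nat}" "\<And>i. i < Q \<Longrightarrow> r i = s (p i)"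
proof -
  have "image_mset s (mset_set {..<Q}) = image_mset r (mset_set {..<Q})"
    using assms by (simp only: sum_single_mset)
  then obtain p where "p permutes {..<Q}" "\<forall>i\<in>{..<Q}. r i = s (p i)"
    using image_mset_eq_implies_permutes[of "{..<Q}" r s] by (metis finite_lessThan)
  then show ?thesis using that[of p] by (metis lessThan_iff)
qed

lemma Qdist_enum:
  "Qdist d Q (\<Sum>i<Q. {#r i#}) (\<Sum>i<Q. {#t i#}) =
     Min ((\<lambda>\<sigma>. sqrt (\<Sum>i<Q. (d (r i) (t (\<sigma> i)))\<^sup>2)) ` {\<sigma>. \<sigma> permutes {..<Q}})"
proof -
  let ?A = "{sqrt (\<Sum>i<Q. (d (r' i) (t' (\<sigma> i)))\<^sup>2) | r' t' \<sigma>.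
      (\<Sum>i<Q. {#r i#}) = (\<Sum>i<Q. {#r' i#}) \<and> (\<Sum>i<Q. {#t i#}) = (\<Sum>i<Q. {#t' i#})
      \<and> \<sigma> permutes {..<Q}}"
  let ?B = "(\<lambda>\<sigma>. sqrt (\<Sum>i<Q. (d (r i) (t (\<sigma> i)))\<^sup>2)) ` {\<sigma>. \<sigma> permutes {..<Q}}"
  have "?A \<subseteq> ?B"
  proof
    fix x assume "x \<in> ?A"
    then obtain r' t' \<sigma> where x: "x = sqrt (\<Sum>i<Q. (d (r' i) (t' (\<sigma> i)))\<^sup>2)"
      and r: "(\<Sum>i<Q. {#r i#}) = (\<Sum>i<Q. {#r' i#})"
      and t: "(\<Sum>i<Q. {#t' i#}) = (\<Sum>i<Q. {#t i#})" and s: "\<sigma> permutes {..<Q}" by auto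
    obtain p where p: "p permutes {..<Q}" "\<And>i. i < Q \<Longrightarrow> r i = r' (p i)"
      using enumeration_permutes[OF r] by metis
    obtain p' where p': "p' permutes {..<Q}" "\<And>i. i < Q \<Longrightarrow> t' i = t (p' i)"
      using enumeration_permutes[OF t] by metis
    have "(\<Sum>i<Q. (d (r' i) (t' (\<sigma> i)))\<^sup>2) = (\<Sum>i<Q. (d (r' (p i)) (t' (\<sigma> (p i))))\<^sup>2)"
      using sum.permute[OF p(1), of "\<lambda>i. (d (r' i) (t' (\<sigma> i)))\<^sup>2"] by (simp add: o_def)
    also have "\<dots> = (\<Sum>i<Q. (d (r i) (t ((p' \<circ> \<sigma> \<circ> p) i)))\<^sup>2)"
      by (rule sum.cong)
         (use p p' s permutes_in_image[OF p(1)] permutes_in_image[OF s] in auto)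
    finally show "x \<in> ?B"
      unfolding x using p(1) p'(1) s
      by (intro image_eqI[of _ _ "p' \<circ> \<sigma> \<circ> p"]) (auto intro!: permutes_compose)
  qed
  moreover have "?B \<subseteq> ?A" by blast
  ultimately have "?A = ?B" by blast
  then show ?thesis by (simp add: Qdist_def)
qed

lemma Qdist_le:
  assumes "\<sigma> permutes {..<Q}"
  shows "Qdist d Q (\<Sum>i<Q. {#r i#}) (\<Sum>i<Q. {#t i#}) \<le> sqrt (\<Sum>i<Q. (d (r i) (t (\<sigma> i)))\<^sup>2)"
proof -
  let ?f = "\<lambda>\<sigma>. sqrt (\<Sum>i<Q. (d (r i) (t (\<sigma> i)))\<^sup>2)"
  have "finite (?f ` {\<sigma>. \<sigma> permutes {..<Q}})" by (simp add: finite_permutations)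
  moreover have "?f \<sigma> \<in> ?f ` {\<sigma>. \<sigma> permutes {..<Q}}" using assms by blast
  ultimately show ?thesis unfolding Qdist_enum by (rule Min_le)
qed

lemma Qdist_attained:
  obtains \<sigma> where "\<sigma> permutes {..<Q}"
    "Qdist d Q (\<Sum>i<Q. {#r i#}) (\<Sum>i<Q. {#t i#}) = sqrt (\<Sum>i<Q. (d (r i) (t (\<sigma> i)))\<^sup>2)"
proof -
  let ?B = "(\<lambda>\<sigma>. sqrt (\<Sum>i<Q. (d (r i) (t (\<sigma> i)))\<^sup>2)) ` {\<sigma>. \<sigma> permutes {..<Q}}"
  have "Min ?B \<in> ?B"
  proof (rule Min_in)
    show "finite ?B" by (simp add: finite_permutations)
    have "{\<sigma>. \<sigma> permutes {..<Q}} \<noteq> {}" by (metis permutes_id empty_Collect_eq)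
    then show "?B \<noteq> {}" by (simp only: image_is_empty not_False_eq_True)
  qed
  then obtain \<sigma> where "\<sigma> permutes {..<Q}" "Min ?B = sqrt (\<Sum>i<Q. (d (r i) (t (\<sigma> i)))\<^sup>2)" by blast
  then show ?thesis using that by (simp only: Qdist_enum)
qed

lemma Metric_space_Qtuples:
  assumes "Metric_space S d"
  shows "Metric_space (Qtuples Q S) (Qdist d Q)"
proof -
  interpret Metric_space S d by fact
  have le: "Qdist d Q x y \<le> Qdist d Q y x" if xy: "size x = Q" "size y = Q" for x y
  proof -
    obtain r t where r: "x = (\<Sum>i<Q. {#r i#})" and t: "y = (\<Sum>i<Q. {#t i#})"
      using xy ex_enumeration by metis
    obtain \<sigma> where s: "\<sigma> permutes {..<Q}"
      "Qdist d Q y x = sqrt (\<Sum>i<Q. (d (t i) (r (\<sigma> i)))\<^sup>2)"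
      unfolding r t by (rule Qdist_attained)
    let ?p = "inv \<sigma>"
    have p: "?p permutes {..<Q}" using s(1) by (rule permutes_inv)
    have "(\<Sum>i<Q. (d (t i) (r (\<sigma> i)))\<^sup>2) = (\<Sum>i<Q. (d (t (?p i)) (r (\<sigma> (?p i))))\<^sup>2)"
      using sum.permute[OF p, of "\<lambda>i. (d (t i) (r (\<sigma> i)))\<^sup>2"] by (simp add: o_def)
    also have "\<dots> = (\<Sum>i<Q. (d (r i) (t (?p i)))\<^sup>2)"
      using s(1) by (simp add: permutes_inverses commute)
    finally show ?thesis using Qdist_le[OF p, of d r t] s(2) by (simp add: r t)
  qed
  show ?thesis
  proof
    show "0 \<le> Qdist d Q x y" for x y
    proof (cases "size x = Q \<and> size y = Q")
      case True
      then obtain r t where r: "x = (\<Sum>i<Q. {#r i#})" and t: "y = (\<Sum>i<Q. {#t i#})"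
        using ex_enumeration by metis
      show ?thesis unfolding r t by (rule Qdist_attained[of Q d r t]) (simp add: sum_nonneg)
    qed (auto simp: Qdist_def)
    show "Qdist d Q x y = Qdist d Q y x" for x y
      by (cases "size x = Q \<and> size y = Q") (use le in \<open>auto intro: antisym simp: Qdist_def\<close>)
  next
    fix x y assume xy: "x \<in> Qtuples Q S" "y \<in> Qtuples Q S"
    obtain r where r: "x = (\<Sum>i<Q. {#r i#})" and rS: "\<And>i. i < Q \<Longrightarrow> r i \<in> S"
      using xy(1) by (rule Qtuples_enumeration) blast
    obtain t where t: "y = (\<Sum>i<Q. {#t i#})" and tS: "\<And>i. i < Q \<Longrightarrow> t i \<in> S"
      using xy(2) by (rule Qtuples_enumeration) blast
    show "Qdist d Q x y = 0 \<longleftrightarrow> x = y"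
    proof
      assume 0: "Qdist d Q x y = 0"
      obtain \<sigma> where s: "\<sigma> permutes {..<Q}"
        "Qdist d Q x y = sqrt (\<Sum>i<Q. (d (r i) (t (\<sigma> i)))\<^sup>2)"
        unfolding r t by (rule Qdist_attained)
      then have "(\<Sum>i<Q. (d (r i) (t (\<sigma> i)))\<^sup>2) = 0" using 0 by simp
      then have "\<forall>i<Q. d (r i) (t (\<sigma> i)) = 0" by (subst (asm) sum_nonneg_eq_0_iff) auto
      then have "\<forall>i<Q. r i = t (\<sigma> i)"
        using rS tS zero permutes_in_image[OF s(1)] by (metis lessThan_iff)
      then have "x = (\<Sum>i<Q. {#t (\<sigma> i)#})" unfolding r by (intro sum.cong) auto
      also have "\<dots> = y"
        unfolding t using sum.permute[OF s(1), of "\<lambda>i. {#t i#}"] by (simp add: o_def)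
      finally show "x = y" .
    next
      assume "x = y"
      have "Qdist d Q x x \<le> sqrt (\<Sum>i<Q. (d (r i) (r (id i)))\<^sup>2)"
        unfolding r by (rule Qdist_le[OF permutes_id])
      also have "\<dots> = 0" using rS by simp
      finally have "Qdist d Q x y \<le> 0" using \<open>x = y\<close> by simp
      moreover have "Qdist d Q x y \<ge> 0"
        unfolding r t by (rule Qdist_attained[of Q d r t]) (simp add: sum_nonneg)
      ultimately show "Qdist d Q x y = 0" by simp
    qed
  next
    fix x y z assume xyz: "x \<in> Qtuples Q S" "y \<in> Qtuples Q S" "z \<in> Qtuples Q S"
    obtain r where r: "x = (\<Sum>i<Q. {#r i#})" and rS: "\<And>i. i < Q \<Longrightarrow> r i \<in> S"
      using xyz(1) by (rule Qtuples_enumeration) blast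
    obtain s where s: "y = (\<Sum>i<Q. {#s i#})" and sS: "\<And>i. i < Q \<Longrightarrow> s i \<in> S"
      using xyz(2) by (rule Qtuples_enumeration) blast
    obtain t where t: "z = (\<Sum>i<Q. {#t i#})" and tS: "\<And>i. i < Q \<Longrightarrow> t i \<in> S"
      using xyz(3) by (rule Qtuples_enumeration) blast
    obtain p where p: "p permutes {..<Q}"
      "Qdist d Q x y = sqrt (\<Sum>i<Q. (d (r i) (s (p i)))\<^sup>2)"
      unfolding r s by (rule Qdist_attained)
    obtain p' where p': "p' permutes {..<Q}"
      "Qdist d Q y z = sqrt (\<Sum>i<Q. (d (s i) (t (p' i)))\<^sup>2)"
      unfolding s t by (rule Qdist_attained)
    have pQ: "p i < Q" "p' (p i) < Q" if "i < Q" for i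
      using that permutes_in_image[OF p(1)] permutes_in_image[OF p'(1)] by (auto simp: lessThan_iff[symmetric] simp del: lessThan_iff)
    have e: "(\<Sum>i<Q. (d (s i) (t (p' i)))\<^sup>2) = (\<Sum>i<Q. (d (s (p i)) (t (p' (p i))))\<^sup>2)"
      using sum.permute[OF p(1), of "\<lambda>i. (d (s i) (t (p' i)))\<^sup>2"] by (simp add: o_def)
    have "Qdist d Q x z \<le> L2_set (\<lambda>i. d (r i) (t (p' (p i)))) {..<Q}"
      using Qdist_le[OF permutes_compose[OF p(1) p'(1)], of d r t] by (simp add: r t L2_set_def)
    also have "\<dots> \<le> L2_set (\<lambda>i. d (r i) (s (p i)) + d (s (p i)) (t (p' (p i)))) {..<Q}"
      by (rule L2_set_mono) (use rS sS tS pQ triangle in auto)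
    also have "\<dots> \<le> L2_set (\<lambda>i. d (r i) (s (p i))) {..<Q} + L2_set (\<lambda>i. d (s (p i)) (t (p' (p i)))) {..<Q}"
      by (rule L2_set_triangle_ineq)
    also have "\<dots> = Qdist d Q x y + Qdist d Q y z"
      unfolding p(2) p'(2) e by (simp add: L2_set_def)
    finally show "Qdist d Q x z \<le> Qdist d Q x y + Qdist d Q y z" .
  qed
qed

type_synonym ('n, 'm) Qfun = "real^'n \<Rightarrow> (real^'m) multiset"

text \<open>
  A multiple-valued function on \<open>\<Omega>\<close> is a total function whose values outside \<open>\<Omega>\<close> are irrelevant.
\<close>

text \<open>The value at infinity is meant for positive exponents only.\<close>

definition ennpowr :: "ennreal \<Rightarrow> real \<Rightarrow> ennreal" where
  "ennpowr x p = (if x = \<infinity> then \<infinity> else ennreal (enn2real x powr p))"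

definition Qborel :: "nat \<Rightarrow> (real^'m::finite) multiset measure" where
  "Qborel Q = sigma (Qtuples Q UNIV) {U. openin (Qtopology UNIV dist Q) U}"

definition Qabs :: "nat \<Rightarrow> (real^'m::finite) multiset \<Rightarrow> real" where
  "Qabs Q T = Qdist dist Q T (\<Sum>i<Q. {#0#})"

definition Lq_norm :: "nat \<Rightarrow> (real^'n::finite) set \<Rightarrow> real \<Rightarrow> ('n, 'm::finite) Qfun \<Rightarrow> ennreal" where
  "Lq_norm Q \<Omega> q u = ennpowr (\<integral>\<^sup>+x\<in>\<Omega>. ennreal (Qabs Q (u x) powr q) \<partial>lebesgue) (1/q)"

definition Lq_space :: "nat \<Rightarrow> (real^'n::finite) set \<Rightarrow> real \<Rightarrow> ('n, 'm::finite) Qfun set" where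
  "Lq_space Q \<Omega> q = {u \<in> measurable (lebesgue_on \<Omega>) (Qborel Q). Lq_norm Q \<Omega> q u < \<infinity>}"

text \<open>The multi-indices below form a finite set, see \<open>finite_multi_indices\<close>.\<close>

definition poly_fun :: "nat \<Rightarrow> (real^'n::finite \<Rightarrow> real^'m::finite) \<Rightarrow> bool" where
  "poly_fun k p \<longleftrightarrow> (\<exists>c :: ('n \<Rightarrow> nat) \<Rightarrow> real^'m.
     \<forall>x. p x = (\<Sum>a | (\<Sum>i\<in>UNIV. a i) \<le> k. (\<Prod>i\<in>UNIV. (x $ i) ^ a i) *\<^sub>R c a))"

lemma finite_multi_indices: "finite {a :: 'n::finite \<Rightarrow> nat. (\<Sum>i\<in>UNIV. a i) \<le> k}"
proof (rule finite_subset)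
  show "{a :: 'n \<Rightarrow> nat. (\<Sum>i\<in>UNIV. a i) \<le> k} \<subseteq> (\<Pi>\<^sub>E i\<in>UNIV. {..k})"
  proof
    fix a :: "'n \<Rightarrow> nat" assume "a \<in> {a. (\<Sum>i\<in>UNIV. a i) \<le> k}"
    then have "a i \<le> k" for i using member_le_sum[of i UNIV a] by simp
    then show "a \<in> (\<Pi>\<^sub>E i\<in>UNIV. {..k})" by (simp add: PiE_iff)
  qed
  show "finite (\<Pi>\<^sub>E (i::'n)\<in>UNIV. {..k})" by (intro finite_PiE) auto
qed

definition Qpolys :: "nat \<Rightarrow> nat \<Rightarrow> ('n::finite, 'm::finite) Qfun set" where
  "Qpolys Q k = {\<lambda>x. \<Sum>i<Q. {#p i x#} | p. \<forall>i<Q. poly_fun k (p i)}"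

definition campanato_seminorm ::
  "nat \<Rightarrow> (real^'n::finite) set \<Rightarrow> nat \<Rightarrow> real \<Rightarrow> real \<Rightarrow> ('n, 'm::finite) Qfun \<Rightarrow> ennreal" where
  "campanato_seminorm Q \<Omega> k q lam u =
     (SUP x0\<in>closure \<Omega>. SUP \<rho>\<in>{0<..diameter \<Omega>}.
        ennpowr (ennreal (\<rho> powr (- lam)) *
          (INF P\<in>Qpolys Q k.
             \<integral>\<^sup>+x\<in>\<Omega> \<inter> ball x0 \<rho>. ennreal (Qdist dist Q (u x) (P x) powr q) \<partial>lebesgue)) (1/q))"

definition campanato_space ::
  "nat \<Rightarrow> (real^'n::finite) set \<Rightarrow> nat \<Rightarrow> real \<Rightarrow> real \<Rightarrow> ('n, 'm::finite) Qfun set" where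
  "campanato_space Q \<Omega> k q lam = {u \<in> Lq_space Q \<Omega> q. campanato_seminorm Q \<Omega> k q lam u < \<infinity>}"

definition campanato_norm ::
  "nat \<Rightarrow> (real^'n::finite) set \<Rightarrow> nat \<Rightarrow> real \<Rightarrow> real \<Rightarrow> ('n, 'm::finite) Qfun \<Rightarrow> ennreal" where
  "campanato_norm Q \<Omega> k q lam u =
     ennpowr (ennpowr (Lq_norm Q \<Omega> q u) q + ennpowr (campanato_seminorm Q \<Omega> k q lam u) q) (1/q)"

definition continuously_isomorphic ::
  "'u set \<Rightarrow> ('u \<Rightarrow> ennreal) \<Rightarrow> 'u set \<Rightarrow> ('u \<Rightarrow> ennreal) \<Rightarrow> bool" where
  "continuously_isomorphic X N X' N' \<longleftrightarrow> X = X' \<and>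
     (\<exists>c::real. c > 0 \<and> (\<forall>u\<in>X. N u \<le> ennreal c * N' u \<and> N' u \<le> ennreal c * N u))"

text \<open>
  The density condition is usually stated with n-dimensional Hausdorff measure, which on
  n-dimensional Euclidean space is Lebesgue measure.
\<close>

definition weighted_domain :: "real \<Rightarrow> (real^'n::finite) set \<Rightarrow> bool" where
  "weighted_domain A \<Omega> \<longleftrightarrow> open \<Omega> \<and> connected \<Omega> \<and> \<Omega> \<noteq> {} \<and> bounded \<Omega> \<and>
     (\<forall>x\<in>closure \<Omega>. \<forall>\<rho>\<in>{0<..diameter \<Omega>}.
        A * \<rho> ^ CARD('n) \<le> measure lebesgue (\<Omega> \<inter> ball x \<rho>))"

text \<open>
  The values of the j-th derivative are Q-tuples of points of the Euclidean space of dimension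
  \<open>m * n ^ j\<close>. Since this dimension varies with j, such a point is encoded as a function T on lists
  of indices that vanishes off the lists of length j. For a smooth single-valued function
  f, \<open>T [i\<^sub>1, \<dots>, i\<^sub>j]\<close> is the partial derivative of f with respect to the variables with indices
  \<open>i\<^sub>1, \<dots>, i\<^sub>j\<close>.
\<close>

type_synonym ('n, 'm) tensor = "'n list \<Rightarrow> real^'m"

definition tensors :: "nat \<Rightarrow> ('n::finite, 'm::finite) tensor set" where
  "tensors j = {T. \<forall>is. length is \<noteq> j \<longrightarrow> T is = 0}"

definition tensor_dist :: "nat \<Rightarrow> ('n::finite, 'm::finite) tensor \<Rightarrow> ('n, 'm) tensor \<Rightarrow> real" where
  "tensor_dist j S T = sqrt (\<Sum>is | length is = j. (norm (S is - T is))\<^sup>2)"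

lemma finite_index_lists: "finite {is :: 'n::finite list. length is = j}"
  using finite_lists_length_eq[of "UNIV :: 'n set" j] by simp

lemma Metric_space_tensors: "Metric_space (tensors j) (tensor_dist j)"
proof
  fix R S T :: "('a, 'b) tensor"
  show "0 \<le> tensor_dist j S T" by (simp add: tensor_dist_def sum_nonneg)
  show "tensor_dist j S T = tensor_dist j T S" by (simp add: tensor_dist_def norm_minus_commute)
  show "tensor_dist j S T = 0 \<longleftrightarrow> S = T" if "S \<in> tensors j" "T \<in> tensors j"
  proof
    assume "tensor_dist j S T = 0"
    then have "\<forall>is. length is = j \<longrightarrow> S is = T is"
      by (auto simp: tensor_dist_def sum_nonneg_eq_0_iff finite_index_lists)
    moreover have "\<forall>is. length is \<noteq> j \<longrightarrow> S is = T is" using that by (simp add: tensors_def)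
    ultimately show "S = T" by blast
  qed (simp add: tensor_dist_def)
  have "tensor_dist j R T \<le> L2_set (\<lambda>is. norm (R is - S is) + norm (S is - T is)) {is. length is = j}"
    unfolding tensor_dist_def L2_set_def[symmetric]
    by (rule L2_set_mono) (auto intro: norm_diff_triangle_le)
  also have "\<dots> \<le> tensor_dist j R S + tensor_dist j S T"
    unfolding tensor_dist_def L2_set_def[symmetric] by (rule L2_set_triangle_ineq)
  finally show "tensor_dist j R T \<le> tensor_dist j R S + tensor_dist j S T" .
qed

text \<open>
  An order \<open>j + 1\<close> tensor A acts as a linear map (matrix) from vectors to order j tensors by
  contracting the first index.
\<close>

definition tensor_affine ::
  "('n::finite, 'm::finite) tensor \<Rightarrow> ('n, 'm) tensor \<Rightarrow> real^'n \<Rightarrow> ('n, 'm) tensor" where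
  "tensor_affine T A h = (\<lambda>is. T is + (\<Sum>i\<in>UNIV. (h $ i) *\<^sub>R A (i # is)))"

definition has_Qderiv ::
  "nat \<Rightarrow> nat \<Rightarrow> (real^'n \<Rightarrow> ('n::finite, 'm::finite) tensor multiset) \<Rightarrow> real^'n \<Rightarrow>
     ('n, 'm) tensor multiset \<Rightarrow> bool" where
  "has_Qderiv Q j v x0 V \<longleftrightarrow>
     (\<exists>T A. v x0 = (\<Sum>i<Q. {#T i#}) \<and> V = (\<Sum>i<Q. {#A i#}) \<and>
        (\<forall>i<Q. T i \<in> tensors j \<and> A i \<in> tensors (Suc j)) \<and>
        ((\<lambda>h. Qdist (tensor_dist j) Q (v (x0 + h)) (\<Sum>i<Q. {#tensor_affine (T i) (A i) h#})
            / norm h) \<longlongrightarrow> 0) (at 0))"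

text \<open>
  In the recursion below SOME picks the derivative, which is unique when it exists.
\<close>

primrec QD ::
  "nat \<Rightarrow> nat \<Rightarrow> ('n::finite, 'm::finite) Qfun \<Rightarrow> real^'n \<Rightarrow> ('n, 'm) tensor multiset" where
  "QD Q 0 u = (\<lambda>x. image_mset (\<lambda>y is. if is = [] then y else 0) (u x))"
| "QD Q (Suc j) u = (\<lambda>x. SOME V. has_Qderiv Q j (QD Q j u) x V)"

definition Holder_seminorm ::
  "nat \<Rightarrow> (real^'n::finite) set \<Rightarrow> nat \<Rightarrow> real \<Rightarrow> ('n, 'm::finite) Qfun \<Rightarrow> ennreal" where
  "Holder_seminorm Q \<Omega> l \<alpha> u =
     (SUP (x, y)\<in>{(x, y). x \<in> \<Omega> \<and> y \<in> \<Omega> \<and> x \<noteq> y}.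
        ennreal (Qdist (tensor_dist l) Q (QD Q l u x) (QD Q l u y) / norm (x - y) powr \<alpha>))"

definition C_space :: "nat \<Rightarrow> (real^'n::finite) set \<Rightarrow> nat \<Rightarrow> ('n, 'm::finite) Qfun set" where
  "C_space Q \<Omega> l = {u.
     (\<forall>x\<in>\<Omega>. u x \<in> Qtuples Q UNIV) \<and>
     (\<forall>j<l. \<forall>x\<in>\<Omega>. \<exists>V. has_Qderiv Q j (QD Q j u) x V) \<and>
     (\<forall>j\<le>l. continuous_map (top_of_set \<Omega>) (Qtopology (tensors j) (tensor_dist j) Q) (QD Q j u))}"

definition Holder_space ::
  "nat \<Rightarrow> (real^'n::finite) set \<Rightarrow> nat \<Rightarrow> real \<Rightarrow> ('n, 'm::finite) Qfun set" where
  "Holder_space Q \<Omega> l \<alpha> = {u \<in> C_space Q \<Omega> l.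
     (\<forall>j\<le>l. \<exists>E. continuous_map (top_of_set (closure \<Omega>)) (Qtopology (tensors j) (tensor_dist j) Q) E \<and>
               (\<forall>x\<in>\<Omega>. E x = QD Q j u x)) \<and>
     Holder_seminorm Q \<Omega> l \<alpha> u < \<infinity>}"

end

theory Submission
  imports Defs
begin

text \<open>
  Let \<open>\<beta> = (lam - n) / q\<close>, so that \<open>l < \<beta> < l + 1\<close> and \<open>\<alpha> = \<beta> - l\<close>. If the seminorm of u is less
  than M, then at every point x and scale \<open>\<rho>\<close> some Q-valued polynomial P has
  distance at most \<open>M \<rho> powr \<beta>\<close> from u, up to a constant, in the \<open>L\<^sup>q\<close> mean over the ball of
  radius \<open>\<rho>\<close> about x. The theorem follows by comparing such polynomials at neighbouring points and
  consecutive scales, as for single-valued functions; what has to be explained is why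
  unordered tuples do no harm.

  The reason is that a single permutation matches two Q-valued polynomials P and R that are close
  in the mean on a set E (\<open>Qpoly_comparison\<close>). Pointwise the matching may vary with x, but there are
  only finitely many permutations, so one of them is good on a subset of E of comparable measure.
  By a Remez inequality (\<open>remez_inequality_part\<close>) a polynomial that is small on a set of positive
  density in a ball is small on the ball, with all its derivatives. Applied to the differences of
  the matched sheets it shows that the sheets of P and R, paired by one permutation, differ
  little in all derivatives. The Remez inequality holds because the dilations of the set about a
  point y must overlap many times, which gives a line through y on which there are enough points of
  the set to extrapolate to y.

  The derivatives of order j of the sheets then change by \<open>O(M \<rho> powr (\<beta> - j))\<close> from one scale to the
  next or to a point at distance \<open>\<rho>\<close>. For \<open>j \<le> l\<close> the exponent is positive. Hence, with sheets
  relabelled from scale to scale, the derivatives converge as the scale shrinks (\<open>jet_exists\<close>); the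
  limits at x form the jet of u at x, which is unique up to a permutation. The jets at two
  points are compared through one polynomial near both (\<open>layer_match\<close>). This gives the estimate for
  the top order, the continuity of all orders up to the boundary, and with Taylor's formula
  that each order is the derivative of the previous one. The values of the jets form a function v,
  and a covering argument shows that v = u almost everywhere. For \<open>j > l\<close> the exponent is negative
  and the derivatives may grow as the scale shrinks, but not faster than \<open>\<rho> powr (\<beta> - j)\<close>
  (\<open>high_derivative_bound\<close>), so cutting the Taylor polynomials at degree l costs
  \<open>O(\<rho> powr \<beta>)\<close> only (\<open>lower_degree\<close>). This is the isomorphism of the spaces for k and l.
\<close>

section \<open>Polynomial maps and their partial derivatives\<close>

lemma poly_fun_monomial:
  assumes "(\<Sum>i\<in>UNIV. a i) \<le> k"
  shows "poly_fun k (\<lambda>x::real^'n::finite. (\<Prod>i\<in>UNIV. (x $ i) ^ a i) *\<^sub>R (c::real^'m::finite))"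
proof -
  have "(\<Sum>b | (\<Sum>i\<in>UNIV. b i) \<le> k. (\<Prod>i\<in>UNIV. (x $ i) ^ b i) *\<^sub>R (if b = a then c else 0))
      = (\<Prod>i\<in>UNIV. (x $ i) ^ a i) *\<^sub>R c" for x :: "real^'n"
    using assms sum.delta[OF finite_multi_indices[of k], where a = a and b =
        "\<lambda>b. (\<Prod>i\<in>UNIV. (x $ i) ^ b i) *\<^sub>R c"]
    by (simp add: if_distrib cong: if_cong)
  then show ?thesis unfolding poly_fun_def by (intro exI[of _ "\<lambda>b. if b = a then c else 0"]) simp
qed

lemma poly_fun_add:
  assumes "poly_fun k p" "poly_fun k r"
  shows "poly_fun k (\<lambda>x. p x + r x)"
proof -
  obtain c d where "\<forall>x. p x = (\<Sum>a | (\<Sum>i\<in>UNIV. a i) \<le> k. (\<Prod>i\<in>UNIV. (x $ i) ^ a i) *\<^sub>R c a)"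
    "\<forall>x. r x = (\<Sum>a | (\<Sum>i\<in>UNIV. a i) \<le> k. (\<Prod>i\<in>UNIV. (x $ i) ^ a i) *\<^sub>R d a)"
    using assms unfolding poly_fun_def by blast
  then show ?thesis unfolding poly_fun_def
    by (intro exI[of _ "\<lambda>a. c a + d a"]) (simp add: sum.distrib scaleR_add_right)
qed

lemma poly_fun_scaleR:
  assumes "poly_fun k p"
  shows "poly_fun k (\<lambda>x. s *\<^sub>R p x)"
proof -
  obtain c where "\<forall>x. p x = (\<Sum>a | (\<Sum>i\<in>UNIV. a i) \<le> k. (\<Prod>i\<in>UNIV. (x $ i) ^ a i) *\<^sub>R c a)"
    using assms unfolding poly_fun_def by blast
  then show ?thesis unfolding poly_fun_def
    by (intro exI[of _ "\<lambda>a. s *\<^sub>R c a"]) (simp add: scaleR_sum_right mult.commute)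
qed

lemma poly_fun_const: "poly_fun k (\<lambda>x. c)"
  using poly_fun_monomial[of "\<lambda>i. 0" k c] by simp

lemma poly_fun_diff: "poly_fun k p \<Longrightarrow> poly_fun k r \<Longrightarrow> poly_fun k (\<lambda>x. p x - r x)"
  using poly_fun_add[OF _ poly_fun_scaleR[of k r "-1"], of p] by simp

lemma poly_fun_sum:
  assumes "\<And>a. a \<in> I \<Longrightarrow> poly_fun k (f a)"
  shows "poly_fun k (\<lambda>x. \<Sum>a\<in>I. f a x)"
  using assms by (induction I rule: infinite_finite_induct) (auto intro: poly_fun_const poly_fun_add)

lemma poly_fun_cases:
  assumes "poly_fun k p"
  obtains c where "p = (\<lambda>x. \<Sum>a | (\<Sum>i\<in>UNIV. a i) \<le> k. (\<Prod>i\<in>UNIV. (x $ i) ^ a i) *\<^sub>R c a)"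
proof -
  obtain c where "\<forall>x. p x = (\<Sum>a | (\<Sum>i\<in>UNIV. a i) \<le> k. (\<Prod>i\<in>UNIV. (x $ i) ^ a i) *\<^sub>R c a)"
    using assms unfolding poly_fun_def by blast
  then show ?thesis using that[of c] by (simp add: fun_eq_iff)
qed

lemma poly_fun_mono:
  assumes "poly_fun k p" "k \<le> k'"
  shows "poly_fun k' p"
proof -
  obtain c where p: "p = (\<lambda>x. \<Sum>a | (\<Sum>i\<in>UNIV. a i) \<le> k. (\<Prod>i\<in>UNIV. (x $ i) ^ a i) *\<^sub>R c a)"
    using assms(1) by (rule poly_fun_cases)
  show ?thesis unfolding p using assms(2) by (intro poly_fun_sum poly_fun_monomial) auto
qed

lemma monomial_Suc:
  fixes x :: "real^'n::finite"
  shows "(\<Prod>j\<in>UNIV. (x $ j) ^ (a(i := Suc (a i))) j) = x $ i * (\<Prod>j\<in>UNIV. (x $ j) ^ a j)"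
    and "(\<Sum>j\<in>UNIV. (a(i := Suc (a i))) j) = Suc (\<Sum>j\<in>UNIV. a j)"
proof -
  have "(\<Prod>j\<in>UNIV. (x $ j) ^ (a(i := Suc (a i))) j)
      = (x $ i) ^ Suc (a i) * (\<Prod>j\<in>UNIV - {i}. (x $ j) ^ (a(i := Suc (a i))) j)"
    by (subst prod.remove[of _ i]) auto
  also have "(\<Prod>j\<in>UNIV - {i}. (x $ j) ^ (a(i := Suc (a i))) j) = (\<Prod>j\<in>UNIV - {i}. (x $ j) ^ a j)"
    by (intro prod.cong) auto
  also have "(x $ i) ^ Suc (a i) * \<dots> = x $ i * (\<Prod>j\<in>UNIV. (x $ j) ^ a j)"
    by (subst (2) prod.remove[of _ i]) auto
  finally show "(\<Prod>j\<in>UNIV. (x $ j) ^ (a(i := Suc (a i))) j) = x $ i * (\<Prod>j\<in>UNIV. (x $ j) ^ a j)" .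
  have "(\<Sum>j\<in>UNIV. (a(i := Suc (a i))) j)
      = Suc (a i) + (\<Sum>j\<in>UNIV - {i}. (a(i := Suc (a i))) j)"
    by (subst sum.remove[of _ i]) auto
  also have "(\<Sum>j\<in>UNIV - {i}. (a(i := Suc (a i))) j) = (\<Sum>j\<in>UNIV - {i}. a j)"
    by (intro sum.cong) auto
  also have "Suc (a i) + \<dots> = Suc (\<Sum>j\<in>UNIV. a j)"
    by (subst (2) sum.remove[of _ i]) auto
  finally show "(\<Sum>j\<in>UNIV. (a(i := Suc (a i))) j) = Suc (\<Sum>j\<in>UNIV. a j)" .
qed

lemma poly_fun_mult_coord:
  assumes "poly_fun k p"
  shows "poly_fun (Suc k) (\<lambda>x. (x $ i) *\<^sub>R p x)"
proof -
  obtain c where p: "p = (\<lambda>x. \<Sum>a | (\<Sum>i\<in>UNIV. a i) \<le> k. (\<Prod>i\<in>UNIV. (x $ i) ^ a i) *\<^sub>R c a)"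
    using assms(1) by (rule poly_fun_cases)
  have "(\<lambda>x. (x $ i) *\<^sub>R p x) = (\<lambda>x. \<Sum>a | (\<Sum>i\<in>UNIV. a i) \<le> k.
      (\<Prod>j\<in>UNIV. (x $ j) ^ (a(i := Suc (a i))) j) *\<^sub>R c a)"
    unfolding p monomial_Suc by (simp add: scaleR_sum_right)
  then show ?thesis
    by (simp only:) (intro poly_fun_sum poly_fun_monomial, simp add: monomial_Suc(2) del: fun_upd_apply)
qed

text \<open>
  Polynomial maps are generated from constants by addition and multiplication with coordinates.
  This induction principle replaces all computation with multi-indices.
\<close>

lemma poly_fun_induct [consumes 1, case_names const add mult]:
  fixes p :: "real^'n::finite \<Rightarrow> real^'m::finite"
  assumes "poly_fun k p"
    and const: "\<And>k c. R k (\<lambda>x. c)"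
    and add: "\<And>k p r. poly_fun k p \<Longrightarrow> poly_fun k r \<Longrightarrow> R k p \<Longrightarrow> R k r \<Longrightarrow> R k (\<lambda>x. p x + r x)"
    and mult: "\<And>k p i. poly_fun k p \<Longrightarrow> R k p \<Longrightarrow> R (Suc k) (\<lambda>x. (x $ i) *\<^sub>R p x)"
  shows "R k p"
proof -
  have mono: "(\<Sum>i\<in>UNIV. a i) \<le> k \<Longrightarrow> R k (\<lambda>x. (\<Prod>i\<in>UNIV. (x $ i) ^ a i) *\<^sub>R c)" for k c and a :: "'n \<Rightarrow> nat"
  proof (induction "\<Sum>i\<in>UNIV. a i" arbitrary: a k)
    case 0
    then have "a = (\<lambda>i. 0)" by auto
    then show ?case using const by simp
  next
    case (Suc N)
    then obtain i where i: "a i > 0" by (metis sum.neutral neq0_conv nat.distinct(1))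
    define b where "b = a(i := a i - 1)"
    have ab: "a = b(i := Suc (b i))" using i by (auto simp: b_def)
    obtain k' where k: "k = Suc k'" using Suc by (cases k) auto
    have N: "N = (\<Sum>j\<in>UNIV. b j)" using Suc(2) ab monomial_Suc(2)[of b i] by simp
    have bk: "(\<Sum>j\<in>UNIV. b j) \<le> k'" using N Suc.hyps(2) Suc.prems k by linarith
    have "R (Suc k') (\<lambda>x. (x $ i) *\<^sub>R ((\<Prod>i\<in>UNIV. (x $ i) ^ b i) *\<^sub>R c))"
      by (intro mult poly_fun_monomial bk Suc.hyps(1) N)
    moreover have "(\<lambda>x. (x $ i) *\<^sub>R ((\<Prod>i\<in>UNIV. (x $ i) ^ b i) *\<^sub>R c)) = (\<lambda>x. (\<Prod>i\<in>UNIV. (x $ i) ^ a i) *\<^sub>R c)"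
      unfolding ab monomial_Suc by simp
    ultimately show ?case by (simp only: k)
  qed
  obtain c where p: "p = (\<lambda>x. \<Sum>a | (\<Sum>i\<in>UNIV. a i) \<le> k. (\<Prod>i\<in>UNIV. (x $ i) ^ a i) *\<^sub>R c a)"
    using assms(1) by (rule poly_fun_cases)
  have "R k (\<lambda>x. \<Sum>a\<in>I. (\<Prod>i\<in>UNIV. (x $ i) ^ a i) *\<^sub>R c a)"
    if "I \<subseteq> {a. (\<Sum>i\<in>UNIV. a i) \<le> k}" "finite I" for I
    using that(2,1)
  proof (induction I rule: finite_induct)
    case empty
    then show ?case using const by simp
  next
    case (insert a I)
    have "R k (\<lambda>x. (\<Prod>i\<in>UNIV. (x $ i) ^ a i) *\<^sub>R c a + (\<Sum>a\<in>I. (\<Prod>i\<in>UNIV. (x $ i) ^ a i) *\<^sub>R c a))"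
      using insert by (intro add mono poly_fun_monomial poly_fun_sum) auto
    then show ?case using insert by simp
  qed
  then show ?thesis unfolding p using finite_multi_indices by blast
qed

definition pderiv_coord :: "'n \<Rightarrow> (real^'n::finite \<Rightarrow> real^'m::finite) \<Rightarrow> real^'n \<Rightarrow> real^'m" where
  "pderiv_coord i p = (\<lambda>x. frechet_derivative p (at x) (axis i 1))"

text \<open>
  The order of the indices is that of \<open>tensor_affine\<close>: prepending an index differentiates once more.
\<close>

primrec part :: "'n list \<Rightarrow> (real^'n::finite \<Rightarrow> real^'m::finite) \<Rightarrow> real^'n \<Rightarrow> real^'m" where
  "part [] p = p"
| "part (i # is) p = pderiv_coord i (part is p)"

lemma pderiv_coord_eq:
  assumes "(p has_derivative (\<lambda>h. \<Sum>i\<in>UNIV. (h $ i) *\<^sub>R g i)) (at x)"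
  shows "pderiv_coord i p x = g i"
proof -
  have "frechet_derivative p (at x) = (\<lambda>h. \<Sum>i\<in>UNIV. (h $ i) *\<^sub>R g i)"
    using frechet_derivative_at[OF assms] by simp
  then show ?thesis by (simp add: pderiv_coord_def axis_def if_distrib[of "\<lambda>t. t *\<^sub>R _"] cong: if_cong)
qed

lemma poly_fun_has_derivative_aux:
  assumes "poly_fun k p"
  shows "\<exists>g. (\<forall>x. (p has_derivative (\<lambda>h. \<Sum>i\<in>UNIV. (h $ i) *\<^sub>R g i x)) (at x)) \<and>
     (\<forall>i. poly_fun (k - 1) (g i)) \<and> (k = 0 \<longrightarrow> (\<forall>i x. g i x = 0))"
  using assms
proof (induction rule: poly_fun_induct)
  case (const k c)
  show ?case by (rule exI[of _ "\<lambda>i x. 0"]) (auto intro: poly_fun_const)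
next
  case (add k p r)
  then obtain g g' where "\<And>x. (p has_derivative (\<lambda>h. \<Sum>i\<in>UNIV. (h $ i) *\<^sub>R g i x)) (at x)"
    "\<forall>i. poly_fun (k - 1) (g i)" "k = 0 \<longrightarrow> (\<forall>i x. g i x = 0)"
    "\<And>x. (r has_derivative (\<lambda>h. \<Sum>i\<in>UNIV. (h $ i) *\<^sub>R g' i x)) (at x)"
    "\<forall>i. poly_fun (k - 1) (g' i)" "k = 0 \<longrightarrow> (\<forall>i x. g' i x = 0)" by blast
  then show ?case
    by (intro exI[of _ "\<lambda>i x. g i x + g' i x"])
       (auto intro: poly_fun_add has_derivative_add simp: scaleR_add_right sum.distrib)
next
  case (mult k p i)
  then obtain g where g: "\<And>x. (p has_derivative (\<lambda>h. \<Sum>i\<in>UNIV. (h $ i) *\<^sub>R g i x)) (at x)"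
    "\<And>i. poly_fun (k - 1) (g i)" "k = 0 \<longrightarrow> (\<forall>i x. g i x = 0)" by blast
  let ?g = "\<lambda>j x. (if j = i then p x else 0) + (x $ i) *\<^sub>R g j x"
  have "((\<lambda>x. (x $ i) *\<^sub>R p x) has_derivative (\<lambda>h. \<Sum>j\<in>UNIV. (h $ j) *\<^sub>R ?g j x)) (at x)" for x
  proof -
    have "((\<lambda>x. (x $ i) *\<^sub>R p x) has_derivative
        (\<lambda>h. (x $ i) *\<^sub>R (\<Sum>i\<in>UNIV. (h $ i) *\<^sub>R g i x) + (h $ i) *\<^sub>R p x)) (at x)"
      by (rule has_derivative_scaleR[OF _ g(1)]) (rule bounded_linear_imp_has_derivative[OF bounded_linear_vec_nth])
    also have "(\<lambda>h. (x $ i) *\<^sub>R (\<Sum>i\<in>UNIV. (h $ i) *\<^sub>R g i x) + (h $ i) *\<^sub>R p x)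
       = (\<lambda>h. \<Sum>j\<in>UNIV. (h $ j) *\<^sub>R ?g j x)"
      by (auto simp: scaleR_add_right sum.distrib scaleR_sum_right mult.commute
            if_distrib[of "\<lambda>t. _ *\<^sub>R t"] cong: if_cong)
    finally show ?thesis .
  qed
  moreover have "poly_fun k (?g j)" for j
  proof (intro poly_fun_add)
    show "poly_fun k (\<lambda>x. if j = i then p x else 0)"
      using mult(1) by (cases "j = i") (auto intro: poly_fun_const)
    show "poly_fun k (\<lambda>x. (x $ i) *\<^sub>R g j x)"
    proof (cases "k = 0")
      case True
      then show ?thesis using g(3) by (auto intro: poly_fun_const)
    next
      case False
      then show ?thesis using poly_fun_mult_coord[OF g(2)[of j], of i] by simp
    qed
  qed
  ultimately show ?case by (intro exI[of _ ?g]) auto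
qed

lemma poly_fun_has_derivative:
  assumes "poly_fun k p"
  shows "(p has_derivative (\<lambda>h. \<Sum>i\<in>UNIV. (h $ i) *\<^sub>R pderiv_coord i p x)) (at x)"
    and "poly_fun (k - 1) (pderiv_coord i p)"
    and "k = 0 \<Longrightarrow> pderiv_coord i p x = 0"
proof -
  obtain g where g: "\<forall>x. (p has_derivative (\<lambda>h. \<Sum>i\<in>UNIV. (h $ i) *\<^sub>R g i x)) (at x)"
    "\<forall>i. poly_fun (k - 1) (g i)" "k = 0 \<longrightarrow> (\<forall>i x. g i x = 0)"
    using poly_fun_has_derivative_aux[OF assms] by blast
  have "pderiv_coord i p = g i" for i
  proof
    show "pderiv_coord i p x = g i x" for x by (rule pderiv_coord_eq) (use g(1) in blast)
  qed
  then show "(p has_derivative (\<lambda>h. \<Sum>i\<in>UNIV. (h $ i) *\<^sub>R pderiv_coord i p x)) (at x)"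
    "poly_fun (k - 1) (pderiv_coord i p)" "k = 0 \<Longrightarrow> pderiv_coord i p x = 0"
    using g by auto
qed

lemma poly_fun_continuous: "poly_fun k p \<Longrightarrow> continuous_on S p"
  using has_derivative_continuous[OF poly_fun_has_derivative(1)]
  by (auto intro: continuous_at_imp_continuous_on)

lemma poly_fun_part: "poly_fun k p \<Longrightarrow> poly_fun (k - length is) (part is p)"
proof (induction "is")
  case (Cons i "is")
  then show ?case using poly_fun_has_derivative(2)[of "k - length is" "part is p" i] by simp
qed simp

lemma poly_fun_part': "poly_fun k p \<Longrightarrow> poly_fun k (part is p)"
  using poly_fun_part poly_fun_mono diff_le_self by metis

lemma part_eq_0:
  assumes "poly_fun k p" "length is > k"
  shows "part is p x = 0"
  using assms(2)
proof (induction "is" arbitrary: x)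
  case (Cons i "is")
  show ?case
  proof (cases "length is > k")
    case True
    then have "part is p = (\<lambda>x. 0)" using Cons by auto
    then show ?thesis using pderiv_coord_eq[of "\<lambda>x. 0" "\<lambda>i. 0" x i] by simp
  next
    case False
    then have "poly_fun 0 (part is p)" using poly_fun_part[OF assms(1), of "is"] Cons(2) by simp
    then show ?thesis using poly_fun_has_derivative(3) by auto
  qed
qed simp

lemma part_top_const:
  assumes "poly_fun k p" "length is = k"
  shows "part is p x = part is p y"
proof -
  have "poly_fun 0 (part is p)" using poly_fun_part[OF assms(1), of "is"] assms(2) by simp
  then obtain c where "part is p = (\<lambda>x. \<Sum>a | (\<Sum>i\<in>UNIV. a i) \<le> 0. (\<Prod>i\<in>UNIV. (x $ i) ^ a i) *\<^sub>R c a)"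
    by (rule poly_fun_cases)
  then show ?thesis by (simp add: sum.neutral)
qed

lemma part_diff:
  assumes "poly_fun k p" "poly_fun k r"
  shows "part is (\<lambda>x. p x - r x) x = part is p x - part is r x"
proof (induction "is" arbitrary: x)
  case (Cons i "is")
  have "part is (\<lambda>x. p x - r x) = (\<lambda>x. part is p x - part is r x)" using Cons by auto
  moreover have "((\<lambda>x. part is p x - part is r x) has_derivative (\<lambda>h. \<Sum>i\<in>UNIV.
      (h $ i) *\<^sub>R (pderiv_coord i (part is p) x - pderiv_coord i (part is r) x))) (at x)"
    using has_derivative_diff[OF poly_fun_has_derivative(1)[OF poly_fun_part[OF assms(1)]]
       poly_fun_has_derivative(1)[OF poly_fun_part[OF assms(2)]]]
    by (simp add: scaleR_diff_right sum_subtractf)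
  ultimately show ?case using pderiv_coord_eq by simp
qed simp

lemma part_append: "part (js @ is) p = part js (part is p)"
  by (induction js) auto

section \<open>Taylor's formula for polynomial maps\<close>

definition dir_prod :: "real^'n::finite \<Rightarrow> 'n list \<Rightarrow> real" where
  "dir_prod h is = prod_list (map (($) h) is)"

lemma dir_prod_simps [simp]: "dir_prod h [] = 1" "dir_prod h (i # is) = h $ i * dir_prod h is"
  by (auto simp: dir_prod_def)

lemma abs_dir_prod_le: "\<bar>dir_prod h is\<bar> \<le> norm h ^ length is"
  by (induction "is") (auto simp: abs_mult intro!: mult_mono component_le_norm_cart)

lemma sum_lists_Suc:
  fixes f :: "'n::finite list \<Rightarrow> 'b::comm_monoid_add"
  shows "(\<Sum>is | length is = Suc j. f is) = (\<Sum>is | length is = j. \<Sum>i\<in>UNIV. f (i # is))"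
proof -
  have e: "{is :: 'n list. length is = Suc j} = (\<lambda>(is, i). i # is) ` ({is. length is = j} \<times> UNIV)"
    by (auto simp: length_Suc_conv image_iff)
  have "inj_on (\<lambda>(is, i). i # is) ({is :: 'n list. length is = j} \<times> UNIV)" by (auto simp: inj_on_def)
  then show ?thesis
    unfolding e by (simp add: sum.reindex sum.cartesian_product split_def comp_def)
qed

text \<open>
  All lists of j indices are summed over, each mixed derivative once for each order of the
  differentiations; so the coefficients are those of Taylor's formula for the restriction to the line
  through y and y + h.
\<close>

lemma poly_fun_taylor:
  fixes p :: "real^'n::finite \<Rightarrow> real^'m::finite"
  assumes "poly_fun k p"
  shows "p (y + h) = (\<Sum>j\<le>k. (1 / fact j) *\<^sub>R (\<Sum>is | length is = j. dir_prod h is *\<^sub>R part is p y))"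
proof (rule vec_eq_iff[THEN iffD2], rule allI)
  fix c :: 'm
  define diff where "diff j s = (\<Sum>is | length is = j. dir_prod h is * part is p (y + s *\<^sub>R h) $ c)"
    for j and s :: real
  have D: "DERIV (diff j) s :> diff (Suc j) s" for j s
  proof -
    have "((\<lambda>s. part is p (y + s *\<^sub>R h) $ c) has_real_derivative
        (\<Sum>i\<in>UNIV. h $ i * part (i # is) p (y + s *\<^sub>R h) $ c)) (at s)" for "is" s
    proof -
      let ?F = "\<lambda>v. \<Sum>i\<in>UNIV. (v $ i) *\<^sub>R part (i # is) p (y + s *\<^sub>R h)"
      have 1: "((\<lambda>s. y + s *\<^sub>R h) has_derivative (\<lambda>t. t *\<^sub>R h)) (at s)"
        by (auto intro!: derivative_eq_intros)
      have "(part is p has_derivative ?F) (at (y + s *\<^sub>R h))"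
        using poly_fun_has_derivative(1)[OF poly_fun_part[OF assms]] by simp
      then have "((\<lambda>s. part is p (y + s *\<^sub>R h)) has_derivative (\<lambda>t. ?F (t *\<^sub>R h))) (at s)"
        using has_derivative_compose[OF 1, of "part is p" ?F] by simp
      then have "((\<lambda>s. part is p (y + s *\<^sub>R h) $ c) has_derivative (\<lambda>t. ?F (t *\<^sub>R h) $ c)) (at s)"
        by (rule bounded_linear.has_derivative[OF bounded_linear_vec_nth])
      moreover have "(\<lambda>t. ?F (t *\<^sub>R h) $ c) = (*) (\<Sum>i\<in>UNIV. h $ i * part (i # is) p (y + s *\<^sub>R h) $ c)"
        by (auto simp: sum_component fun_eq_iff sum_distrib_left mult_ac)
      ultimately show ?thesis by (simp add: has_field_derivative_def)
    qed
    then have "DERIV (diff j) s :> (\<Sum>is | length is = j. dir_prod h is *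
        (\<Sum>i\<in>UNIV. h $ i * part (i # is) p (y + s *\<^sub>R h) $ c))"
      unfolding diff_def by (intro DERIV_sum DERIV_cmult)
    also have "(\<Sum>is | length is = j. dir_prod h is *
        (\<Sum>i\<in>UNIV. h $ i * part (i # is) p (y + s *\<^sub>R h) $ c)) = diff (Suc j) s"
      unfolding diff_def sum_lists_Suc by (simp add: sum_distrib_left algebra_simps)
    finally show ?thesis .
  qed
  obtain t where t: "diff 0 1 = (\<Sum>m<Suc k. (diff m 0 / fact m) * 1 ^ m) + (diff (Suc k) t / fact (Suc k)) * 1 ^ (Suc k)"
    using Maclaurin_all_le[of diff "diff 0" 1 "Suc k"] D by blast
  have "diff (Suc k) t = 0"
    unfolding diff_def using part_eq_0[OF assms] by (intro sum.neutral) auto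
  moreover have "diff 0 1 = p (y + h) $ c" by (simp add: diff_def)
  ultimately have "p (y + h) $ c = (\<Sum>m\<le>k. diff m 0 / fact m)"
    using t by (simp add: lessThan_Suc_atMost)
  then show "p (y + h) $ c = (\<Sum>j\<le>k. (1 / fact j) *\<^sub>R (\<Sum>is | length is = j. dir_prod h is *\<^sub>R part is p y)) $ c"
    by (simp add: diff_def sum_component)
qed

section \<open>A Remez inequality for polynomial maps on sets of positive measure\<close>

text \<open>
  The weights are the coefficients of degree e of the Lagrange basis polynomials. They extract the
  coefficient of degree e of a polynomial of degree at most k from k + 1 of its values: e = 0
  serves for extrapolation to 0, and e = 1 for the derivative at 0.
\<close>

lemma interpolation_weights:
  fixes s :: "'a \<Rightarrow> real"
  assumes "finite I" "card I = Suc k" "inj_on s I"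
  shows "\<exists>w. \<forall>d\<le>k. (\<Sum>i\<in>I. w i * s i ^ d) = (if d = e then 1 else 0)"
proof -
  define L where "L i = (\<Prod>j\<in>I - {i}. smult (1 / (s i - s j)) [:- s j, 1:])" for i
  have deg: "degree (L i) \<le> k" if "i \<in> I" for i
  proof -
    have "degree (L i) \<le> (\<Sum>j\<in>I - {i}. degree (smult (1 / (s i - s j)) [:- s j, 1:]))"
      unfolding L_def 
      by (rule order_trans[OF degree_prod_sum_le]) (use assms(1) in \<open>simp_all add: o_def\<close>)
    also have "\<dots> \<le> (\<Sum>j\<in>I - {i}. 1)" by (intro sum_mono) auto
    also have "\<dots> = k" using assms that by simp
    finally show ?thesis .
  qed
  have val: "poly (L i) (s j) = (if i = j then 1 else 0)" if "i \<in> I" "j \<in> I" for i j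
  proof (cases "i = j")
    case True
    have "poly (L i) (s i) = (\<Prod>j\<in>I - {i}. 1)"
      unfolding L_def poly_prod
      by (intro prod.cong refl) (use assms(3) that in \<open>auto simp: inj_on_def diff_divide_distrib[symmetric]\<close>)
    then show ?thesis using True by simp
  next
    case False
    then have "\<exists>x\<in>I - {i}. poly (smult (1 / (s i - s x)) [:- s x, 1:]) (s j) = 0"
      using that by (intro bexI[of _ j]) auto
    then have "poly (L i) (s j) = 0"
      unfolding L_def poly_prod using assms(1) by (subst prod_zero_iff) auto
    then show ?thesis using False by simp
  qed
  have "monom 1 d = (\<Sum>i\<in>I. smult (s i ^ d) (L i))" if "d \<le> k" for d
  proof (rule poly_eqI_degree[of "s ` I"])
    fix x assume "x \<in> s ` I"
    then obtain j where j: "j \<in> I" "x = s j" by blast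
    have "poly (\<Sum>i\<in>I. smult (s i ^ d) (L i)) x = (\<Sum>i\<in>I. if i = j then s i ^ d else 0)"
      unfolding poly_sum j(2) by (intro sum.cong) (auto simp: val j)
    then show "poly (monom 1 d) x = poly (\<Sum>i\<in>I. smult (s i ^ d) (L i)) x"
      using assms(1) j by (simp add: poly_monom)
  next
    have c: "card (s ` I) = Suc k" using assms by (simp add: card_image)
    show "degree (monom 1 d :: real poly) < card (s ` I)"
      using c that degree_monom_le[of "1::real" d] by simp
    have "degree (\<Sum>i\<in>I. smult (s i ^ d) (L i)) \<le> k"
      by (intro degree_sum_le assms(1)) (use deg degree_smult_le le_trans in blast)
    then show "degree (\<Sum>i\<in>I. smult (s i ^ d) (L i)) < card (s ` I)" using c by simp
  qed
  then have "coeff (monom 1 d) e = coeff (\<Sum>i\<in>I. smult (s i ^ d) (L i)) e" if "d \<le> k" for d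
    using that by simp
  then show ?thesis
    by (intro exI[of _ "\<lambda>i. coeff (L i) e"]) (simp add: coeff_sum mult.commute)
qed

text \<open>The sum of the measures is the integral over B of the number of sets that contain a point.\<close>

lemma measure_pigeonhole:
  fixes B :: "'a::euclidean_space set"
  assumes I: "finite I" "\<And>i. i \<in> I \<Longrightarrow> E i \<in> lmeasurable" "\<And>i. i \<in> I \<Longrightarrow> E i \<subseteq> B"
    and B: "B \<in> lmeasurable"
    and less: "real k * measure lebesgue B < (\<Sum>i\<in>I. measure lebesgue (E i))"
  obtains x where "k < card {i \<in> I. x \<in> E i}"
proof -
  have "\<exists>x. k < card {i \<in> I. x \<in> E i}"
  proof (rule ccontr)
    assume "\<not> ?thesis"
    then have le: "card {i \<in> I. x \<in> E i} \<le> k" for x by (meson not_less)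
    have "(\<Sum>i\<in>I. measure lebesgue (E i)) = (\<Sum>i\<in>I. integral\<^sup>L lebesgue (indicator (E i) :: 'a \<Rightarrow> real))"
      using I(2) by (intro sum.cong) (auto simp: fmeasurable_def)
    also have "\<dots> = integral\<^sup>L lebesgue (\<lambda>x. \<Sum>i\<in>I. indicator (E i) x :: real)"
      using I(2) by (intro Bochner_Integration.integral_sum[symmetric]) (simp add: lmeasurable_iff_integrable)
    also have "\<dots> \<le> integral\<^sup>L lebesgue (\<lambda>x. real k * indicator B x :: real)"
    proof (rule integral_mono)
      show "integrable lebesgue (\<lambda>x. \<Sum>i\<in>I. indicator (E i) x :: real)"
        using I(2) by (intro Bochner_Integration.integrable_sum) (simp add: lmeasurable_iff_integrable)
      show "integrable lebesgue (\<lambda>x. real k * indicator B x :: real)"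
        using B by (simp add: lmeasurable_iff_integrable)
      fix x
      have "(\<Sum>i\<in>I. indicator (E i) x :: real) = real (card {i \<in> I. x \<in> E i})"
        using I(1) by (simp add: indicator_def sum.If_cases Int_def)
      then show "(\<Sum>i\<in>I. indicator (E i) x :: real) \<le> real k * indicator B x"
      proof (cases "x \<in> B")
        case False
        then have "{i \<in> I. x \<in> E i} = {}" using I(3) by blast
        then show ?thesis using \<open>(\<Sum>i\<in>I. indicator (E i) x :: real) = _\<close> by simp
      qed (use le[of x] in simp)
    qed
    also have "\<dots> = real k * measure lebesgue B" using B by (simp add: fmeasurable_def)
    finally show False using less by simp
  qed
  then show ?thesis using that by blast
qed

lemma dir_prod_scaleR: "dir_prod (s *\<^sub>R v) is = s ^ length is * dir_prod v is"
  by (induction "is") auto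

lemma poly_fun_line:
  fixes p :: "real^'n::finite \<Rightarrow> real^'m::finite"
  assumes "poly_fun k p"
  obtains c where "c 0 = p y" "c 1 = (\<Sum>i\<in>UNIV. (v $ i) *\<^sub>R pderiv_coord i p y)"
    "\<And>s. p (y + s *\<^sub>R v) = (\<Sum>j\<le>k. s ^ j *\<^sub>R c j)"
proof
  let ?c = "\<lambda>j. (1 / fact j) *\<^sub>R (\<Sum>is | length is = j. dir_prod v is *\<^sub>R part is p y)"
  show "?c 0 = p y" by simp
  show "?c 1 = (\<Sum>i\<in>UNIV. (v $ i) *\<^sub>R pderiv_coord i p y)"
    unfolding One_nat_def sum_lists_Suc by simp
  fix s
  have "(\<Sum>is | length is = j. dir_prod (s *\<^sub>R v) is *\<^sub>R part is p y)
     = s ^ j *\<^sub>R (\<Sum>is | length is = j. dir_prod v is *\<^sub>R part is p y)" for j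
    unfolding scaleR_sum_right by (intro sum.cong) (auto simp: dir_prod_scaleR)
  then show "p (y + s *\<^sub>R v) = (\<Sum>j\<le>k. s ^ j *\<^sub>R ?c j)"
    unfolding poly_fun_taylor[OF assms, of y "s *\<^sub>R v"] by (simp add: mult.commute)
qed

lemma weighted_sum_powers:
  assumes "\<And>d. d \<le> k \<Longrightarrow> (\<Sum>i\<in>I. w i * s i ^ d) = (if d = e then 1 else 0)" "e \<le> k"
  shows "(\<Sum>i\<in>I. w i *\<^sub>R (\<Sum>j\<le>k. s i ^ j *\<^sub>R (c j :: 'b::real_vector))) = c e"
proof -
  have "(\<Sum>i\<in>I. w i *\<^sub>R (\<Sum>j\<le>k. s i ^ j *\<^sub>R c j)) = (\<Sum>j\<le>k. (\<Sum>i\<in>I. w i * s i ^ j) *\<^sub>R c j)"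
    unfolding scaleR_sum_right scaleR_sum_left by (subst sum.swap) simp
  also have "\<dots> = (\<Sum>j\<le>k. if j = e then c j else 0)"
    by (intro sum.cong) (auto simp: assms(1))
  also have "\<dots> = c e" using assms(2) by simp
  finally show ?thesis .
qed

lemma norm_weighted_sum_le:
  assumes "\<And>i. i \<in> I \<Longrightarrow> norm (f i :: 'b::real_normed_vector) \<le> c"
  shows "norm (\<Sum>i\<in>I. w i *\<^sub>R f i) \<le> (\<Sum>i\<in>I. \<bar>w i\<bar>) * c"
  unfolding sum_distrib_right
  by (rule order_trans[OF norm_sum]) (auto intro!: sum_mono mult_left_mono assms)

text \<open>
  The value at y is extrapolated along a line through y on which sufficiently many points
  of E lie. Such a line exists by counting: the dilations of E with centre y by the
  factors \<open>1 / s\<close>, for N numbers s between 1/2 and 1, are subsets of one ball, and for large N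
  their measures add up to more than k times that of the ball. So some x is a point of k + 1
  dilations; that is, the points \<open>y + s (x - y)\<close> belong to E for k + 1 values of s.
\<close>

lemma remez_inequality:
  assumes A: "A > 0" and R: "R \<ge> 0"
  shows "\<exists>C>0. \<forall>(p :: real^'n::finite \<Rightarrow> real^'m::finite) E z \<rho> c y.
     poly_fun k p \<longrightarrow> 0 < \<rho> \<longrightarrow> E \<in> lmeasurable \<longrightarrow> E \<subseteq> ball z \<rho> \<longrightarrow>
     A * \<rho> ^ CARD('n) \<le> measure lebesgue E \<longrightarrow> (\<forall>x\<in>E. norm (p x) \<le> c) \<longrightarrow> dist z y \<le> R * \<rho> \<longrightarrow>
     norm (p y) \<le> C * c"
proof -
  define \<omega> where "\<omega> = measure lborel (ball (0 :: real^'n) 1)"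
  obtain N :: nat where N: "real k * ((3 * R + 3) ^ CARD('n) * \<omega>) < N * A"
    using reals_Archimedean3[OF A] by blast
  have "\<omega> \<ge> 0" by (simp add: \<omega>_def)
  then have N0: "N > 0" using N R A by (intro Nat.gr0I) (auto simp: not_less mult_less_0_iff)
  define s where "s i = (real N + real i) / (2 * real N)" for i :: nat
  have s: "1/2 \<le> s i" "s i \<le> 1" if "i < N" for i using that N0 by (auto simp: s_def field_simps)
  have inj: "inj_on s {..<N}" using N0 by (auto simp: inj_on_def s_def)
  have "\<exists>w. I \<subseteq> {..<N} \<longrightarrow> card I = Suc k \<longrightarrow>
      (\<forall>d\<le>k. (\<Sum>i\<in>I. w i * s i ^ d) = (if d = 0 then 1 else 0))" for I
    using interpolation_weights[of I k s 0] finite_subset[of I "{..<N}"] inj_on_subset[OF inj, of I]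
    by auto
  then obtain w where w: "\<And>I d. I \<subseteq> {..<N} \<Longrightarrow> card I = Suc k \<Longrightarrow> d \<le> k \<Longrightarrow>
      (\<Sum>i\<in>I. w I i * s i ^ d) = (if d = 0 then 1 else 0)" by metis
  define C where "C = 1 + (\<Sum>I\<in>Pow {..<N}. \<Sum>i\<in>I. \<bar>w I i\<bar>)"
  have C: "C > 0" unfolding C_def by (intro add_pos_nonneg sum_nonneg) auto
  have "norm (p y) \<le> C * c"
    if p: "poly_fun k p" and \<rho>: "0 < \<rho>" and E: "E \<in> lmeasurable" "E \<subseteq> ball z \<rho>"
      "A * \<rho> ^ CARD('n) \<le> measure lebesgue E" and c: "\<forall>x\<in>E. norm (p x) \<le> c" and y: "dist z y \<le> R * \<rho>"
    for p :: "real^'n \<Rightarrow> real^'m" and E z \<rho> c y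
  proof -
    define F where "F i = (\<lambda>x. (1 / s i) *\<^sub>R x + (y - (1 / s i) *\<^sub>R y)) ` E" for i
    define B where "B = ball z ((3 * R + 3) * \<rho>)"
    have F: "F i \<in> lmeasurable" "F i \<subseteq> B" "A * \<rho> ^ CARD('n) \<le> measure lebesgue (F i)" if i: "i < N" for i
    proof -
      have si: "1 \<le> 1 / s i" "1 / s i \<le> 2" using s[OF i] by (auto simp: field_simps)
      have "F i = (\<lambda>x. (y - (1 / s i) *\<^sub>R y) + x) ` (\<lambda>x. (1 / s i) *\<^sub>R x) ` E"
        by (auto simp: F_def image_image add.commute)
      moreover have "(\<lambda>x. (1 / s i) *\<^sub>R x) ` E = (\<lambda>x. s i *\<^sub>R x) -` E \<inter> space lebesgue"
      proof (intro set_eqI iffI)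
        fix x assume "x \<in> (\<lambda>x. s i *\<^sub>R x) -` E \<inter> space lebesgue"
        then have "s i *\<^sub>R x \<in> E" by simp
        moreover have "x = (1 / s i) *\<^sub>R (s i *\<^sub>R x)" using si by auto
        ultimately show "x \<in> (\<lambda>x. (1 / s i) *\<^sub>R x) ` E" by (rule rev_image_eqI)
      qed (use si in auto)
      then have "(\<lambda>x. (1 / s i) *\<^sub>R x) ` E \<in> sets lebesgue"
        using measurable_sets[OF lebesgue_measurable_scaling fmeasurableD[OF E(1)]] by (simp only:)
      ultimately have "F i \<in> sets lebesgue" by (simp only: lebesgue_sets_translation)
      moreover have "emeasure lebesgue (F i) = \<bar>1 / s i\<bar> ^ DIM(real^'n) * emeasure lebesgue E"
        unfolding F_def by (rule emeasure_lebesgue_affine)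
      then have "emeasure lebesgue (F i) < \<infinity>"
        using E(1) by (simp add: fmeasurable_def ennreal_mult_less_top del: emeasure_completion)
      ultimately show "F i \<in> lmeasurable" by (simp add: fmeasurable_def)
      have "measure lebesgue (F i) = \<bar>1 / s i\<bar> ^ DIM(real^'n) * measure lebesgue E"
        unfolding F_def by (rule measure_lebesgue_affine)
      moreover have "1 \<le> \<bar>1 / s i\<bar> ^ DIM(real^'n)" using si by (intro one_le_power) linarith
      ultimately have "measure lebesgue E \<le> measure lebesgue (F i)"
        by (metis measure_nonneg mult_right_mono mult_1)
      then show "A * \<rho> ^ CARD('n) \<le> measure lebesgue (F i)" using E(3) by linarith
      show "F i \<subseteq> B"
      proof
        fix x assume "x \<in> F i"
        then obtain e where e: "e \<in> E" "x = (1 / s i) *\<^sub>R e + (y - (1 / s i) *\<^sub>R y)" by (auto simp: F_def)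
        have "x - y = (1 / s i) *\<^sub>R (e - y)" unfolding e(2) by (simp add: algebra_simps)
        then have "dist y x = \<bar>1 / s i\<bar> * dist e y" by (metis dist_norm norm_minus_commute norm_scaleR)
        also have "\<dots> \<le> 2 * (dist z e + dist z y)"
          using si dist_triangle[of e y z] by (intro mult_mono) (auto simp: dist_commute)
        also have "\<dots> < 2 * (\<rho> + R * \<rho>)" using E(2) e(1) y by auto
        finally show "x \<in> B" using y dist_triangle[of z x y] \<rho> R
          by (simp add: B_def algebra_simps)
      qed
    qed
    have "real k * measure lebesgue B = real k * ((3 * R + 3) ^ CARD('n) * \<omega>) * \<rho> ^ CARD('n)"
      using content_ball_conv_unit_ball[of "(3 * R + 3) * \<rho>" z] \<rho> R
      by (simp add: B_def \<omega>_def power_mult_distrib mult_ac)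
    also have "\<dots> < N * A * \<rho> ^ CARD('n)" using N \<rho> by (intro mult_strict_right_mono) auto
    also have "\<dots> = (\<Sum>i<N. A * \<rho> ^ CARD('n))" by simp
    also have "\<dots> \<le> (\<Sum>i<N. measure lebesgue (F i))" by (intro sum_mono F) auto
    finally obtain x where "k < card {i \<in> {..<N}. x \<in> F i}"
      using measure_pigeonhole[of "{..<N}" F B k] F by (auto simp: B_def)
    then obtain I where I: "I \<subseteq> {i \<in> {..<N}. x \<in> F i}" "card I = Suc k"
      by (metis Suc_leI obtain_subset_with_card_n)
    then have IN: "I \<subseteq> {..<N}" by auto
    obtain c' where c': "c' 0 = p y" "\<And>s. p (y + s *\<^sub>R (x - y)) = (\<Sum>j\<le>k. s ^ j *\<^sub>R c' j)"
      by (rule poly_fun_line[OF p, of y "x - y"]) blast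
    have pc: "norm (p (y + s i *\<^sub>R (x - y))) \<le> c" if "i \<in> I" for i
    proof -
      have "x \<in> F i" using I(1) that by blast
      then obtain e where e: "e \<in> E" "x = (1 / s i) *\<^sub>R e + (y - (1 / s i) *\<^sub>R y)"
        unfolding F_def by blast
      have "s i \<noteq> 0" using s[of i] IN that by auto
      then have "y + s i *\<^sub>R (x - y) = e" unfolding e(2) by (simp add: algebra_simps)
      then show ?thesis using c e(1) by simp
    qed
    have "p y = (\<Sum>i\<in>I. w I i *\<^sub>R p (y + s i *\<^sub>R (x - y)))"
      unfolding c'(2) 
      using weighted_sum_powers[where k = k and I = I and w = "w I" and s = s and e = 0 and c = c'] w IN I(2) c'(1)
      by simp
    then have "norm (p y) \<le> (\<Sum>i\<in>I. \<bar>w I i\<bar>) * c" 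
      using norm_weighted_sum_le[where I = I and w = "w I", OF pc] by simp
    also have "\<dots> \<le> C * c"
    proof (rule mult_right_mono)
      show "(\<Sum>i\<in>I. \<bar>w I i\<bar>) \<le> C"
        unfolding C_def using member_le_sum[of I "Pow {..<N}" "\<lambda>I. \<Sum>i\<in>I. \<bar>w I i\<bar>"] IN
        by (simp add: sum_nonneg add_increasing)
      have "I \<noteq> {}" using I(2) by auto
      then show "0 \<le> c" using pc norm_ge_zero order_trans by blast
    qed
    finally show ?thesis .
  qed
  then show ?thesis using C by blast
qed

text \<open>
  An inequality of Markov type: a partial derivative at y is a fixed combination of the values at
  the k + 1 equidistant points y, \<open>y + \<rho> e\<^sub>i\<close>, ..., \<open>y + k \<rho> e\<^sub>i\<close>.
\<close>

lemma markov_inequality: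
  shows "\<exists>C>0. \<forall>(p :: real^'n::finite \<Rightarrow> real^'m::finite) z R \<rho> c i y.
     poly_fun k p \<longrightarrow> 0 < \<rho> \<longrightarrow> (\<forall>x. dist z x \<le> (R + real k) * \<rho> \<longrightarrow> norm (p x) \<le> c) \<longrightarrow>
     dist z y \<le> R * \<rho> \<longrightarrow> norm (pderiv_coord i p y) \<le> C * (c / \<rho>)"
proof -
  obtain w where w: "\<And>d. d \<le> k \<Longrightarrow> (\<Sum>i\<le>k. w i * real i ^ d) = (if d = 1 then 1 else 0)"
    using interpolation_weights[of "{..k}" k real 1] by auto
  define C where "C = 1 + (\<Sum>i\<le>k. \<bar>w i\<bar>)"
  have C: "C > 0" unfolding C_def by (intro add_pos_nonneg sum_nonneg) auto
  have "norm (pderiv_coord i p y) \<le> C * (c / \<rho>)"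
    if p: "poly_fun k p" and \<rho>: "0 < \<rho>" and c: "\<And>x. dist z x \<le> (R + real k) * \<rho> \<Longrightarrow> norm (p x) \<le> c"
      and y: "dist z y \<le> R * \<rho>"
    for p :: "real^'n \<Rightarrow> real^'m" and z R \<rho> c i y
  proof -
    have b: "norm (p (y + real j *\<^sub>R \<rho> *\<^sub>R axis i 1)) \<le> c" if "j \<le> k" for j
    proof (rule c)
      have "dist z (y + real j *\<^sub>R \<rho> *\<^sub>R axis i 1) \<le> dist z y + dist y (y + real j *\<^sub>R \<rho> *\<^sub>R axis i 1)"
        by (rule dist_triangle)
      also have "dist y (y + real j *\<^sub>R \<rho> *\<^sub>R axis i 1) = real j * \<rho>"
        using \<rho> by (simp add: dist_norm)
      also have "dist z y + real j * \<rho> \<le> R * \<rho> + real k * \<rho>" using y that \<rho> by (intro add_mono) auto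
      finally show "dist z (y + real j *\<^sub>R \<rho> *\<^sub>R axis i 1) \<le> (R + real k) * \<rho>" by (simp add: algebra_simps)
    qed
    have c0: "c \<ge> 0" using b[of 0] norm_ge_zero order_trans by blast
    show ?thesis
    proof (cases "k = 0")
      case True
      then show ?thesis using poly_fun_has_derivative(3)[OF p] c0 \<rho> C by simp
    next
      case False
      obtain c' where "c' 0 = p y"
        and c': "c' 1 = (\<Sum>j\<in>UNIV. ((\<rho> *\<^sub>R axis i 1 :: real^'n) $ j) *\<^sub>R pderiv_coord j p y)"
          "\<And>s. p (y + s *\<^sub>R \<rho> *\<^sub>R axis i 1) = (\<Sum>j\<le>k. s ^ j *\<^sub>R c' j)"
        by (rule poly_fun_line[OF p, of y "\<rho> *\<^sub>R axis i 1"]) metis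
      have "c' 1 = \<rho> *\<^sub>R pderiv_coord i p y"
      proof -
        have "(\<Sum>j\<in>UNIV. ((\<rho> *\<^sub>R axis i 1 :: real^'n) $ j) *\<^sub>R pderiv_coord j p y)
            = (\<Sum>j\<in>UNIV. if j = i then \<rho> *\<^sub>R pderiv_coord j p y else 0)"
          by (intro sum.cong) (auto simp: axis_def)
        then show ?thesis unfolding c'(1) by simp
      qed
      moreover have "(\<Sum>j\<le>k. w j *\<^sub>R p (y + real j *\<^sub>R \<rho> *\<^sub>R axis i 1)) = c' 1"
        unfolding c'(2) by (rule weighted_sum_powers) (use w False in auto)
      ultimately have "norm (\<rho> *\<^sub>R pderiv_coord i p y) \<le> (\<Sum>i\<le>k. \<bar>w i\<bar>) * c"
        using norm_weighted_sum_le[where I = "{..k}" and w = w and c = c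
            and f = "\<lambda>j. p (y + real j *\<^sub>R \<rho> *\<^sub>R axis i 1)"] b by simp
      also have "\<dots> \<le> C * c" using c0 by (intro mult_right_mono) (auto simp: C_def)
      finally show ?thesis using \<rho> by (simp add: field_simps)
    qed
  qed
  then show ?thesis using C by blast
qed

text \<open>
  Each differentiation by Markov's inequality needs bounds on a larger ball. The Remez inequality
  provides them on balls of any size.
\<close>

lemma remez_inequality_part:
  assumes A: "A > 0"
  shows "\<exists>C>0. \<forall>(p :: real^'n::finite \<Rightarrow> real^'m::finite) E z \<rho> c y is.
     poly_fun k p \<longrightarrow> 0 < \<rho> \<longrightarrow> E \<in> lmeasurable \<longrightarrow> E \<subseteq> ball z \<rho> \<longrightarrow>
     A * \<rho> ^ CARD('n) \<le> measure lebesgue E \<longrightarrow> (\<forall>x\<in>E. norm (p x) \<le> c) \<longrightarrow> dist z y \<le> R * \<rho> \<longrightarrow>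
     length is \<le> k \<longrightarrow> norm (part is p y) \<le> C * (c / \<rho> ^ length is)"
proof -
  let ?hyp = "\<lambda>(p :: real^'n \<Rightarrow> real^'m) E z \<rho> c. poly_fun k p \<and> 0 < \<rho> \<and> E \<in> lmeasurable \<and> E \<subseteq> ball z \<rho> \<and>
     A * \<rho> ^ CARD('n) \<le> measure lebesgue E \<and> (\<forall>x\<in>E. norm (p x) \<le> c)"
  have "\<exists>C>0. \<forall>p E z \<rho> c y is. ?hyp p E z \<rho> c \<longrightarrow> dist z y \<le> R * \<rho> \<longrightarrow>
     length is = j \<longrightarrow> norm (part is p y) \<le> C * (c / \<rho> ^ j)" if "R \<ge> 0" for j R
    using that
  proof (induction j arbitrary: R)
    case 0
    then show ?case using remez_inequality[OF A, of R k, where 'n='n and 'm='m] by auto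
  next
    case (Suc j)
    have "R + real k \<ge> 0" using Suc.prems by simp
    from Suc.IH[OF this] obtain C where C: "C > 0"
      "\<And>p E z \<rho> c y is. ?hyp p E z \<rho> c \<Longrightarrow> dist z y \<le> (R + real k) * \<rho> \<Longrightarrow>
         length is = j \<Longrightarrow> norm (part is p y) \<le> C * (c / \<rho> ^ j)" by blast
    obtain C' where C': "C' > 0" "\<And>(p :: real^'n::finite \<Rightarrow> real^'m::finite) z R \<rho> c i y.
       poly_fun k p \<Longrightarrow> 0 < \<rho> \<Longrightarrow> (\<And>x. dist z x \<le> (R + real k) * \<rho> \<Longrightarrow> norm (p x) \<le> c) \<Longrightarrow>
       dist z y \<le> R * \<rho> \<Longrightarrow> norm (pderiv_coord i p y) \<le> C' * (c / \<rho>)"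
      using markov_inequality[of k, where 'n='n and 'm='m] by meson
    have "norm (part is p y) \<le> (C' * C) * (c / \<rho> ^ Suc j)"
      if h: "?hyp p E z \<rho> c" and y: "dist z y \<le> R * \<rho>" and l: "length is = Suc j" for p E z \<rho> c y "is"
    proof -
      obtain i js where i: "is = i # js" "length js = j" using l by (cases "is") auto
      have "norm (pderiv_coord i (part js p) y) \<le> C' * (C * (c / \<rho> ^ j) / \<rho>)"
        by (rule C'(2)[of _ _ z R]) (use h y C(2)[OF h] i poly_fun_part' in auto)
      then show ?thesis by (simp add: i mult_ac)
    qed
    then show ?case using C(1) C'(1)
      by (intro exI[of _ "C' * C"] conjI allI impI mult_pos_pos) blast+
  qed
  from this[of "max R 0"] obtain C where C: "\<And>j. C j > (0::real)"
    "\<And>j p E z \<rho> c y is. ?hyp p E z \<rho> c \<Longrightarrow> dist z y \<le> max R 0 * \<rho> \<Longrightarrow>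
       length is = j \<Longrightarrow> norm (part is p y) \<le> C j * (c / \<rho> ^ j)"
    by (metis max.cobounded2)
  have "norm (part is p y) \<le> (\<Sum>j\<le>k. C j) * (c / \<rho> ^ length is)"
    if h: "?hyp p E z \<rho> c" and y: "dist z y \<le> R * \<rho>" and l: "length is \<le> k" for p E z \<rho> c y "is"
  proof -
    have "R * \<rho> \<le> max R 0 * \<rho>" using h by (intro mult_right_mono) auto
    then have "norm (part is p y) \<le> C (length is) * (c / \<rho> ^ length is)"
      using C(2)[OF h] y by simp
    also have "\<dots> \<le> (\<Sum>j\<le>k. C j) * (c / \<rho> ^ length is)"
    proof (rule mult_right_mono)
      show "C (length is) \<le> (\<Sum>j\<le>k. C j)"
        using C(1) l by (intro member_le_sum) (auto intro: less_imp_le)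
      have "0 < A * \<rho> ^ CARD('n)" using A h by simp
      then have "0 < measure lebesgue E" using h by linarith
      then have "E \<noteq> {}" by auto
      then have "c \<ge> 0" using h norm_ge_zero order_trans by blast
      then show "0 \<le> c / \<rho> ^ length is" using h by simp
    qed
    finally show ?thesis .
  qed
  moreover have "(\<Sum>j\<le>k. C j) > 0" using C(1) by (intro sum_pos) auto
  ultimately show ?thesis by (intro exI[of _ "\<Sum>j\<le>k. C j"]) blast
qed

section \<open>Tuples of points and their matchings\<close>

abbreviation tup :: "nat \<Rightarrow> (nat \<Rightarrow> 'c) \<Rightarrow> 'c multiset" where
  "tup Q r \<equiv> (\<Sum>i<Q. {#r i#})"

lemma tup_in_Qtuples: "(\<And>i. i < Q \<Longrightarrow> r i \<in> S) \<Longrightarrow> tup Q r \<in> Qtuples Q S"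
  by (auto simp: Qtuples_def sum_single_mset)

lemma Metric_space_Qtuples_UNIV: "Metric_space (Qtuples Q UNIV) (Qdist dist Q)"
  by (rule Metric_space_Qtuples) (rule Met_TC.Metric_space_axioms)

lemma tup_permute: "\<sigma> permutes {..<Q} \<Longrightarrow> tup Q (\<lambda>i. r (\<sigma> i)) = tup Q r"
  using sum.permute[of \<sigma> "{..<Q}" "\<lambda>i. {#r i#}"] by (simp add: o_def)

lemma Qdist_le_of_matching:
  assumes "\<sigma> permutes {..<Q}" "\<And>i. i < Q \<Longrightarrow> \<bar>d (r i) (t (\<sigma> i))\<bar> \<le> c" "c \<ge> 0"
  shows "Qdist d Q (tup Q r) (tup Q t) \<le> sqrt Q * c"
proof -
  have "(\<Sum>i<Q. (d (r i) (t (\<sigma> i)))\<^sup>2) \<le> (\<Sum>i<Q. c\<^sup>2)"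
    using assms(2,3) by (intro sum_mono) (metis abs_le_square_iff abs_of_nonneg lessThan_iff)
  then have "sqrt (\<Sum>i<Q. (d (r i) (t (\<sigma> i)))\<^sup>2) \<le> sqrt (Q * c\<^sup>2)" by simp
  also have "\<dots> = sqrt Q * c" using assms(3) by (simp add: real_sqrt_mult)
  finally show ?thesis using Qdist_le[OF assms(1), of d r t] by simp
qed

lemma Qdist_matching:
  obtains \<sigma> where "\<sigma> permutes {..<Q}" "\<And>i. i < Q \<Longrightarrow> d (r i) (t (\<sigma> i)) \<le> Qdist d Q (tup Q r) (tup Q t)"
proof -
  obtain \<sigma> where s: "\<sigma> permutes {..<Q}"
    "Qdist d Q (tup Q r) (tup Q t) = sqrt (\<Sum>i<Q. (d (r i) (t (\<sigma> i)))\<^sup>2)"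
    by (rule Qdist_attained)
  have "d (r i) (t (\<sigma> i)) \<le> Qdist d Q (tup Q r) (tup Q t)" if "i < Q" for i
    unfolding s(2) using that
    by (intro real_le_rsqrt member_le_sum) auto
  then show ?thesis using that s(1) by blast
qed

lemma Qdist_measurable_fst:
  assumes "T \<in> Qtuples Q UNIV"
  shows "(\<lambda>R. Qdist dist Q R T) \<in> borel_measurable (Qborel Q :: (real^'m::finite) multiset measure)"
proof (rule borel_measurableI_less)
  fix y
  interpret M: Metric_space "Qtuples Q UNIV" "Qdist dist Q :: (real^'m) multiset \<Rightarrow> _"
    by (rule Metric_space_Qtuples_UNIV)
  have sub: "{U. openin M.mtopology U} \<subseteq> Pow (Qtuples Q UNIV)" using openin_subset M.topspace_mtopology by blast
  have "{R \<in> space (Qborel Q). Qdist dist Q R T < y} = M.mball T y"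
    using assms sub by (auto simp: Qborel_def space_measure_of M.commute)
  moreover have "M.mball T y \<in> sets (Qborel Q)"
    using sub unfolding Qborel_def by (simp add: sets_measure_of)
  ultimately show "{R \<in> space (Qborel Q). Qdist dist Q R T < y} \<in> sets (Qborel Q)" by simp
qed

lemma space_Qborel: "space (Qborel Q :: (real^'m::finite) multiset measure) = Qtuples Q UNIV"
proof -
  interpret M: Metric_space "Qtuples Q UNIV" "Qdist dist Q :: (real^'m) multiset \<Rightarrow> _"
    by (rule Metric_space_Qtuples_UNIV)
  have "{U. openin M.mtopology U} \<subseteq> Pow (Qtuples Q UNIV)" using openin_subset M.topspace_mtopology by blast
  then show ?thesis by (simp add: Qborel_def space_measure_of)
qed

lemma Qdist_tendsto:
  assumes "R \<in> Qtuples Q UNIV" "\<And>i. i < Q \<Longrightarrow> (\<lambda>j. t j i) \<longlonglongrightarrow> (s i :: real^'m::finite)"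
  shows "(\<lambda>j. Qdist dist Q R (tup Q (t j))) \<longlonglongrightarrow> Qdist dist Q R (tup Q s)"
proof -
  interpret M: Metric_space "Qtuples Q UNIV" "Qdist dist Q :: (real^'m) multiset \<Rightarrow> _"
    by (rule Metric_space_Qtuples_UNIV)
  have "(\<lambda>j. sqrt (\<Sum>i<Q. (dist (t j i) (s i))\<^sup>2)) \<longlonglongrightarrow> sqrt (\<Sum>i<Q. (dist (s i) (s i))\<^sup>2)"
    by (intro tendsto_intros assms(2)) auto
  then have lim: "(\<lambda>j. sqrt (\<Sum>i<Q. (dist (t j i) (s i))\<^sup>2)) \<longlonglongrightarrow> 0" by simp
  have "norm (Qdist dist Q R (tup Q (t j)) - Qdist dist Q R (tup Q s))
      \<le> sqrt (\<Sum>i<Q. (dist (t j i) (s i))\<^sup>2)" for j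
  proof -
    have T: "tup Q (t j) \<in> Qtuples Q UNIV" "tup Q s \<in> Qtuples Q UNIV" by (auto intro: tup_in_Qtuples)
    have "\<bar>Qdist dist Q R (tup Q (t j)) - Qdist dist Q R (tup Q s)\<bar> \<le> Qdist dist Q (tup Q (t j)) (tup Q s)"
      using M.triangle[OF assms(1) T] M.triangle[OF assms(1) T(2) T(1)] M.commute[of "tup Q s"] by auto
    also have "\<dots> \<le> sqrt (\<Sum>i<Q. (dist (t j i) (s (id i)))\<^sup>2)" by (rule Qdist_le[OF permutes_id])
    finally show ?thesis by simp
  qed
  then have "(\<lambda>j. Qdist dist Q R (tup Q (t j)) - Qdist dist Q R (tup Q s)) \<longlonglongrightarrow> 0"
    by (intro Lim_null_comparison[OF _ lim]) auto
  then show ?thesis by (simp only: LIM_zero_iff)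
qed

text \<open>
  A measurable function and a continuous one have measurable distance: rounding the argument
  of the continuous one down to the dyadic grid leaves countably many constant comparisons.
\<close>

lemma Qdist_measurable:
  fixes u :: "('n::finite, 'm::finite) Qfun"
  assumes u: "u \<in> measurable (lebesgue_on \<Omega>) (Qborel Q)" and p: "\<And>i. i < Q \<Longrightarrow> continuous_on UNIV (p i)"
  shows "(\<lambda>x. Qdist dist Q (u x) (tup Q (\<lambda>i. p i x))) \<in> borel_measurable (lebesgue_on \<Omega>)"
proof (rule borel_measurable_LIMSEQ_real)
  define g where "g j x = (\<lambda>i. \<lfloor>2 ^ j * x $ i\<rfloor>)" for j and x :: "real^'n"
  define y where "y j a = (\<chi> i. real_of_int (a i) / 2 ^ j)" for j and a :: "'n \<Rightarrow> int"
  show "(\<lambda>j. Qdist dist Q (u x) (tup Q (\<lambda>i. p i (y j (g j x))))) \<longlonglongrightarrow> Qdist dist Q (u x) (tup Q (\<lambda>i. p i x))"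
    if "x \<in> space (lebesgue_on \<Omega>)" for x
  proof (rule Qdist_tendsto)
    show "u x \<in> Qtuples Q UNIV" using measurable_space[OF u that] by (simp add: space_Qborel)
    have "(\<lambda>j. y j (g j x)) \<longlonglongrightarrow> x"
    proof (rule vec_tendstoI)
      fix i
      have "\<bar>y j (g j x) $ i - x $ i\<bar> \<le> (1/2) ^ j" for j
      proof -
        have "y j (g j x) $ i - x $ i = (real_of_int \<lfloor>2 ^ j * x $ i\<rfloor> - 2 ^ j * x $ i) / 2 ^ j"
          by (simp add: y_def g_def diff_divide_distrib)
        moreover have "\<bar>real_of_int \<lfloor>2 ^ j * x $ i\<rfloor> - 2 ^ j * x $ i\<bar> \<le> 1"
          using floor_correct[of "2 ^ j * x $ i"] by linarith
        ultimately show ?thesis by (simp add: abs_divide power_divide divide_right_mono)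
      qed
      then have "(\<lambda>j. y j (g j x) $ i - x $ i) \<longlonglongrightarrow> 0"
        by (intro Lim_null_comparison[OF _ LIMSEQ_power_zero[of "1/2::real"]]) auto
      then show "(\<lambda>j. y j (g j x) $ i) \<longlonglongrightarrow> x $ i" by (simp only: LIM_zero_iff)
    qed
    then show "(\<lambda>j. p i (y j (g j x))) \<longlonglongrightarrow> p i x" if "i < Q" for i
      using continuous_on_tendsto_compose[OF p[OF that]] by auto
  qed
  show "(\<lambda>x. Qdist dist Q (u x) (tup Q (\<lambda>i. p i (y j (g j x))))) \<in> borel_measurable (lebesgue_on \<Omega>)" for j
  proof (rule measurable_compose_countable[where f = "\<lambda>a x. Qdist dist Q (u x) (tup Q (\<lambda>i. p i (y j a)))"])
    show "(\<lambda>x. Qdist dist Q (u x) (tup Q (\<lambda>i. p i (y j a)))) \<in> borel_measurable (lebesgue_on \<Omega>)" for a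
      by (rule measurable_compose[OF u Qdist_measurable_fst]) (auto intro: tup_in_Qtuples)
    show "g j \<in> lebesgue_on \<Omega> \<rightarrow>\<^sub>M count_space UNIV"
    proof -
      have "g j -` {a} \<inter> space (lebesgue_on \<Omega>) \<in> sets (lebesgue_on \<Omega>)" for a
      proof -
      have "g j -` {a} = (\<Inter>i. {x. real_of_int (a i) \<le> 2 ^ j * x $ i} \<inter> {x. 2 ^ j * x $ i < real_of_int (a i) + 1})"
        by (auto simp: g_def fun_eq_iff floor_eq_iff)
      moreover have "{x :: real^'n. real_of_int (a i) \<le> 2 ^ j * x $ i} \<in> sets borel" for i
        by (intro borel_closed closed_Collect_le continuous_intros)
      moreover have "{x :: real^'n. 2 ^ j * x $ i < real_of_int (a i) + 1} \<in> sets borel" for i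
        by (intro borel_open open_Collect_less continuous_intros)
      ultimately have "g j -` {a} \<in> sets borel" by (simp add: sets.finite_INT)
      then have "g j -` {a} \<in> sets lebesgue" by simp
      then show "g j -` {a} \<inter> space (lebesgue_on \<Omega>) \<in> sets (lebesgue_on \<Omega>)"
        by (auto simp: sets_restrict_space Int_commute)
      qed
      then show ?thesis by (simp add: measurable_count_space_eq2_countable)
    qed
  qed
qed

lemma Qdist_powr_measurable:
  fixes u :: "('n::finite, 'm::finite) Qfun"
  assumes u: "u \<in> measurable (lebesgue_on \<Omega>) (Qborel Q)" and p: "\<And>i. i < Q \<Longrightarrow> continuous_on UNIV (p i)"
    and \<Omega>: "\<Omega> \<in> sets lebesgue" and E: "E \<in> sets lebesgue" "E \<subseteq> \<Omega>"
  shows "(\<lambda>x. ennreal (Qdist dist Q (u x) (tup Q (\<lambda>i. p i x)) powr q) * indicator E x) \<in> borel_measurable lebesgue"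
proof -
  have "(\<lambda>x. ennreal (Qdist dist Q (u x) (tup Q (\<lambda>i. p i x)) powr q)) \<in> borel_measurable (lebesgue_on \<Omega>)"
    using Qdist_measurable[OF u p] by measurable
  then have "(\<lambda>x. ennreal (Qdist dist Q (u x) (tup Q (\<lambda>i. p i x)) powr q) * indicator \<Omega> x) \<in> borel_measurable lebesgue"
    by (subst (asm) borel_measurable_restrict_space_iff_ennreal) (use \<Omega> in auto)
  then have "(\<lambda>x. ennreal (Qdist dist Q (u x) (tup Q (\<lambda>i. p i x)) powr q) * indicator \<Omega> x * indicator E x) \<in> borel_measurable lebesgue"
    using E(1) by measurable
  also have "(\<lambda>x. ennreal (Qdist dist Q (u x) (tup Q (\<lambda>i. p i x)) powr q) * indicator \<Omega> x * indicator E x)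
    = (\<lambda>x. ennreal (Qdist dist Q (u x) (tup Q (\<lambda>i. p i x)) powr q) * indicator E x)"
    using E(2) by (auto simp: indicator_def fun_eq_iff)
  finally show ?thesis .
qed

section \<open>Comparison of Q-valued polynomials\<close>

definition deviation ::
  "nat \<Rightarrow> real \<Rightarrow> ('n::finite, 'm::finite) Qfun \<Rightarrow> (real^'n) set \<Rightarrow> (nat \<Rightarrow> real^'n \<Rightarrow> real^'m) \<Rightarrow> ennreal" where
  "deviation Q q u S p = (\<integral>\<^sup>+x\<in>S. ennreal (Qdist dist Q (u x) (tup Q (\<lambda>i. p i x)) powr q) \<partial>lebesgue)"

text \<open>
  Two Q-valued polynomials that are both close to u on E are close to each other sheet by
  sheet, with all derivatives. At each point of E, up to a small exceptional set, some
  permutation matches the two tuples of values. There are only finitely many permutations, so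
  one of them works on a subset of E of comparable measure, and there the Remez
  inequality applies to the differences of the matched sheets. Hence one permutation serves all
  derivatives at all points.
\<close>

lemma Qpoly_comparison:
  assumes A: "A > 0" and q: "q \<ge> 1"
  shows "\<exists>C>0. \<forall>\<Omega> (u :: ('n::finite, 'm::finite) Qfun) p r E z \<rho> b.
    \<Omega> \<in> sets lebesgue \<longrightarrow> u \<in> measurable (lebesgue_on \<Omega>) (Qborel Q) \<longrightarrow>
    (\<forall>i<Q. poly_fun k (p i) \<and> poly_fun k (r i)) \<longrightarrow> E \<in> lmeasurable \<longrightarrow> E \<subseteq> \<Omega> \<longrightarrow> E \<subseteq> ball z \<rho> \<longrightarrow>
    0 < \<rho> \<longrightarrow> A * \<rho> ^ CARD('n) \<le> measure lebesgue E \<longrightarrow> 0 < b \<longrightarrow>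
    deviation Q q u E p \<le> ennreal b \<longrightarrow>
    deviation Q q u E r \<le> ennreal b \<longrightarrow>
    (\<exists>\<sigma>. \<sigma> permutes {..<Q} \<and> (\<forall>i<Q. \<forall>is y. length is \<le> k \<longrightarrow> dist z y \<le> R * \<rho> \<longrightarrow>
       norm (part is (p i) y - part is (r (\<sigma> i)) y) \<le> C * ((b / \<rho> ^ CARD('n)) powr (1/q) / \<rho> ^ length is)))"
proof -
  define A' where "A' = A / (2 * fact Q)"
  have A': "A' > 0" using A by (simp add: A'_def)
  obtain C where C: "C > 0" "\<And>(p :: real^'n \<Rightarrow> real^'m) E z \<rho> c y is.
     poly_fun k p \<Longrightarrow> 0 < \<rho> \<Longrightarrow> E \<in> lmeasurable \<Longrightarrow> E \<subseteq> ball z \<rho> \<Longrightarrow>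
     A' * \<rho> ^ CARD('n) \<le> measure lebesgue E \<Longrightarrow> (\<forall>x\<in>E. norm (p x) \<le> c) \<Longrightarrow> dist z y \<le> R * \<rho> \<Longrightarrow>
     length is \<le> k \<Longrightarrow> norm (part is p y) \<le> C * (c / \<rho> ^ length is)"
    using remez_inequality_part[OF A', of k R, where 'n='n and 'm='m] by metis
  define K where "K = 2 * (4 / A) powr (1/q)"
  have K: "K > 0" using A by (simp add: K_def)
  have "\<exists>\<sigma>. \<sigma> permutes {..<Q} \<and> (\<forall>i<Q. \<forall>is y. length is \<le> k \<longrightarrow> dist z y \<le> R * \<rho> \<longrightarrow>
       norm (part is (p i) y - part is (r (\<sigma> i)) y) \<le> (C * K) * ((b / \<rho> ^ CARD('n)) powr (1/q) / \<rho> ^ length is))"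
    if \<Omega>: "\<Omega> \<in> sets lebesgue" and u: "u \<in> measurable (lebesgue_on \<Omega>) (Qborel Q)"
      and pr: "\<forall>i<Q. poly_fun k (p i) \<and> poly_fun k (r i)"
      and E: "E \<in> lmeasurable" "E \<subseteq> \<Omega>" "E \<subseteq> ball z \<rho>" "A * \<rho> ^ CARD('n) \<le> measure lebesgue E"
      and \<rho>: "0 < \<rho>" and b: "0 < b"
      and bp: "deviation Q q u E p \<le> ennreal b"
      and br: "deviation Q q u E r \<le> ennreal b"
    for \<Omega> and u :: "('n, 'm) Qfun" and p r E z \<rho> b
  proof -
    interpret M: Metric_space "Qtuples Q UNIV" "Qdist dist Q :: (real^'m) multiset \<Rightarrow> _"
      by (rule Metric_space_Qtuples_UNIV)
    let ?P = "\<lambda>x. tup Q (\<lambda>i. p i x)" and ?R = "\<lambda>x. tup Q (\<lambda>i. r i x)"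
    \<comment> \<open>By Chebyshev's inequality, the distance of P and R exceeds c on at most half of E.\<close>
    define c where "c = K * (b / \<rho> ^ CARD('n)) powr (1/q)"
    have c: "c > 0" using K b \<rho> by (simp add: c_def)
    have c2: "(c / 2) powr q = 4 * b / (A * \<rho> ^ CARD('n))"
    proof -
      have "c / 2 = (4 / A) powr (1/q) * (b / \<rho> ^ CARD('n)) powr (1/q)" by (simp add: c_def K_def)
      also have "\<dots> = (4 / A * (b / \<rho> ^ CARD('n))) powr (1/q)"
        by (rule powr_mult[symmetric])
      finally show ?thesis using q A b \<rho> by (simp add: powr_powr)
    qed
    define F where "F \<sigma> = E \<inter> {x. \<forall>i<Q. norm (p i x - r (\<sigma> i) x) \<le> c}" for \<sigma> :: "nat \<Rightarrow> nat"
    define S where "S = {\<sigma>. \<sigma> permutes {..<Q}}"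
    have S: "finite S" "card S = fact Q" "S \<noteq> {}"
      unfolding S_def using card_permutations[of "{..<Q}" Q] permutes_id[of "{..<Q}"]
      by (auto simp: finite_permutations simp del: permutes_id)
    have F: "F \<sigma> \<in> lmeasurable" if "\<sigma> \<in> S" for \<sigma>
    proof -
      have "\<sigma> i < Q" if "i < Q" for i
        using permutes_in_image[of \<sigma> "{..<Q}" i] that \<open>\<sigma> \<in> S\<close> by (simp add: S_def)
      then have "closed {x. norm (p i x - r (\<sigma> i) x) \<le> c}" if "i < Q" for i
        using pr that by (intro closed_Collect_le continuous_intros) (auto intro: poly_fun_continuous)
      then have "closed (\<Inter>i\<in>{..<Q}. {x. norm (p i x - r (\<sigma> i) x) \<le> c})" by (intro closed_INT) auto
      then have "(\<Inter>i\<in>{..<Q}. {x. norm (p i x - r (\<sigma> i) x) \<le> c}) \<in> sets lebesgue" by simp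
      moreover have "F \<sigma> = E \<inter> (\<Inter>i\<in>{..<Q}. {x. norm (p i x - r (\<sigma> i) x) \<le> c})" by (auto simp: F_def)
      ultimately show ?thesis using E(1) by (simp only: fmeasurable_Int_fmeasurable)
    qed
    define N where "N = E - (\<Union>\<sigma>\<in>S. F \<sigma>)"
    have N: "N \<in> lmeasurable" unfolding N_def using E(1) F S(1)
      by (intro fmeasurable_Diff) (auto intro!: fmeasurableD)
    have Np: "(c / 2) powr q \<le> Qdist dist Q (u x) (?P x) powr q + Qdist dist Q (u x) (?R x) powr q"
      if x: "x \<in> N" for x
    proof -
      have ux: "u x \<in> Qtuples Q UNIV"
        using measurable_space[OF u, of x] x E(2) by (auto simp: space_Qborel N_def)
      have T: "?P x \<in> Qtuples Q UNIV" "?R x \<in> Qtuples Q UNIV" by (auto intro: tup_in_Qtuples)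
      obtain \<sigma> where s: "\<sigma> permutes {..<Q}"
        "\<And>i. i < Q \<Longrightarrow> dist (p i x) (r (\<sigma> i) x) \<le> Qdist dist Q (?P x) (?R x)"
        using Qdist_matching[of Q dist "\<lambda>i. p i x" "\<lambda>i. r i x"] by auto
      have "x \<notin> F \<sigma>" using x s(1) by (auto simp: N_def S_def)
      then obtain i where "i < Q" "\<not> norm (p i x - r (\<sigma> i) x) \<le> c" using x by (auto simp: N_def F_def)
      then have "c < Qdist dist Q (?P x) (?R x)" using s(2)[of i] by (simp add: dist_norm)
      also have "\<dots> \<le> Qdist dist Q (u x) (?P x) + Qdist dist Q (u x) (?R x)"
        using M.triangle[OF T(1) ux T(2)] M.commute[of "?P x" "u x"] by simp
      finally have "c / 2 \<le> Qdist dist Q (u x) (?P x) \<or> c / 2 \<le> Qdist dist Q (u x) (?R x)" by linarith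
      then show ?thesis
      proof
        assume "c / 2 \<le> Qdist dist Q (u x) (?P x)"
        then have "(c / 2) powr q \<le> Qdist dist Q (u x) (?P x) powr q" using c q by (intro powr_mono2) auto
        then show ?thesis using powr_ge_zero[of "Qdist dist Q (u x) (?R x)" q] by linarith
      next
        assume "c / 2 \<le> Qdist dist Q (u x) (?R x)"
        then have "(c / 2) powr q \<le> Qdist dist Q (u x) (?R x) powr q" using c q by (intro powr_mono2) auto
        then show ?thesis using powr_ge_zero[of "Qdist dist Q (u x) (?P x)" q] by linarith
      qed
    qed
    have "ennreal ((c / 2) powr q * measure lebesgue N) = (\<integral>\<^sup>+x. ennreal ((c / 2) powr q) * indicator N x \<partial>lebesgue)"
      using N by (simp add: nn_integral_cmult_indicator emeasure_eq_measure2 fmeasurableD ennreal_mult del: emeasure_completion)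
    also have "\<dots> \<le> (\<integral>\<^sup>+x. ennreal (Qdist dist Q (u x) (?P x) powr q) * indicator E x
        + ennreal (Qdist dist Q (u x) (?R x) powr q) * indicator E x \<partial>lebesgue)"
    proof (rule nn_integral_mono)
      fix x
      show "ennreal ((c / 2) powr q) * indicator N x \<le> ennreal (Qdist dist Q (u x) (?P x) powr q) * indicator E x
        + ennreal (Qdist dist Q (u x) (?R x) powr q) * indicator E x"
      proof (cases "x \<in> N")
        case True
        then have "x \<in> E" by (simp add: N_def)
        then show ?thesis using Np[OF True] True by (simp add: ennreal_plus[symmetric] del: ennreal_plus)
      qed simp
    qed
    also have "\<dots> = deviation Q q u E p + deviation Q q u E r"
      unfolding deviation_def using pr E(1,2) \<Omega> by (intro nn_integral_add Qdist_powr_measurable[OF u]) (auto intro: poly_fun_continuous)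
    also have "\<dots> \<le> ennreal (2 * b)"
      using add_mono[OF bp br] b by (simp add: ennreal_plus[symmetric] del: ennreal_plus)
    finally have "(c / 2) powr q * measure lebesgue N \<le> 2 * b" using b by (simp add: ennreal_le_iff)
    then have Nle: "measure lebesgue N \<le> A * \<rho> ^ CARD('n) / 2"
      unfolding c2 using A \<rho> b by (simp add: field_simps)
    have "\<exists>\<sigma>\<in>S. A' * \<rho> ^ CARD('n) \<le> measure lebesgue (F \<sigma>)"
    proof (rule ccontr)
      assume "\<not> ?thesis"
      then have "(\<Sum>\<sigma>\<in>S. measure lebesgue (F \<sigma>)) < (\<Sum>\<sigma>\<in>S. A' * \<rho> ^ CARD('n))"
        using S by (intro sum_strict_mono) auto
      also have "\<dots> = A * \<rho> ^ CARD('n) / 2" by (simp add: S A'_def)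
      finally have 1: "(\<Sum>\<sigma>\<in>S. measure lebesgue (F \<sigma>)) < A * \<rho> ^ CARD('n) / 2" .
      have "E = (\<Union>\<sigma>\<in>S. F \<sigma>) \<union> N" by (auto simp: N_def F_def)
      then have "measure lebesgue E \<le> measure lebesgue (\<Union>\<sigma>\<in>S. F \<sigma>) + measure lebesgue N"
        using measure_Un_le[of "\<Union>\<sigma>\<in>S. F \<sigma>" lebesgue N] F S(1) N by (auto intro!: fmeasurableD)
      also have "measure lebesgue (\<Union>\<sigma>\<in>S. F \<sigma>) \<le> (\<Sum>\<sigma>\<in>S. measure lebesgue (F \<sigma>))"
        using F S(1) by (intro measure_UNION_le) (auto intro: fmeasurableD)
      finally show False using 1 Nle E(4) by linarith
    qed
    then obtain \<sigma> where s: "\<sigma> \<in> S" "A' * \<rho> ^ CARD('n) \<le> measure lebesgue (F \<sigma>)" by blast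
    have sQ: "\<sigma> i < Q" if "i < Q" for i
      using permutes_in_image[of \<sigma> "{..<Q}" i] that \<open>\<sigma> \<in> S\<close> by (simp add: S_def)
    have "norm (part is (p i) y - part is (r (\<sigma> i)) y) \<le> (C * K) * ((b / \<rho> ^ CARD('n)) powr (1/q) / \<rho> ^ length is)"
      if "i < Q" "length is \<le> k" "dist z y \<le> R * \<rho>" for i "is" y
    proof -
      have "norm (part is (\<lambda>x. p i x - r (\<sigma> i) x) y) \<le> C * (c / \<rho> ^ length is)"
        by (rule C(2)[of _ _ "F \<sigma>" z]) (use pr that sQ \<rho> F s E in \<open>auto intro: poly_fun_diff simp: F_def\<close>)
      then show ?thesis using part_diff[of k "p i" "r (\<sigma> i)" "is" y] pr that(1) sQ
        by (simp add: c_def mult.assoc)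
    qed
    then show ?thesis using s(1) by (auto simp: S_def)
  qed
  then show ?thesis using C(1) K by (intro exI[of _ "C * K"] conjI mult_pos_pos allI impI) blast+
qed

section \<open>Almost optimal polynomials at neighbouring points and scales\<close>

lemma geometric_limit:
  fixes f :: "nat \<Rightarrow> 'b::banach"
  assumes step: "\<And>h. norm (f (Suc h) - f h) \<le> a * c ^ h" and a: "a \<ge> 0" and c: "0 \<le> c" "c < 1"
  obtains l where "\<And>h. norm (f h - l) \<le> a * c ^ h / (1 - c)"
proof -
  have fin: "norm (f (h + j) - f h) \<le> a * c ^ h * (\<Sum>i<j. c ^ i)" for h j
  proof (induction j)
    case (Suc j)
    have "norm (f (h + Suc j) - f h) \<le> norm (f (Suc (h + j)) - f (h + j)) + norm (f (h + j) - f h)"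
      using norm_triangle_ineq[of "f (Suc (h + j)) - f (h + j)" "f (h + j) - f h"] by simp
    also have "\<dots> \<le> a * c ^ (h + j) + a * c ^ h * (\<Sum>i<j. c ^ i)" using step[of "h + j"] Suc by linarith
    finally show ?case by (simp add: algebra_simps power_add)
  qed simp
  have "(\<Sum>i<j. c ^ i) \<le> 1 / (1 - c)" for j
  proof -
    have "(\<Sum>i<j. c ^ i) \<le> suminf (\<lambda>i. c ^ i)" using c by (intro sum_le_suminf) (auto intro: summable_geometric)
    then show ?thesis using suminf_geometric[of c] c by simp
  qed
  then have bd: "norm (f (h + j) - f h) \<le> a * c ^ h * (1 / (1 - c))" for h j
    using a c by (intro order_trans[OF fin] mult_left_mono) auto
  have lim0: "(\<lambda>h. a * c ^ h * (1 / (1 - c))) \<longlonglongrightarrow> a * 0 * (1 / (1 - c))"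
    using c by (intro tendsto_intros LIMSEQ_power_zero) auto
  have "Cauchy f"
  proof (rule metric_CauchyI)
    fix e :: real assume "e > 0"
    then have "eventually (\<lambda>h. a * c ^ h * (1 / (1 - c)) < e / 2) sequentially"
      using lim0 by (intro order_tendstoD(2)[of _ "a * 0 * (1 / (1 - c))"]) auto
    then obtain N where N: "a * c ^ N * (1 / (1 - c)) < e / 2" by (auto simp: eventually_sequentially)
    have "dist (f m) (f n) < e" if "m \<ge> N" "n \<ge> N" for m n
    proof -
      have "norm (f m - f N) < e / 2" "norm (f n - f N) < e / 2"
        using bd[of N "m - N"] bd[of N "n - N"] N that
        by (simp_all only: le_add_diff_inverse)
      then show ?thesis using dist_triangle_half_l[of "f m" "f N" e "f n"]
        by (simp add: dist_norm norm_minus_commute)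
    qed
    then show "\<exists>M. \<forall>m\<ge>M. \<forall>n\<ge>M. dist (f m) (f n) < e" by blast
  qed
  then obtain l where l: "f \<longlonglongrightarrow> l" using Cauchy_convergent convergent_def by blast
  have "norm (f h - l) \<le> a * c ^ h / (1 - c)" for h
  proof (rule Lim_bounded)
    show "(\<lambda>n. norm (f h - f n)) \<longlonglongrightarrow> norm (f h - l)" by (intro tendsto_intros l)
    show "\<forall>n\<ge>h. norm (f h - f n) \<le> a * c ^ h / (1 - c)"
      using bd[of h] by (auto simp: norm_minus_commute dest!: le_Suc_ex)
  qed
  then show ?thesis using that by blast
qed

lemma powr_real_nat_diff: "\<rho> > 0 \<Longrightarrow> \<rho> powr (b - real j) = \<rho> powr b / \<rho> ^ j"
  by (simp add: powr_diff powr_realpow)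

text \<open>
  The comparison of polynomials enters as an assumption with a constant C. All further
  estimates are traced back to it, and \<open>campanato_axioms_hold\<close> provides one C for all \<open>\<Omega>\<close> and u; so a
  constant that is an expression in C, A, q, \<open>\<beta>\<close> and the degree does not depend on \<open>\<Omega>\<close> and u.
  The comparison takes place on a ball of radius \<open>\<rho>/2\<close>, which fits both into the intersection of
  two balls of radius \<open>\<rho>\<close> whose centres have distance at most \<open>\<rho>\<close> and into a concentric ball at the
  next smaller scale.
\<close>

locale campanato =
  fixes Q k :: nat and q lam \<beta> A C :: real
    and \<Omega> :: "(real^'n::finite) set" and u :: "('n, 'm::finite) Qfun"
  assumes q: "q \<ge> 1" and A: "A > 0" and C: "C > 0"
    and lam: "real CARD('n) < lam" and \<beta>: "\<beta> = (lam - real CARD('n)) / q"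
    and cvx: "convex \<Omega>" and wd: "weighted_domain A \<Omega>"
    and u: "u \<in> measurable (lebesgue_on \<Omega>) (Qborel Q)"
    and comparison: "\<And>z \<rho> M p r. z \<in> closure \<Omega> \<Longrightarrow> 0 < \<rho> \<Longrightarrow> \<rho> \<le> diameter \<Omega> \<Longrightarrow> 0 < M \<Longrightarrow>
      (\<And>i. i < Q \<Longrightarrow> poly_fun k (p i)) \<Longrightarrow> (\<And>i. i < Q \<Longrightarrow> poly_fun k (r i)) \<Longrightarrow>
      deviation Q q u (\<Omega> \<inter> ball z (\<rho>/2)) p \<le> ennreal (M powr q * \<rho> powr lam) \<Longrightarrow>
      deviation Q q u (\<Omega> \<inter> ball z (\<rho>/2)) r \<le> ennreal (M powr q * \<rho> powr lam) \<Longrightarrow>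
      \<exists>\<sigma>. \<sigma> permutes {..<Q} \<and> (\<forall>i<Q. \<forall>is y. length is \<le> k \<longrightarrow> dist z y \<le> \<rho> \<longrightarrow>
        norm (part is (p i) y - part is (r (\<sigma> i)) y)
          \<le> C * M * \<rho> powr (\<beta> - real (length is)))"

lemma campanato_axioms_hold:
  assumes q: "q \<ge> 1" and A: "A > 0" and lam: "real CARD('n::finite) < lam"
  shows "\<exists>C>0. \<forall>\<Omega> (u :: ('n, 'm::finite) Qfun). convex \<Omega> \<longrightarrow> weighted_domain A \<Omega> \<longrightarrow>
    u \<in> measurable (lebesgue_on \<Omega>) (Qborel Q) \<longrightarrow> campanato Q k q lam ((lam - real CARD('n)) / q) A C \<Omega> u"
proof -
  obtain C where C: "C > 0" and cmp: "\<forall>\<Omega> (u :: ('n, 'm) Qfun) p r E z \<rho> b.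
    \<Omega> \<in> sets lebesgue \<longrightarrow> u \<in> measurable (lebesgue_on \<Omega>) (Qborel Q) \<longrightarrow>
    (\<forall>i<Q. poly_fun k (p i) \<and> poly_fun k (r i)) \<longrightarrow> E \<in> lmeasurable \<longrightarrow> E \<subseteq> \<Omega> \<longrightarrow> E \<subseteq> ball z \<rho> \<longrightarrow>
    0 < \<rho> \<longrightarrow> A * \<rho> ^ CARD('n) \<le> measure lebesgue E \<longrightarrow> 0 < b \<longrightarrow>
    deviation Q q u E p \<le> ennreal b \<longrightarrow>
    deviation Q q u E r \<le> ennreal b \<longrightarrow>
    (\<exists>\<sigma>. \<sigma> permutes {..<Q} \<and> (\<forall>i<Q. \<forall>is y. length is \<le> k \<longrightarrow> dist z y \<le> 2 * \<rho> \<longrightarrow>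
       norm (part is (p i) y - part is (r (\<sigma> i)) y) \<le> C * ((b / \<rho> ^ CARD('n)) powr (1/q) / \<rho> ^ length is)))"
    using Qpoly_comparison[OF A q, of Q k 2, where 'n='n and 'm='m] 
    by (elim exE conjE) (rule that)
  define C' where "C' = C * (2 powr (real CARD('n) / q) * 2 ^ k)"
  have "campanato Q k q lam ((lam - real CARD('n)) / q) A C' \<Omega> u"
    if cvx: "convex \<Omega>" and wd: "weighted_domain A \<Omega>" and u: "u \<in> measurable (lebesgue_on \<Omega>) (Qborel Q)"
    for \<Omega> and u :: "('n, 'm) Qfun"
  proof
    show "C' > 0" using C by (simp add: C'_def)
    fix z \<rho> M and p r :: "nat \<Rightarrow> real^'n \<Rightarrow> real^'m"
    assume z: "z \<in> closure \<Omega>" and \<rho>: "0 < \<rho>" "\<rho> \<le> diameter \<Omega>" and M: "0 < M"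
      and pr: "\<And>i. i < Q \<Longrightarrow> poly_fun k (p i)" "\<And>i. i < Q \<Longrightarrow> poly_fun k (r i)"
      and b: "deviation Q q u (\<Omega> \<inter> ball z (\<rho>/2)) p \<le> ennreal (M powr q * \<rho> powr lam)"
        "deviation Q q u (\<Omega> \<inter> ball z (\<rho>/2)) r \<le> ennreal (M powr q * \<rho> powr lam)"
    have op: "open \<Omega>" using wd by (simp add: weighted_domain_def)
    then have \<Omega>_leb: "\<Omega> \<in> sets lebesgue" by simp
    have E: "\<Omega> \<inter> ball z (\<rho>/2) \<in> lmeasurable"
      using op by (intro bounded_set_imp_lmeasurable) (auto simp: bounded_Int)
    have mE: "A * (\<rho>/2) ^ CARD('n) \<le> measure lebesgue (\<Omega> \<inter> ball z (\<rho>/2))"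
      using wd z \<rho> unfolding weighted_domain_def by auto
    have "\<exists>\<sigma>. \<sigma> permutes {..<Q} \<and> (\<forall>i<Q. \<forall>is y. length is \<le> k \<longrightarrow> dist z y \<le> 2 * (\<rho>/2) \<longrightarrow>
       norm (part is (p i) y - part is (r (\<sigma> i)) y)
         \<le> C * ((M powr q * \<rho> powr lam / (\<rho>/2) ^ CARD('n)) powr (1/q) / (\<rho>/2) ^ length is))"
      by (rule cmp[rule_format, OF \<Omega>_leb u _ E _ _ _ mE _ b]) (use pr \<rho> M in auto)
    then obtain \<sigma> where s: "\<sigma> permutes {..<Q}" "\<And>i is y. i < Q \<Longrightarrow> length is \<le> k \<Longrightarrow> dist z y \<le> \<rho> \<Longrightarrow>
       norm (part is (p i) y - part is (r (\<sigma> i)) y)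
         \<le> C * ((M powr q * \<rho> powr lam / (\<rho>/2) ^ CARD('n)) powr (1/q) / (\<rho>/2) ^ length is)"
      by auto
    have "norm (part is (p i) y - part is (r (\<sigma> i)) y) \<le> C' * M * \<rho> powr ((lam - real CARD('n)) / q - real (length is))"
      if "i < Q" "length is \<le> k" "dist z y \<le> \<rho>" for i "is" y
    proof -
      have "M powr q * \<rho> powr lam / (\<rho>/2) ^ CARD('n) = M powr q * (\<rho> powr (lam - real CARD('n)) * 2 ^ CARD('n))"
        using \<rho> by (simp add: powr_real_nat_diff power_divide)
      then have "(M powr q * \<rho> powr lam / (\<rho>/2) ^ CARD('n)) powr (1/q)
        = M * (\<rho> powr ((lam - real CARD('n)) / q) * 2 powr (real CARD('n) / q))"
        using M \<rho> q by (simp add: powr_mult powr_powr powr_realpow[symmetric])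
      moreover have "1 / (\<rho>/2) ^ length is \<le> 2 ^ k * (1 / \<rho> ^ length is)"
      proof -
        have "(2::real) ^ length is \<le> 2 ^ k" using that(2) by (intro power_increasing) auto
        then show ?thesis using \<rho> by (simp add: power_divide divide_right_mono)
      qed
      ultimately have "(M powr q * \<rho> powr lam / (\<rho>/2) ^ CARD('n)) powr (1/q) / (\<rho>/2) ^ length is
         \<le> M * (\<rho> powr ((lam - real CARD('n)) / q) * 2 powr (real CARD('n) / q)) * (2 ^ k * (1 / \<rho> ^ length is))"
        using mult_left_mono[of "1 / (\<rho>/2) ^ length is" "2 ^ k * (1 / \<rho> ^ length is)"
           "M * (\<rho> powr ((lam - real CARD('n)) / q) * 2 powr (real CARD('n) / q))"] M by simp
      then have "C * ((M powr q * \<rho> powr lam / (\<rho>/2) ^ CARD('n)) powr (1/q) / (\<rho>/2) ^ length is)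
         \<le> C * (M * (\<rho> powr ((lam - real CARD('n)) / q) * 2 powr (real CARD('n) / q)) * (2 ^ k * (1 / \<rho> ^ length is)))"
        using C by (intro mult_left_mono) auto
      also have "\<dots> = C' * M * \<rho> powr ((lam - real CARD('n)) / q - real (length is))"
        using \<rho> by (simp add: C'_def powr_real_nat_diff)
      finally show ?thesis using s(2)[OF that] by linarith
    qed
    then show "\<exists>\<sigma>. \<sigma> permutes {..<Q} \<and> (\<forall>i<Q. \<forall>is y. length is \<le> k \<longrightarrow> dist z y \<le> \<rho> \<longrightarrow>
        norm (part is (p i) y - part is (r (\<sigma> i)) y)
          \<le> C' * M * \<rho> powr ((lam - real CARD('n)) / q - real (length is)))"
      using s(1) by blast
  qed (use q A lam cvx wd u in auto)
  moreover have "C' > 0" using C by (simp add: C'_def)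
  ultimately show ?thesis by blast
qed

context campanato
begin

definition rad :: "nat \<Rightarrow> real" where "rad h = diameter \<Omega> / 2 ^ h"

abbreviation excess :: "(real^'n) set \<Rightarrow> (nat \<Rightarrow> real^'n \<Rightarrow> real^'m) \<Rightarrow> ennreal" where
  "excess \<equiv> deviation Q q u"

text \<open>The natural size of a derivative of order j of the approximation error at scale \<open>rad h\<close>.\<close>

abbreviation scale :: "nat \<Rightarrow> nat \<Rightarrow> real" where
  "scale h j \<equiv> rad h powr (\<beta> - real j)"

definition approx :: "real \<Rightarrow> real^'n \<Rightarrow> real \<Rightarrow> (nat \<Rightarrow> real^'n \<Rightarrow> real^'m) \<Rightarrow> bool" where
  "approx M x \<rho> p \<longleftrightarrow> (\<forall>i<Q. poly_fun k (p i)) \<and>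
     excess (\<Omega> \<inter> ball x \<rho>) p \<le> ennreal (M powr q * \<rho> powr lam)"

text \<open>Every M above the seminorm of u is admissible.\<close>

definition admissible :: "real \<Rightarrow> bool" where
  "admissible M \<longleftrightarrow> M > 0 \<and> (\<forall>x\<in>closure \<Omega>. \<forall>\<rho>. 0 < \<rho> \<and> \<rho> \<le> diameter \<Omega> \<longrightarrow> (\<exists>p. approx M x \<rho> p))"

lemma open_\<Omega>: "open \<Omega>" and bounded_\<Omega>: "bounded \<Omega>" and nonempty: "\<Omega> \<noteq> {}"
  using wd by (auto simp: weighted_domain_def)

lemma \<Omega>_lebesgue [simp]: "\<Omega> \<in> sets lebesgue"
  using open_\<Omega> by simp

lemma diameter_pos: "0 < diameter \<Omega>"
proof -
  obtain x e where x: "x \<in> \<Omega>" "e > 0" "cball x e \<subseteq> \<Omega>"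
    using nonempty open_\<Omega> by (meson ex_in_conv open_contains_cball)
  define y where "y = x + e *\<^sub>R axis undefined 1"
  have "dist x y = e" using x by (simp add: y_def dist_norm)
  then have "y \<in> \<Omega>" using x by auto
  then have "e \<le> diameter \<Omega>" using diameter_bounded_bound[OF bounded_\<Omega> x(1), of y] \<open>dist x y = e\<close> by simp
  then show ?thesis using x by simp
qed

lemma dist_le_diameter: "x \<in> closure \<Omega> \<Longrightarrow> y \<in> closure \<Omega> \<Longrightarrow> dist x y \<le> diameter \<Omega>"
  using diameter_bounded_bound[of "closure \<Omega>" x y] bounded_\<Omega>
  by (simp add: diameter_closure bounded_closure)

lemma rad: "0 < rad h" "rad h \<le> diameter \<Omega>" "rad 0 = diameter \<Omega>" "rad (Suc h) = rad h / 2"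
  using diameter_pos by (auto simp: rad_def divide_le_eq mult_le_cancel_left1)

lemma rad_tendsto_0: "rad \<longlonglongrightarrow> 0"
proof -
  have "(\<lambda>h. diameter \<Omega> * (1/2) ^ h) \<longlonglongrightarrow> diameter \<Omega> * 0"
    by (intro tendsto_intros LIMSEQ_power_zero) auto
  then show ?thesis by (simp add: rad_def[abs_def] power_divide)
qed

lemma rad_sandwich:
  assumes "0 < r" "r \<le> diameter \<Omega>"
  obtains h where "r \<le> rad h" "rad h < 2 * r"
proof -
  have "eventually (\<lambda>h. rad h < r) sequentially" using order_tendstoD(2)[OF rad_tendsto_0 assms(1)] .
  then have ex: "\<exists>h. rad h < r" by (auto simp: eventually_sequentially)
  define H where "H = (LEAST h. rad h < r)"
  have H: "rad H < r" unfolding H_def using ex by (rule LeastI_ex)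
  then obtain h where h: "H = Suc h" using assms rad(3) by (cases H) auto
  have "\<not> rad h < r" using not_less_Least[of h "\<lambda>h. rad h < r"] h by (simp add: H_def)
  then show ?thesis using that[of h] H h rad(4)[of h] by simp
qed

lemma \<beta>_pos: "\<beta> > 0" using lam q by (simp add: \<beta>)

lemma excess_mono: "S \<subseteq> T \<Longrightarrow> excess S p \<le> excess T p"
  unfolding deviation_def by (intro nn_integral_mono) (auto simp: indicator_def)

lemma approx_permute:
  assumes "approx M x \<rho> p" "\<sigma> permutes {..<Q}"
  shows "approx M x \<rho> (\<lambda>i. p (\<sigma> i))"
proof -
  have "excess S (\<lambda>i. p (\<sigma> i)) = excess S p" for S
    unfolding deviation_def using tup_permute[OF assms(2), of "\<lambda>i. p i _"] by simp
  moreover have "\<sigma> i < Q" if "i < Q" for i using permutes_in_image[OF assms(2), of i] that by simp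
  ultimately show ?thesis using assms(1) by (simp add: approx_def)
qed

lemma approx_mono:
  assumes "approx M x \<rho> p" "0 \<le> M" "M \<le> M'"
  shows "approx M' x \<rho> p"
proof -
  have "M powr q * \<rho> powr lam \<le> M' powr q * \<rho> powr lam"
    using assms q by (intro mult_right_mono powr_mono2) auto
  then show ?thesis using assms(1) unfolding approx_def by (meson ennreal_leI order_trans)
qed

text \<open>
  Approximants at two points of distance at most \<open>\<rho>\<close>, both at scale \<open>\<rho>\<close>, are compared on a ball
  about the midpoint, which lies in the closure of \<open>\<Omega>\<close> by convexity.
\<close>

lemma approx_match:
  assumes xy: "x \<in> closure \<Omega>" "y \<in> closure \<Omega>" "dist x y \<le> \<rho>" and \<rho>: "0 < \<rho>" "\<rho> \<le> diameter \<Omega>"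
    and M: "0 < M" and p: "approx M x \<rho> p" and r: "approx M y \<rho> r"
  obtains \<sigma> where "\<sigma> permutes {..<Q}"
    "\<And>i is w. i < Q \<Longrightarrow> length is \<le> k \<Longrightarrow> w \<in> {x, y} \<Longrightarrow>
       norm (part is (p i) w - part is (r (\<sigma> i)) w) \<le> C * M * \<rho> powr (\<beta> - real (length is))"
proof -
  define z where "z = (1/2) *\<^sub>R x + (1/2) *\<^sub>R y"
  have z: "z \<in> closure \<Omega>" unfolding z_def
    using convexD[OF convex_closure[OF cvx] xy(1,2)] by simp
  have "z - x = (1/2) *\<^sub>R (y - x)" "z - y = (1/2) *\<^sub>R (x - y)" by (auto simp: z_def vec_eq_iff field_simps)
  then have zx: "dist z x \<le> \<rho>/2" "dist z y \<le> \<rho>/2"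
    using xy(3) by (auto simp: dist_norm norm_minus_commute)
  have "ball z (\<rho>/2) \<subseteq> ball x \<rho>" "ball z (\<rho>/2) \<subseteq> ball y \<rho>"
    using zx by (simp_all add: ball_subset_ball_iff)
  then have "excess (\<Omega> \<inter> ball z (\<rho>/2)) p \<le> excess (\<Omega> \<inter> ball x \<rho>) p"
    "excess (\<Omega> \<inter> ball z (\<rho>/2)) r \<le> excess (\<Omega> \<inter> ball y \<rho>) r"
    by (auto intro!: excess_mono)
  then have "excess (\<Omega> \<inter> ball z (\<rho>/2)) p \<le> ennreal (M powr q * \<rho> powr lam)"
    "excess (\<Omega> \<inter> ball z (\<rho>/2)) r \<le> ennreal (M powr q * \<rho> powr lam)"
    using p r unfolding approx_def by (meson order_trans)+
  then obtain \<sigma> where "\<sigma> permutes {..<Q}" "\<And>i is y. i < Q \<Longrightarrow> length is \<le> k \<Longrightarrow> dist z y \<le> \<rho> \<Longrightarrow>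
        norm (part is (p i) y - part is (r (\<sigma> i)) y) \<le> C * M * \<rho> powr (\<beta> - real (length is))"
    using comparison[OF z \<rho> M, of p r] p r unfolding approx_def deviation_def by blast
  then show ?thesis using that[of \<sigma>] zx \<rho> by fastforce
qed

lemma approx_match_scale:
  assumes x: "x \<in> closure \<Omega>" and \<rho>: "0 < \<rho>" "\<rho> \<le> diameter \<Omega>"
    and M: "0 < M" and p: "approx M x \<rho> p" and r: "approx M x (\<rho>/2) r"
  obtains \<sigma> where "\<sigma> permutes {..<Q}"
    "\<And>i is. i < Q \<Longrightarrow> length is \<le> k \<Longrightarrow>
       norm (part is (p i) x - part is (r (\<sigma> i)) x) \<le> C * M * \<rho> powr (\<beta> - real (length is))"
proof -
  have "excess (\<Omega> \<inter> ball x (\<rho>/2)) p \<le> excess (\<Omega> \<inter> ball x \<rho>) p"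
    using \<rho> by (intro excess_mono Int_mono order_refl subset_ball) auto
  then have 1: "excess (\<Omega> \<inter> ball x (\<rho>/2)) p \<le> ennreal (M powr q * \<rho> powr lam)"
    using p unfolding approx_def by (meson order_trans)
  have "(\<rho>/2) powr lam \<le> \<rho> powr lam" using \<rho> lam by (intro powr_mono2) auto
  then have "M powr q * (\<rho>/2) powr lam \<le> M powr q * \<rho> powr lam" by (intro mult_left_mono) auto
  then have 2: "excess (\<Omega> \<inter> ball x (\<rho>/2)) r \<le> ennreal (M powr q * \<rho> powr lam)"
    using r unfolding approx_def by (meson order_trans ennreal_leI)
  from 1 2 obtain \<sigma> where "\<sigma> permutes {..<Q}" "\<And>i is y. i < Q \<Longrightarrow> length is \<le> k \<Longrightarrow> dist x y \<le> \<rho> \<Longrightarrow>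
        norm (part is (p i) y - part is (r (\<sigma> i)) y) \<le> C * M * \<rho> powr (\<beta> - real (length is))"
    using comparison[OF x \<rho> M, of p r] p r unfolding approx_def deviation_def by blast
  then show ?thesis using that[of \<sigma>] \<rho> by simp
qed

end

section \<open>Jets as limits of the approximating polynomials\<close>

lemma le_0_of_frequently:
  fixes e :: "nat \<Rightarrow> real"
  assumes "infinite H" "\<And>h. h \<in> H \<Longrightarrow> x \<le> e h" "e \<longlonglongrightarrow> 0"
  shows "x \<le> 0"
proof (rule ccontr)
  assume "\<not> x \<le> 0"
  then have "eventually (\<lambda>h. e h < x) sequentially" using assms(3) by (intro order_tendstoD(2)[of e 0]) auto
  then obtain N where "\<And>h. h \<ge> N \<Longrightarrow> e h < x" by (auto simp: eventually_sequentially)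
  then have "H \<subseteq> {..<N}" using assms(2) by (meson lessThan_iff not_less subsetI)
  then show False using assms(1) finite_subset by blast
qed

lemma frequent_permutation:
  assumes "\<And>h::nat. \<sigma> h permutes {..<Q::nat}"
  obtains \<tau> where "\<tau> permutes {..<Q}" "infinite {h. \<sigma> h = \<tau>}"
proof -
  have "finite (range \<sigma>)"
    by (rule finite_subset[of _ "{\<tau>. \<tau> permutes {..<Q}}"]) (use assms in \<open>auto simp: finite_permutations\<close>)
  then obtain h0 where "infinite {h \<in> UNIV. \<sigma> h = \<sigma> h0}"
    using pigeonhole_infinite[of UNIV \<sigma>] by auto
  then show ?thesis using that[of "\<sigma> h0"] assms by simp
qed

locale campanato_jets = campanato Q k q lam \<beta> A C \<Omega> u
  for Q k q lam \<beta> A C and \<Omega> :: "(real^'n::finite) set" and u :: "('n, 'm::finite) Qfun" +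
  assumes top: "real k < \<beta>"
begin

definition C1 :: real where "C1 = C / (1 - 2 powr (real k - \<beta>))"

lemma C1: "C1 > 0" "2 powr (real k - \<beta>) < 1"
proof -
  show "2 powr (real k - \<beta>) < 1" using powr_less_mono[of "real k - \<beta>" 0 2] top by simp
  then show "C1 > 0" using C by (simp add: C1_def)
qed

text \<open>
  The jet of u at y lists the derivatives up to order k of Q sheets at y. It is determined by u
  only up to a common permutation of the sheets.
\<close>

definition is_jet :: "real \<Rightarrow> real^'n \<Rightarrow> (nat \<Rightarrow> 'n list \<Rightarrow> real^'m) \<Rightarrow> bool" where
  "is_jet M y t \<longleftrightarrow> (\<forall>h. \<exists>p. approx M y (rad h) p \<and>
     (\<forall>i<Q. \<forall>is. length is \<le> k \<longrightarrow>
        norm (part is (p i) y - t i is) \<le> C1 * M * scale h (length is)))"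

lemma rad_powr: "rad h powr g = diameter \<Omega> powr g * (2 powr (- g)) ^ h"
proof -
  have "rad h powr g = diameter \<Omega> powr g / (2 ^ h) powr g"
    unfolding rad_def using diameter_pos by (simp add: powr_divide)
  also have "(2 ^ h :: real) powr g = (2 powr g) ^ h"
    by (simp add: powr_realpow[symmetric] powr_powr mult.commute)
  finally show ?thesis by (simp add: powr_minus divide_inverse power_inverse)
qed

lemma rad_powr_tendsto_0: "g > 0 \<Longrightarrow> (\<lambda>h. a * rad h powr g) \<longlonglongrightarrow> 0"
proof -
  assume "g > 0"
  then have "(2::real) powr (- g) < 1" using powr_less_mono[of "- g" 0 "2::real"] by simp
  then have "(\<lambda>h. a * (diameter \<Omega> powr g * (2 powr (- g)) ^ h)) \<longlonglongrightarrow> a * (diameter \<Omega> powr g * 0)"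
    by (intro tendsto_intros LIMSEQ_power_zero) auto
  then show ?thesis by (simp add: rad_powr)
qed

text \<open>
  Consecutive scales are matched by permutations, and composing these labels the sheets
  consistently at all scales. Since \<open>\<beta> > k\<close>, all derivatives up to order k then change by the terms
  of a geometric series.
\<close>

lemma jet_exists:
  assumes y: "y \<in> closure \<Omega>" and M: "admissible M"
  obtains t where "is_jet M y t"
proof -
  have M0: "M > 0" using M by (simp add: admissible_def)
  have "\<exists>p. approx M y (rad h) p" for h
    using M y rad(1,2)[of h] unfolding admissible_def by blast
  then obtain P where P: "\<And>h. approx M y (rad h) (P h)" by metis
  have "\<exists>\<sigma>. \<sigma> permutes {..<Q} \<and> (\<forall>i is. i < Q \<longrightarrow> length is \<le> k \<longrightarrow>
     norm (part is (P h i) y - part is (P (Suc h) (\<sigma> i)) y) \<le> C * M * scale h (length is))" for h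
    using approx_match_scale[OF y rad(1,2) M0 P[of h], of "P (Suc h)"] P[of "Suc h"] unfolding rad(4) by metis
  then obtain \<sigma> where \<sigma>: "\<And>h. \<sigma> h permutes {..<Q}" "\<And>h i is. i < Q \<Longrightarrow> length is \<le> k \<Longrightarrow>
     norm (part is (P h i) y - part is (P (Suc h) (\<sigma> h i)) y) \<le> C * M * scale h (length is)"
    by metis
  \<comment> \<open>\<open>\<tau> h i\<close> is the label at scale h of the sheet with label i at scale 0.\<close>
  define \<tau> where "\<tau> = rec_nat id (\<lambda>h f. \<sigma> h \<circ> f)"
  have \<tau>_Suc: "\<tau> (Suc h) i = \<sigma> h (\<tau> h i)" for h i by (simp add: \<tau>_def)
  have \<tau>: "\<tau> h permutes {..<Q}" for h
  proof (induction h)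
    case 0
    have "\<tau> 0 = id" by (simp add: \<tau>_def)
    then show ?case using permutes_id by metis
  next
    case (Suc h)
    have "\<tau> (Suc h) = \<sigma> h \<circ> \<tau> h" by (simp add: \<tau>_def)
    then show ?case using permutes_compose[OF Suc \<sigma>(1)] by metis
  qed
  have \<tau>Q: "\<tau> h i < Q" if "i < Q" for h i using permutes_in_image[OF \<tau>, of h i] that by simp
  have "\<exists>l. i < Q \<longrightarrow> length is \<le> k \<longrightarrow> (\<forall>h. norm (part is (P h (\<tau> h i)) y - l)
     \<le> C1 * M * scale h (length is))" for i "is"
  proof (cases "i < Q \<and> length is \<le> k")
    case True
    let ?g = "\<beta> - real (length is)"
    have g: "?g \<ge> \<beta> - real k" using True by simp
    have c: "(0::real) \<le> 2 powr - ?g" "2 powr - ?g \<le> 2 powr (real k - \<beta>)" using g by auto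
    then have c1: "2 powr - ?g < 1" using C1(2) by linarith
    obtain l where l: "\<And>h. norm (part is (P h (\<tau> h i)) y - l)
       \<le> (C * M * diameter \<Omega> powr ?g) * (2 powr - ?g) ^ h / (1 - 2 powr - ?g)"
    proof (rule geometric_limit)
      show "norm (part is (P (Suc h) (\<tau> (Suc h) i)) y - part is (P h (\<tau> h i)) y)
        \<le> (C * M * diameter \<Omega> powr ?g) * (2 powr - ?g) ^ h" for h
        using \<sigma>(2)[OF \<tau>Q, of i "is" h h] True unfolding rad_powr \<tau>_Suc
        by (simp add: norm_minus_commute mult.assoc)
      show "2 powr - ?g < 1" by (fact c1)
    qed (use C M0 in auto)
    have "(C * M * diameter \<Omega> powr ?g) * (2 powr - ?g) ^ h / (1 - 2 powr - ?g) \<le> C1 * M * rad h powr ?g" for h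
    proof -
      have "(C * M * diameter \<Omega> powr ?g) * (2 powr - ?g) ^ h / (1 - 2 powr - ?g)
        \<le> (C * M * diameter \<Omega> powr ?g) * (2 powr - ?g) ^ h / (1 - 2 powr (real k - \<beta>))"
        using c c1 C1(2) C M0 by (intro divide_left_mono mult_nonneg_nonneg mult_pos_pos) simp_all
      then show ?thesis by (simp add: C1_def rad_powr mult_ac)
    qed
    then show ?thesis using l order_trans by blast
  qed auto
  then obtain t where t: "\<And>i is h. i < Q \<Longrightarrow> length is \<le> k \<Longrightarrow> norm (part is (P h (\<tau> h i)) y - t i is)
     \<le> C1 * M * scale h (length is)" by metis
  have "is_jet M y t" unfolding is_jet_def
    by (intro allI exI[of _ "\<lambda>i. P _ (\<tau> _ i)"] conjI impI) (use approx_permute[OF P \<tau>] t in auto)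
  then show ?thesis by (rule that)
qed

text \<open>Any almost optimal polynomial at a point x near y knows the jet at y, up to its natural error.\<close>

lemma jet_match:
  assumes t: "is_jet M y t" and xy: "x \<in> closure \<Omega>" "y \<in> closure \<Omega>" "dist x y \<le> rad h"
    and M: "0 < M" and p: "approx M x (rad h) p"
  obtains \<sigma> where "\<sigma> permutes {..<Q}" "\<And>i is. i < Q \<Longrightarrow> length is \<le> k \<Longrightarrow>
    norm (part is (p i) y - t (\<sigma> i) is) \<le> (C + C1) * M * scale h (length is)"
proof -
  obtain r where r: "approx M y (rad h) r" "\<And>i is. i < Q \<Longrightarrow> length is \<le> k \<Longrightarrow>
     norm (part is (r i) y - t i is) \<le> C1 * M * scale h (length is)"
    using t unfolding is_jet_def by blast
  obtain \<sigma> where \<sigma>: "\<sigma> permutes {..<Q}" "\<And>i is w. i < Q \<Longrightarrow> length is \<le> k \<Longrightarrow> w \<in> {x, y} \<Longrightarrow>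
       norm (part is (p i) w - part is (r (\<sigma> i)) w) \<le> C * M * scale h (length is)"
    by (rule approx_match[OF xy rad(1,2) M p r(1)]) blast
  have "norm (part is (p i) y - t (\<sigma> i) is) \<le> (C + C1) * M * scale h (length is)"
    if "i < Q" "length is \<le> k" for i "is"
  proof -
    have "\<sigma> i < Q" using permutes_in_image[OF \<sigma>(1), of i] that by simp
    then show ?thesis
      using norm_diff_triangle_le[OF \<sigma>(2)[OF that, of y] r(2)[OF _ that(2), of "\<sigma> i"]]
      by (simp add: algebra_simps)
  qed
  then show ?thesis using that \<sigma>(1) by blast
qed

lemma jet_unique:
  assumes t: "is_jet M y t" "is_jet M y t'" and y: "y \<in> closure \<Omega>" and M: "0 < M"
  obtains \<sigma> where "\<sigma> permutes {..<Q}" "\<And>i is. i < Q \<Longrightarrow> length is \<le> k \<Longrightarrow> t i is = t' (\<sigma> i) is"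
proof -
  have "\<exists>\<sigma>. \<sigma> permutes {..<Q} \<and> (\<forall>i is. i < Q \<longrightarrow> length is \<le> k \<longrightarrow>
     norm (t i is - t' (\<sigma> i) is) \<le> (C1 + (C + C1)) * M * scale h (length is))" for h
  proof -
    obtain p where p: "approx M y (rad h) p" "\<And>i is. i < Q \<Longrightarrow> length is \<le> k \<Longrightarrow>
       norm (part is (p i) y - t i is) \<le> C1 * M * scale h (length is)"
      using t(1) unfolding is_jet_def by blast
    have "dist y y \<le> rad h" using rad(1)[of h] by simp
    from jet_match[OF t(2) y y this M p(1)] obtain \<sigma> where \<sigma>: "\<sigma> permutes {..<Q}"
      "\<And>i is. i < Q \<Longrightarrow> length is \<le> k \<Longrightarrow>
      norm (part is (p i) y - t' (\<sigma> i) is) \<le> (C + C1) * M * scale h (length is)" by blast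
    have "norm (t i is - t' (\<sigma> i) is) \<le> (C1 + (C + C1)) * M * scale h (length is)"
      if "i < Q" "length is \<le> k" for i "is"
      using norm_diff_triangle_le[OF p(2)[OF that, unfolded norm_minus_commute[of "part is (p i) y"]] \<sigma>(2)[OF that]]
      by (simp add: algebra_simps)
    then show ?thesis using \<sigma>(1) by blast
  qed
  then obtain s where s: "\<And>h. s h permutes {..<Q}" "\<And>h i is. i < Q \<Longrightarrow> length is \<le> k \<Longrightarrow>
     norm (t i is - t' (s h i) is) \<le> (C1 + (C + C1)) * M * scale h (length is)" by metis
  obtain \<sigma> where \<sigma>: "\<sigma> permutes {..<Q}" "infinite {h. s h = \<sigma>}"
    by (rule frequent_permutation[OF s(1)])
  have "t i is = t' (\<sigma> i) is" if "i < Q" "length is \<le> k" for i "is"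
  proof -
    have "norm (t i is - t' (\<sigma> i) is) \<le> 0"
    proof (rule le_0_of_frequently[OF \<sigma>(2)])
      show "norm (t i is - t' (\<sigma> i) is) \<le> (C1 + (C + C1)) * M * scale h (length is)"
        if "h \<in> {h. s h = \<sigma>}" for h
        using s(2)[OF \<open>i < Q\<close> \<open>length is \<le> k\<close>, of h] that by simp
      show "(\<lambda>h. (C1 + (C + C1)) * M * scale h (length is)) \<longlonglongrightarrow> 0"
        by (rule rad_powr_tendsto_0) (use that top in linarith)
    qed
    then show ?thesis by simp
  qed
  then show ?thesis using that \<sigma>(1) by blast
qed

lemma is_jet_mono:
  assumes "is_jet M y t" "0 \<le> M" "M \<le> M'"
  shows "is_jet M' y t"
  unfolding is_jet_def
proof
  fix h
  obtain p where p: "approx M y (rad h) p" "\<And>i is. i < Q \<Longrightarrow> length is \<le> k \<Longrightarrow>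
       norm (part is (p i) y - t i is) \<le> C1 * M * scale h (length is)"
    using assms(1) unfolding is_jet_def by blast
  have "C1 * M * rad h powr g \<le> C1 * M' * rad h powr g" for g
    using assms C1 by (intro mult_right_mono mult_left_mono) auto
  then show "\<exists>p. approx M' y (rad h) p \<and> (\<forall>i<Q. \<forall>is. length is \<le> k \<longrightarrow>
        norm (part is (p i) y - t i is) \<le> C1 * M' * scale h (length is))"
    using approx_mono[OF p(1) assms(2,3)] p(2) order_trans by blast
qed

text \<open>
  One jet serves all admissible M at once. So the function built from the jets satisfies the final
  estimate with every M above the seminorm of u, and thus with the seminorm itself even if that is
  zero and the infimum over polynomials is not attained.
\<close>

lemma is_jet_lower:
  assumes t: "is_jet M y t" and y: "y \<in> closure \<Omega>" and M: "0 < M" and M': "admissible M'"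
  shows "is_jet M' y t"
proof (cases "M \<le> M'")
  case True
  then show ?thesis using is_jet_mono[OF t] M by simp
next
  case False
  have M'0: "M' > 0" using M' by (simp add: admissible_def)
  obtain t' where t': "is_jet M' y t'" using jet_exists[OF y M'] by blast
  then have "is_jet M y t'" using is_jet_mono[of M' y t' M] False M'0 by simp
  then obtain \<sigma> where \<sigma>: "\<sigma> permutes {..<Q}" "\<And>i is. i < Q \<Longrightarrow> length is \<le> k \<Longrightarrow> t i is = t' (\<sigma> i) is"
    using jet_unique[OF t _ y M] by metis
  show ?thesis unfolding is_jet_def
  proof
    fix h
    obtain p where p: "approx M' y (rad h) p" "\<And>i is. i < Q \<Longrightarrow> length is \<le> k \<Longrightarrow>
         norm (part is (p i) y - t' i is) \<le> C1 * M' * scale h (length is)"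
      using t' unfolding is_jet_def by blast
    have "\<sigma> i < Q" if "i < Q" for i using permutes_in_image[OF \<sigma>(1), of i] that by simp
    then show "\<exists>p. approx M' y (rad h) p \<and> (\<forall>i<Q. \<forall>is. length is \<le> k \<longrightarrow>
        norm (part is (p i) y - t i is) \<le> C1 * M' * scale h (length is))"
      using approx_permute[OF p(1) \<sigma>(1)] p(2) \<sigma>(2) by (intro exI[of _ "\<lambda>i. p (\<sigma> i)"]) simp
  qed
qed

lemma jet_field:
  assumes "admissible M0"
  obtains t where "\<And>y M. y \<in> closure \<Omega> \<Longrightarrow> admissible M \<Longrightarrow> is_jet M y (t y)"
proof -
  have "\<forall>y\<in>closure \<Omega>. \<exists>t. is_jet M0 y t" using jet_exists assms by metis
  then obtain t where "\<And>y. y \<in> closure \<Omega> \<Longrightarrow> is_jet M0 y (t y)" by metis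
  then show ?thesis using that is_jet_lower assms unfolding admissible_def by metis
qed

end

section \<open>Derivatives of functions valued in tuples\<close>

abbreviation index_count :: "'n::finite itself \<Rightarrow> nat \<Rightarrow> real" where
  "index_count _ j \<equiv> real (card {is :: 'n list. length is = j})"

lemma tensor_dist_le:
  fixes S T :: "('n::finite, 'm::finite) tensor"
  assumes "\<And>is. length is = j \<Longrightarrow> norm (S is - T is) \<le> c" "c \<ge> 0"
  shows "tensor_dist j S T \<le> sqrt (index_count TYPE('n) j) * c"
proof -
  have "(\<Sum>is | length is = j. (norm (S is - T is))\<^sup>2) \<le> (\<Sum>is :: 'n list | length is = j. c\<^sup>2)"
    using assms(1) by (intro sum_mono power_mono) auto
  then have "tensor_dist j S T \<le> sqrt (index_count TYPE('n) j * c\<^sup>2)" by (simp add: tensor_dist_def)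
  also have "\<dots> = sqrt (index_count TYPE('n) j) * c" using assms(2) by (simp add: real_sqrt_mult)
  finally show ?thesis .
qed

lemma norm_le_tensor_dist:
  fixes S T :: "('n::finite, 'm::finite) tensor"
  assumes "length is = j"
  shows "norm (S is - T is) \<le> tensor_dist j S T"
  unfolding tensor_dist_def using assms
  by (intro real_le_rsqrt member_le_sum finite_index_lists) auto

lemma Qdist_tensor_le:
  fixes S T :: "nat \<Rightarrow> ('n::finite, 'm::finite) tensor"
  assumes "\<sigma> permutes {..<Q}" "\<tau> permutes {..<Q}" "c \<ge> 0"
    and "\<And>i is. i < Q \<Longrightarrow> length is = j \<Longrightarrow> norm (S (\<sigma> i) is - T (\<tau> i) is) \<le> c"
  shows "Qdist (tensor_dist j) Q (tup Q S) (tup Q T) \<le> sqrt Q * (sqrt (index_count TYPE('n) j) * c)"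
proof -
  have nn: "tensor_dist j R R' \<ge> 0" for R R' :: "('n, 'm) tensor" by (simp add: tensor_dist_def sum_nonneg)
  have "Qdist (tensor_dist j) Q (tup Q (\<lambda>i. S (\<sigma> i))) (tup Q (\<lambda>i. T (\<tau> i)))
      \<le> sqrt Q * (sqrt (index_count TYPE('n) j) * c)"
    by (rule Qdist_le_of_matching[OF permutes_id])
      (use assms(3,4) nn in \<open>auto intro!: tensor_dist_le mult_nonneg_nonneg\<close>)
  then show ?thesis using tup_permute[OF assms(1), of S] tup_permute[OF assms(2), of T] by simp
qed

text \<open>
  For each direction h, some matching of the sheets occurs at infinitely many points x + s h with
  s tending to 0 and so matches the directional derivatives. The directions that
  belong to one permutation form a subspace; finitely many of them cover the
  space, so one of them is the whole space. The values of w near x must be Q-tuples, since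
  \<open>Qdist\<close> is 0 on multisets of other sizes.
\<close>

lemma has_Qderiv_unique:
  fixes w :: "real^'n::finite \<Rightarrow> ('n, 'm::finite) tensor multiset"
  assumes "has_Qderiv Q j w x V" "has_Qderiv Q j w x V'"
    and S: "open S" "x \<in> S" "\<And>y. y \<in> S \<Longrightarrow> w y \<in> Qtuples Q (tensors j)"
  shows "V = V'"
proof -
  interpret M: Metric_space "Qtuples Q (tensors j)" "Qdist (tensor_dist j) Q :: ('n, 'm) tensor multiset \<Rightarrow> _"
    by (rule Metric_space_Qtuples[OF Metric_space_tensors])
  let ?G = "Qdist (tensor_dist j) Q :: ('n, 'm) tensor multiset \<Rightarrow> _"
  obtain T B where T: "w x = tup Q T" "V = tup Q B" "\<forall>i<Q. T i \<in> tensors j \<and> B i \<in> tensors (Suc j)"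
    "((\<lambda>h. ?G (w (x + h)) (tup Q (\<lambda>i. tensor_affine (T i) (B i) h)) / norm h) \<longlongrightarrow> 0) (at 0)"
    using assms(1) unfolding has_Qderiv_def by blast
  obtain T' B' where T': "w x = tup Q T'" "V' = tup Q B'" "\<forall>i<Q. T' i \<in> tensors j \<and> B' i \<in> tensors (Suc j)"
    "((\<lambda>h. ?G (w (x + h)) (tup Q (\<lambda>i. tensor_affine (T' i) (B' i) h)) / norm h) \<longlongrightarrow> 0) (at 0)"
    using assms(2) unfolding has_Qderiv_def by blast
  define L where "L \<sigma> i is h = (\<Sum>a\<in>UNIV. (h $ a) *\<^sub>R (B i (a # is) - B' (\<sigma> i) (a # is)))"
    for \<sigma> :: "nat \<Rightarrow> nat" and i "is" and h :: "real^'n"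
  have matched: "\<exists>\<sigma>. \<sigma> permutes {..<Q} \<and> (\<forall>i<Q. \<forall>is. length is = j \<longrightarrow> L \<sigma> i is h = 0)" for h
  proof (cases "h = 0")
    case True
    show ?thesis using permutes_id[of "{..<Q}"] by (auto simp: L_def True simp del: permutes_id)
  next
    case False
    define s where "s N = 1 / real (Suc N)" for N
    have s: "s N > 0" for N by (simp add: s_def)
    have s0: "s \<longlonglongrightarrow> 0" unfolding s_def by (rule LIMSEQ_inverse_real_of_nat[unfolded inverse_eq_divide])
    define a where "a N = tup Q (\<lambda>i. tensor_affine (T i) (B i) (s N *\<^sub>R h))" for N
    define a' where "a' N = tup Q (\<lambda>i. tensor_affine (T' i) (B' i) (s N *\<^sub>R h))" for N
    have "filterlim (\<lambda>N. s N *\<^sub>R h) (at 0) sequentially"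
    proof (rule filterlim_atI)
      show "(\<lambda>N. s N *\<^sub>R h) \<longlonglongrightarrow> 0" using tendsto_scaleR[OF s0 tendsto_const, of h] by simp
      show "eventually (\<lambda>N. s N *\<^sub>R h \<noteq> 0) sequentially" using s False by (auto simp: less_imp_neq[symmetric])
    qed
    then have "(\<lambda>N. ?G (w (x + s N *\<^sub>R h)) (a N) / norm (s N *\<^sub>R h)
        + ?G (w (x + s N *\<^sub>R h)) (a' N) / norm (s N *\<^sub>R h)) \<longlonglongrightarrow> 0 + 0"
      unfolding a_def a'_def by (intro tendsto_add filterlim_compose[OF T(4)] filterlim_compose[OF T'(4)])
    then have "(\<lambda>N. norm h * (?G (w (x + s N *\<^sub>R h)) (a N) / norm (s N *\<^sub>R h)
        + ?G (w (x + s N *\<^sub>R h)) (a' N) / norm (s N *\<^sub>R h))) \<longlonglongrightarrow> norm h * (0 + 0)"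
      by (intro tendsto_mult tendsto_const)
    moreover have "norm h * (?G (w (x + s N *\<^sub>R h)) (a N) / norm (s N *\<^sub>R h)
        + ?G (w (x + s N *\<^sub>R h)) (a' N) / norm (s N *\<^sub>R h))
        = (?G (w (x + s N *\<^sub>R h)) (a N) + ?G (w (x + s N *\<^sub>R h)) (a' N)) / s N" for N
      using False s[of N] by (simp add: field_simps)
    ultimately have e: "(\<lambda>N. (?G (w (x + s N *\<^sub>R h)) (a N) + ?G (w (x + s N *\<^sub>R h)) (a' N)) / s N) \<longlonglongrightarrow> 0"
      by simp
    define e where "e N = (?G (w (x + s N *\<^sub>R h)) (a N) + ?G (w (x + s N *\<^sub>R h)) (a' N)) / s N" for N
    have e0: "e \<longlonglongrightarrow> 0" unfolding e_def by (rule e)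
    have "\<exists>\<sigma>. \<sigma> permutes {..<Q} \<and> (\<forall>i<Q. \<forall>is. length is = j \<longrightarrow>
      norm (T i is - T' (\<sigma> i) is + s N *\<^sub>R L \<sigma> i is h) \<le> ?G (a N) (a' N))" for N
    proof -
      obtain \<sigma> where \<sigma>: "\<sigma> permutes {..<Q}" "\<And>i. i < Q \<Longrightarrow>
        tensor_dist j (tensor_affine (T i) (B i) (s N *\<^sub>R h)) (tensor_affine (T' (\<sigma> i)) (B' (\<sigma> i)) (s N *\<^sub>R h))
          \<le> ?G (a N) (a' N)"
        unfolding a_def a'_def by (rule Qdist_matching[of Q "tensor_dist j" "\<lambda>i. tensor_affine (T i) (B i) (s N *\<^sub>R h)"
            "\<lambda>i. tensor_affine (T' i) (B' i) (s N *\<^sub>R h)"]) blast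
      have eq: "tensor_affine (T i) (B i) (s N *\<^sub>R h) is - tensor_affine (T' (\<sigma> i)) (B' (\<sigma> i)) (s N *\<^sub>R h) is
         = T i is - T' (\<sigma> i) is + s N *\<^sub>R L \<sigma> i is h" for i "is"
        by (simp add: tensor_affine_def L_def scaleR_sum_right scaleR_diff_right sum_subtractf algebra_simps)
      have "norm (T i is - T' (\<sigma> i) is + s N *\<^sub>R L \<sigma> i is h) \<le> ?G (a N) (a' N)"
        if "i < Q" "length is = j" for i "is"
        using norm_le_tensor_dist[OF that(2), of "tensor_affine (T i) (B i) (s N *\<^sub>R h)"
            "tensor_affine (T' (\<sigma> i)) (B' (\<sigma> i)) (s N *\<^sub>R h)"] \<sigma>(2)[OF that(1)] unfolding eq by linarith
      then show ?thesis using \<sigma>(1) by blast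
    qed
    then obtain \<sigma>s where \<sigma>s: "\<And>N. \<sigma>s N permutes {..<Q}" "\<And>N i is. i < Q \<Longrightarrow> length is = j \<Longrightarrow>
      norm (T i is - T' (\<sigma>s N i) is + s N *\<^sub>R L (\<sigma>s N) i is h) \<le> ?G (a N) (a' N)" by metis
    have aff: "tensor_affine (T i) (B i) g \<in> tensors j" "tensor_affine (T' i) (B' i) g \<in> tensors j" if "i < Q" for i g
      using T(3) T'(3) that by (auto simp: tensors_def tensor_affine_def)
    have "(\<lambda>N. x + s N *\<^sub>R h) \<longlonglongrightarrow> x + 0 *\<^sub>R h" by (intro tendsto_intros s0)
    then have "eventually (\<lambda>N. x + s N *\<^sub>R h \<in> S) sequentially"
      using S(1,2) by (intro topological_tendstoD) auto
    then obtain N0 where N0: "\<And>N. N \<ge> N0 \<Longrightarrow> x + s N *\<^sub>R h \<in> S" by (auto simp: eventually_sequentially)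
    have Gle: "?G (a N) (a' N) \<le> s N * e N" if "N \<ge> N0" for N
    proof -
      have "a N \<in> Qtuples Q (tensors j)" "a' N \<in> Qtuples Q (tensors j)"
        unfolding a_def a'_def by (intro tup_in_Qtuples aff; assumption)+
      then have "?G (a N) (a' N) \<le> ?G (w (x + s N *\<^sub>R h)) (a N) + ?G (w (x + s N *\<^sub>R h)) (a' N)"
        using M.triangle[of "a N" "w (x + s N *\<^sub>R h)" "a' N"] S(3)[OF N0[OF that]] M.commute[of "a N"] by simp
      then show ?thesis using s[of N] by (simp add: e_def)
    qed
    obtain \<sigma> where \<sigma>: "\<sigma> permutes {..<Q}" "infinite {N. \<sigma>s N = \<sigma>}"
      by (rule frequent_permutation[OF \<sigma>s(1)])
    define H where "H = {N. \<sigma>s N = \<sigma>} - {..<N0}"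
    have H: "infinite H" using \<sigma>(2) by (simp add: H_def)
    have le: "norm (T i is - T' (\<sigma> i) is + s N *\<^sub>R L \<sigma> i is h) \<le> s N * e N"
      if "N \<in> H" "i < Q" "length is = j" for N i "is"
      using \<sigma>s(2)[of i "is" N] Gle[of N] that by (auto simp: H_def)
    have "L \<sigma> i is h = 0" if i: "i < Q" "length is = j" for i "is"
    proof -
      have "norm (T i is - T' (\<sigma> i) is) \<le> 0"
      proof (rule le_0_of_frequently[OF H])
        fix N assume "N \<in> H"
        have "norm (T i is - T' (\<sigma> i) is) \<le> norm (T i is - T' (\<sigma> i) is + s N *\<^sub>R L \<sigma> i is h) + norm (s N *\<^sub>R L \<sigma> i is h)"
          using norm_triangle_ineq4[of "T i is - T' (\<sigma> i) is + s N *\<^sub>R L \<sigma> i is h" "s N *\<^sub>R L \<sigma> i is h"] by simp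
        then show "norm (T i is - T' (\<sigma> i) is) \<le> s N * e N + s N * norm (L \<sigma> i is h)"
          using le[OF \<open>N \<in> H\<close> i] s[of N] by simp
      next
        have "(\<lambda>N. s N * e N + s N * norm (L \<sigma> i is h)) \<longlonglongrightarrow> 0 * 0 + 0 * norm (L \<sigma> i is h)"
          by (intro tendsto_intros s0 e0)
        then show "(\<lambda>N. s N * e N + s N * norm (L \<sigma> i is h)) \<longlonglongrightarrow> 0" by simp
      qed
      then have "norm (L \<sigma> i is h) \<le> e N" if "N \<in> H" for N
        using le[OF that i] s[of N] by simp
      then have "norm (L \<sigma> i is h) \<le> 0" by (rule le_0_of_frequently[OF H _ e0])
      then show ?thesis by simp
    qed
    then show ?thesis using \<sigma>(1) by blast
  qed
  define W where "W \<sigma> = {h. \<forall>i<Q. \<forall>is. length is = j \<longrightarrow> L \<sigma> i is h = 0}" for \<sigma>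
  have sub: "subspace (W \<sigma>)" for \<sigma>
    unfolding W_def L_def
    by (auto simp: subspace_def scaleR_add_left sum.distrib scaleR_scaleR[symmetric] scaleR_sum_right[symmetric]
        simp del: scaleR_scaleR)
  have "\<exists>\<sigma>. \<sigma> permutes {..<Q} \<and> dim (W \<sigma>) = DIM(real^'n)"
  proof (rule ccontr)
    assume n: "\<not> ?thesis"
    have "negligible (W \<sigma>)" if "\<sigma> permutes {..<Q}" for \<sigma>
    proof (rule negligible_lowdim)
      show "dim (W \<sigma>) < DIM(real^'n)" using n that dim_subset_UNIV[of "W \<sigma>"] by (metis le_neq_implies_less)
    qed
    then have "negligible (\<Union>(W ` {\<sigma>. \<sigma> permutes {..<Q}}))"
      by (intro negligible_Union) (auto simp: finite_permutations)
    moreover have "\<Union>(W ` {\<sigma>. \<sigma> permutes {..<Q}}) = UNIV" using matched by (auto simp: W_def)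
    ultimately show False by simp
  qed
  then obtain \<sigma> where \<sigma>: "\<sigma> permutes {..<Q}" "dim (W \<sigma>) = DIM(real^'n)" by blast
  then have W: "W \<sigma> = UNIV" using dim_eq_full[of "W \<sigma>"] span_eq_iff[of "W \<sigma>"] sub by metis
  have "B i = B' (\<sigma> i)" if i: "i < Q" for i
  proof
    fix l
    have \<sigma>i: "\<sigma> i < Q" using permutes_in_image[OF \<sigma>(1), of i] i by simp
    show "B i l = B' (\<sigma> i) l"
    proof (cases "length l = Suc j")
      case True
      then obtain a "is" where l: "l = a # is" "length is = j" by (cases l) auto
      have "L \<sigma> i is (axis a 1) = 0" using W i l(2) unfolding W_def by blast
      moreover have "L \<sigma> i is (axis a 1) = (\<Sum>b\<in>UNIV. if b = a then B i (b # is) - B' (\<sigma> i) (b # is) else 0)"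
        unfolding L_def by (intro sum.cong) (auto simp: axis_def)
      ultimately show ?thesis by (simp add: l)
    next
      case False
      then show ?thesis using T(3) T'(3) i \<sigma>i by (simp add: tensors_def)
    qed
  qed
  then have "V = tup Q (\<lambda>i. B' (\<sigma> i))" unfolding T(2) by (intro sum.cong) auto
  then show ?thesis unfolding T'(2) using tup_permute[OF \<sigma>(1)] by metis
qed

section \<open>Regularity of the jets\<close>

lemma taylor_remainder_2:
  fixes f :: "real^'n::finite \<Rightarrow> real^'m::finite"
  assumes f: "poly_fun k f" and h: "norm h \<le> 1" and B: "\<And>js. norm (part js f x) \<le> B"
  shows "norm (f (x + h) - f x - (\<Sum>a\<in>UNIV. (h $ a) *\<^sub>R pderiv_coord a f x))
    \<le> (\<Sum>j\<le>k. index_count TYPE('n) (Suc (Suc j))) * B * (norm h)\<^sup>2"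
proof -
  let ?g = "\<lambda>j. (1 / fact j) *\<^sub>R (\<Sum>is | length is = j. dir_prod h is *\<^sub>R part is f x)"
  have B0: "B \<ge> 0" using B[of "[]"] norm_ge_zero order_trans by blast
  have "f (x + h) = (\<Sum>j\<le>Suc (Suc k). ?g j)"
    by (rule poly_fun_taylor) (use poly_fun_mono[OF f] in simp)
  also have "\<dots> = ?g 0 + (?g 1 + (\<Sum>j\<le>k. ?g (Suc (Suc j))))"
    by (simp only: sum.atMost_Suc_shift One_nat_def)
  also have "?g 0 = f x" by simp
  also have "?g 1 = (\<Sum>a\<in>UNIV. (h $ a) *\<^sub>R pderiv_coord a f x)"
    unfolding One_nat_def sum_lists_Suc by simp
  finally have "f (x + h) - f x - (\<Sum>a\<in>UNIV. (h $ a) *\<^sub>R pderiv_coord a f x) = (\<Sum>j\<le>k. ?g (Suc (Suc j)))"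
    by simp
  moreover have "norm (?g (Suc (Suc j))) \<le> index_count TYPE('n) (Suc (Suc j)) * B * (norm h)\<^sup>2" for j
  proof -
    have "norm (\<Sum>is | length is = Suc (Suc j). dir_prod h is *\<^sub>R part is f x)
      \<le> (\<Sum>is :: 'n list | length is = Suc (Suc j). (norm h)\<^sup>2 * B)"
    proof (rule order_trans[OF norm_sum], rule sum_mono)
      fix js :: "'n list" assume "js \<in> {is. length is = Suc (Suc j)}"
      then have "\<bar>dir_prod h js\<bar> \<le> norm h ^ Suc (Suc j)" using abs_dir_prod_le[of h js] by simp
      also have "\<dots> \<le> (norm h)\<^sup>2" using h by (intro power_decreasing) auto
      finally show "norm (dir_prod h js *\<^sub>R part js f x) \<le> (norm h)\<^sup>2 * B"
        using B[of js] by (simp add: mult_mono)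
    qed
    also have "\<dots> = index_count TYPE('n) (Suc (Suc j)) * B * (norm h)\<^sup>2" by simp
    finally have "norm (\<Sum>is | length is = Suc (Suc j). dir_prod h is *\<^sub>R part is f x)
      \<le> index_count TYPE('n) (Suc (Suc j)) * B * (norm h)\<^sup>2" .
    moreover have "norm (?g (Suc (Suc j))) \<le> norm (\<Sum>is | length is = Suc (Suc j). dir_prod h is *\<^sub>R part is f x)"
      using mult_right_mono[of "1 / fact (Suc (Suc j))" 1 "norm (\<Sum>is | length is = Suc (Suc j). dir_prod h is *\<^sub>R part is f x)"]
        fact_ge_1[of "Suc (Suc j)", where ?'a = real]
      by (simp add: divide_le_eq del: fact_Suc)
    ultimately show ?thesis by linarith
  qed
  then have "norm (\<Sum>j\<le>k. ?g (Suc (Suc j))) \<le> (\<Sum>j\<le>k. index_count TYPE('n) (Suc (Suc j)) * B * (norm h)\<^sup>2)"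
    by (intro order_trans[OF norm_sum] sum_mono)
  ultimately show ?thesis by (simp add: sum_distrib_right)
qed

locale campanato_jet_field = campanato_jets Q k q lam \<beta> A C \<Omega> u
  for Q k q lam \<beta> A C and \<Omega> :: "(real^'n::finite) set" and u :: "('n, 'm::finite) Qfun" +
  fixes t :: "real^'n \<Rightarrow> nat \<Rightarrow> 'n list \<Rightarrow> real^'m" and M0 :: real
  assumes M0: "admissible M0"
    and jet: "\<And>y M. y \<in> closure \<Omega> \<Longrightarrow> admissible M \<Longrightarrow> is_jet M y (t y)"
begin

definition layer :: "nat \<Rightarrow> real^'n \<Rightarrow> nat \<Rightarrow> ('n, 'm) tensor" where
  "layer j y i = (\<lambda>is. if length is = j then t y i is else 0)"

text \<open>On \<open>\<Omega>\<close> this is the derivative of order j of v, see \<open>QD_v\<close>; on the closure it is the extension.\<close>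

definition D :: "nat \<Rightarrow> real^'n \<Rightarrow> ('n, 'm) tensor multiset" where
  "D j y = tup Q (layer j y)"

definition v :: "('n, 'm) Qfun" where
  "v y = tup Q (\<lambda>i. t y i [])"

definition C2 :: real where "C2 = C + C1"

lemma C2: "C2 > 0" using C C1 by (simp add: C2_def)

lemma layer_tensor: "layer j y i \<in> tensors j"
  by (simp add: layer_def tensors_def)

lemma D_in_Qtuples: "D j y \<in> Qtuples Q (tensors j)"
  unfolding D_def by (intro tup_in_Qtuples layer_tensor)

lemma in_closure: "x \<in> \<Omega> \<Longrightarrow> x \<in> closure \<Omega>"
  using closure_subset by blast

lemma ex_approx:
  assumes "admissible M" "x \<in> closure \<Omega>"
  obtains p where "approx M x (rad h) p"
  using assms rad(1,2)[of h] unfolding admissible_def by blast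

lemma layer_match:
  assumes "admissible M" "x \<in> closure \<Omega>" "y \<in> closure \<Omega>" "dist x y \<le> rad h" "approx M x (rad h) p"
  obtains \<sigma> where "\<sigma> permutes {..<Q}" "\<And>i is. i < Q \<Longrightarrow> length is \<le> k \<Longrightarrow>
    norm (part is (p i) y - t y (\<sigma> i) is) \<le> C2 * M * scale h (length is)"
  using jet_match[OF jet[OF assms(3,1)] assms(2-4) _ assms(5)] assms(1)
  unfolding admissible_def C2_def by blast

text \<open>
  A derivative of top order of the comparison polynomial is the same at both points, so it is close to
  the jets at both.
\<close>

lemma holder_estimate:
  assumes M: "admissible M" and xy: "x \<in> closure \<Omega>" "y \<in> closure \<Omega>" "x \<noteq> y"
  shows "Qdist (tensor_dist k) Q (D k x) (D k y)
    \<le> sqrt Q * (sqrt (index_count TYPE('n) k) * (2 * C2 * 2 powr (\<beta> - real k))) * M * norm (x - y) powr (\<beta> - real k)"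
proof -
  have M0: "M > 0" using M by (simp add: admissible_def)
  have "0 < dist x y" "dist x y \<le> diameter \<Omega>" using xy dist_le_diameter by auto
  then obtain h where h: "dist x y \<le> rad h" "rad h < 2 * dist x y" by (rule rad_sandwich)
  obtain p where p: "approx M x (rad h) p" using ex_approx[OF M xy(1)] .
  have "dist x x \<le> rad h" using rad(1)[of h] by simp
  then obtain \<sigma> where \<sigma>: "\<sigma> permutes {..<Q}" "\<And>i is. i < Q \<Longrightarrow> length is \<le> k \<Longrightarrow>
    norm (part is (p i) x - t x (\<sigma> i) is) \<le> C2 * M * scale h (length is)"
    using layer_match[OF M xy(1,1) _ p] by blast
  obtain \<tau> where \<tau>: "\<tau> permutes {..<Q}" "\<And>i is. i < Q \<Longrightarrow> length is \<le> k \<Longrightarrow>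
    norm (part is (p i) y - t y (\<tau> i) is) \<le> C2 * M * scale h (length is)"
    using layer_match[OF M xy(1,2) h(1) p] by blast
  have "Qdist (tensor_dist k) Q (D k x) (D k y)
     \<le> sqrt Q * (sqrt (index_count TYPE('n) k) * (2 * C2 * M * scale h k))"
    unfolding D_def
  proof (rule Qdist_tensor_le[OF \<sigma>(1) \<tau>(1)])
    fix i and "is" :: "'n list" assume i: "i < Q" "length is = k"
    have eq: "part is (p i) x = part is (p i) y"
      using part_top_const p i unfolding approx_def by blast
    have 1: "norm (t x (\<sigma> i) is - part is (p i) y) \<le> C2 * M * scale h k"
      using \<sigma>(2)[of i "is"] i eq by (simp add: norm_minus_commute)
    have 2: "norm (part is (p i) y - t y (\<tau> i) is) \<le> C2 * M * scale h k"
      using \<tau>(2)[of i "is"] i by simp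
    show "norm (layer k x (\<sigma> i) is - layer k y (\<tau> i) is) \<le> 2 * C2 * M * scale h k"
      using norm_diff_triangle_le[OF 1 2] i by (simp add: layer_def mult_ac)
  qed (use C2 M0 in simp)
  also have "\<dots> \<le> sqrt Q * (sqrt (index_count TYPE('n) k) * (2 * C2 * M * (2 powr (\<beta> - real k) * norm (x - y) powr (\<beta> - real k))))"
  proof -
    have "scale h k \<le> (2 * norm (x - y)) powr (\<beta> - real k)"
      using h rad(1)[of h] top by (intro powr_mono2) (auto simp: dist_norm)
    also have "\<dots> = 2 powr (\<beta> - real k) * norm (x - y) powr (\<beta> - real k)" by (simp add: powr_mult)
    finally show ?thesis using C2 M0 by (intro mult_left_mono) auto
  qed
  finally show ?thesis by (simp add: mult_ac)
qed

text \<open>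
  First the scale is fixed, so small that jets are close to the derivatives of one polynomial at that
  scale; then the continuity of these derivatives decides.
\<close>

lemma continuity_estimate:
  assumes x: "x \<in> closure \<Omega>" and j: "j \<le> k" and e: "e > 0"
  shows "\<exists>d>0. \<forall>y\<in>closure \<Omega>. dist x y < d \<longrightarrow> Qdist (tensor_dist j) Q (D j x) (D j y) < e"
proof -
  define K where "K = sqrt Q * sqrt (index_count TYPE('n) j)"
  have K: "K \<ge> 0" by (simp add: K_def)
  define e' where "e' = e / (2 * (K + 1))"
  have e': "e' > 0" "K * (2 * e') < e"
  proof -
    show "e' > 0" using e K by (simp add: e'_def)
    have "K * (2 * e') = e * (K / (K + 1))" using K by (simp add: e'_def field_simps)
    also have "\<dots> < e * 1" using e K by (intro mult_strict_left_mono) auto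
    finally show "K * (2 * e') < e" by simp
  qed
  have M0p: "M0 > 0" using M0 by (simp add: admissible_def)
  have "(\<lambda>h. 2 * C2 * M0 * scale h j) \<longlonglongrightarrow> 0"
    by (rule rad_powr_tendsto_0) (use top j in linarith)
  then have "eventually (\<lambda>h. 2 * C2 * M0 * scale h j < e') sequentially"
    using e'(1) by (intro order_tendstoD(2)[of _ 0]) auto
  then obtain h where h: "2 * C2 * M0 * scale h j < e'" by (auto simp: eventually_sequentially)
  obtain p where p: "approx M0 x (rad h) p" using ex_approx[OF M0 x] .
  have "dist x x \<le> rad h" using rad(1)[of h] by simp
  then obtain \<sigma> where \<sigma>: "\<sigma> permutes {..<Q}" "\<And>i is. i < Q \<Longrightarrow> length is \<le> k \<Longrightarrow>
    norm (part is (p i) x - t x (\<sigma> i) is) \<le> C2 * M0 * scale h (length is)"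
    using layer_match[OF M0 x x _ p] by blast
  let ?I = "{..<Q} \<times> {is :: 'n list. length is = j}"
  have "eventually (\<lambda>y. \<forall>(i, is)\<in>?I. dist (part is (p i) y) (part is (p i) x) < e') (nhds x)"
  proof (rule eventually_ball_finite)
    show "finite ?I" by (simp add: finite_index_lists)
    show "\<forall>z\<in>?I. eventually (\<lambda>y. case z of (i, is) \<Rightarrow> dist (part is (p i) y) (part is (p i) x) < e') (nhds x)"
    proof
      fix z :: "nat \<times> 'n list" assume "z \<in> ?I"
      then obtain i "is" where z: "z = (i, is)" and "i < Q" by auto
      then have "poly_fun k (part is (p i))" using p poly_fun_part' by (auto simp: approx_def)
      then have "isCont (part is (p i)) x"
        using poly_fun_continuous[of k "part is (p i)" UNIV] by (simp add: continuous_on_eq_continuous_at)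
      then have "(part is (p i) \<longlongrightarrow> part is (p i) x) (nhds x)" by (simp add: isCont_def tendsto_at_iff_tendsto_nhds)
      then have "eventually (\<lambda>y. dist (part is (p i) y) (part is (p i) x) < e') (nhds x)"
        using e'(1) by (rule tendstoD)
      then show "eventually (\<lambda>y. case z of (i, is) \<Rightarrow> dist (part is (p i) y) (part is (p i) x) < e') (nhds x)"
        by (simp add: z)
    qed
  qed
  then obtain d where d: "d > 0" "\<And>y i is. dist y x < d \<Longrightarrow> i < Q \<Longrightarrow> length is = j \<Longrightarrow>
      dist (part is (p i) y) (part is (p i) x) < e'"
    by (fastforce simp: eventually_nhds_metric)
  have "Qdist (tensor_dist j) Q (D j x) (D j y) < e" if y: "y \<in> closure \<Omega>" "dist x y < min d (rad h)" for y
  proof -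
    obtain \<tau> where \<tau>: "\<tau> permutes {..<Q}" "\<And>i is. i < Q \<Longrightarrow> length is \<le> k \<Longrightarrow>
      norm (part is (p i) y - t y (\<tau> i) is) \<le> C2 * M0 * scale h (length is)"
      using layer_match[OF M0 x y(1) _ p] y(2) by auto
    have "Qdist (tensor_dist j) Q (D j x) (D j y) \<le> sqrt Q * (sqrt (index_count TYPE('n) j) * (2 * e'))"
      unfolding D_def
    proof (rule Qdist_tensor_le[OF \<sigma>(1) \<tau>(1)])
      fix i and "is" :: "'n list" assume i: "i < Q" "length is = j"
      have 1: "norm (t x (\<sigma> i) is - part is (p i) x) \<le> C2 * M0 * scale h j"
        using \<sigma>(2)[of i "is"] i j by (simp add: norm_minus_commute)
      have 2: "norm (part is (p i) x - part is (p i) y) \<le> e'"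
        using d(2)[of y i "is"] y(2) i by (simp add: dist_norm norm_minus_commute dist_commute)
      have 3: "norm (part is (p i) y - t y (\<tau> i) is) \<le> C2 * M0 * scale h j"
        using \<tau>(2)[of i "is"] i j by simp
      show "norm (layer j x (\<sigma> i) is - layer j y (\<tau> i) is) \<le> 2 * e'"
      proof -
        have "norm (t x (\<sigma> i) is - t y (\<tau> i) is) \<le> 2 * e'"
          using norm_diff_triangle_le[OF norm_diff_triangle_le[OF 1 2] 3] h by linarith
        then show ?thesis using i by (simp add: layer_def)
      qed
    qed (use e'(1) in simp)
    also have "\<dots> < e" using e'(2) by (simp add: K_def mult.assoc)
    finally show ?thesis .
  qed
  then show ?thesis using d(1) rad(1)[of h] by (intro exI[of _ "min d (rad h)"]) auto
qed

text \<open>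
  The polynomial varies with the scale, so Taylor's formula needs a bound on its derivatives that
  is uniform in the scale.
\<close>

lemma derivative_bound:
  assumes x: "x \<in> closure \<Omega>"
  obtains B where "\<And>h p i is. approx M0 x (rad h) p \<Longrightarrow> i < Q \<Longrightarrow> norm (part is (p i) x) \<le> B"
proof -
  have M0p: "M0 > 0" using M0 by (simp add: admissible_def)
  define I where "I = {..<Q} \<times> {is :: 'n list. length is \<le> k}"
  have fin: "finite I"
  proof -
    have "{is :: 'n list. length is \<le> k} = (\<Union>j\<le>k. {is. length is = j})" by auto
    then show ?thesis by (simp add: I_def finite_index_lists)
  qed
  define B1 where "B1 = (\<Sum>(i, is)\<in>I. norm (t x i is))"
  define B2 where "B2 = (\<Sum>j\<le>k. C2 * M0 * diameter \<Omega> powr (\<beta> - real j))"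
  have B: "B1 \<ge> 0" "B2 \<ge> 0" unfolding B1_def B2_def using C2 M0p by (auto intro!: sum_nonneg)
  have "norm (part is (p i) x) \<le> B1 + B2"
    if p: "approx M0 x (rad h) p" and i: "i < Q" for h p i "is"
  proof (cases "length is \<le> k")
    case True
    have "dist x x \<le> rad h" using rad(1)[of h] by simp
    then obtain \<sigma> where \<sigma>: "\<sigma> permutes {..<Q}" "\<And>i is. i < Q \<Longrightarrow> length is \<le> k \<Longrightarrow>
      norm (part is (p i) x - t x (\<sigma> i) is) \<le> C2 * M0 * scale h (length is)"
      using layer_match[OF M0 x x _ p] by blast
    have "(\<sigma> i, is) \<in> I" using permutes_in_image[OF \<sigma>(1), of i] i True by (simp add: I_def)
    then have 1: "norm (t x (\<sigma> i) is) \<le> B1"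
      unfolding B1_def using member_le_sum[of "(\<sigma> i, is)" I "\<lambda>(i, is). norm (t x i is)"] fin by auto
    have "C2 * M0 * scale h (length is) \<le> C2 * M0 * diameter \<Omega> powr (\<beta> - real (length is))"
      using C2 M0p rad(1,2)[of h] top True by (intro mult_left_mono powr_mono2) auto
    also have "\<dots> \<le> B2"
      unfolding B2_def using True C2 M0p
      by (intro member_le_sum[of "length is" "{..k}" "\<lambda>j. C2 * M0 * diameter \<Omega> powr (\<beta> - real j)"]) auto
    finally have 2: "norm (part is (p i) x - t x (\<sigma> i) is) \<le> B2" using \<sigma>(2)[OF i True] by linarith
    show ?thesis using norm_triangle_sub[of "part is (p i) x" "t x (\<sigma> i) is"] 1 2 by linarith
  next
    case False
    then have "part is (p i) x = 0" using part_eq_0[of k "p i" "is" x] p i by (simp add: approx_def)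
    then show ?thesis using B by simp
  qed
  then show ?thesis using that by blast
qed

text \<open>
  The jets at x and x + h are close to the derivatives of one polynomial there, taken at a scale
  comparable to the norm r of h, and Taylor's formula for that polynomial gives the linear
  part. The errors are of order \<open>r powr (\<beta> - j)\<close>, where \<open>\<beta> - j > 1\<close>, and \<open>r\<^sup>2\<close>.
\<close>

lemma derivative_estimate:
  assumes x: "x \<in> closure \<Omega>" and j: "j < k"
  obtains K where "\<And>h. h \<noteq> 0 \<Longrightarrow> norm h \<le> 1 \<Longrightarrow> norm h \<le> diameter \<Omega> \<Longrightarrow> x + h \<in> closure \<Omega> \<Longrightarrow>
    Qdist (tensor_dist j) Q (D j (x + h)) (tup Q (\<lambda>i. tensor_affine (layer j x i) (layer (Suc j) x i) h))
      \<le> K * (norm h powr (\<beta> - real j) + (norm h)\<^sup>2)"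
proof -
  have M0p: "M0 > 0" using M0 by (simp add: admissible_def)
  obtain B where B: "\<And>h p i is. approx M0 x (rad h) p \<Longrightarrow> i < Q \<Longrightarrow> norm (part is (p i) x) \<le> B"
    using derivative_bound[OF x] by blast
  define B' where "B' = (\<Sum>j\<le>k. index_count TYPE('n) (Suc (Suc j))) * \<bar>B\<bar>"
  define K1 where "K1 = C2 * M0 * (2 + real CARD('n)) * 2 powr (\<beta> - real j)"
  define K where "K = sqrt Q * (sqrt (index_count TYPE('n) j) * max K1 B')"
  have B'0: "B' \<ge> 0" unfolding B'_def by (intro mult_nonneg_nonneg sum_nonneg) auto
  have "Qdist (tensor_dist j) Q (D j (x + h)) (tup Q (\<lambda>i. tensor_affine (layer j x i) (layer (Suc j) x i) h))
      \<le> K * (norm h powr (\<beta> - real j) + (norm h)\<^sup>2)"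
    if h: "h \<noteq> 0" "norm h \<le> 1" "norm h \<le> diameter \<Omega>" "x + h \<in> closure \<Omega>" for h
  proof -
    obtain H where H: "norm h \<le> rad H" "rad H < 2 * norm h"
      using rad_sandwich[of "norm h"] h by auto
    obtain p where p: "approx M0 x (rad H) p" using ex_approx[OF M0 x] .
    have pp: "poly_fun k (p i)" if "i < Q" for i using p that by (simp add: approx_def)
    have "dist x x \<le> rad H" using rad(1)[of H] by simp
    then obtain \<sigma> where \<sigma>: "\<sigma> permutes {..<Q}" "\<And>i is. i < Q \<Longrightarrow> length is \<le> k \<Longrightarrow>
      norm (part is (p i) x - t x (\<sigma> i) is) \<le> C2 * M0 * scale H (length is)"
      using layer_match[OF M0 x x _ p] by blast
    have "dist x (x + h) \<le> rad H" using H by (simp add: dist_norm)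
    then obtain \<tau> where \<tau>: "\<tau> permutes {..<Q}" "\<And>i is. i < Q \<Longrightarrow> length is \<le> k \<Longrightarrow>
      norm (part is (p i) (x + h) - t (x + h) (\<tau> i) is) \<le> C2 * M0 * scale H (length is)"
      using layer_match[OF M0 x h(4) _ p] by blast
    have "Qdist (tensor_dist j) Q (D j (x + h)) (tup Q (\<lambda>i. tensor_affine (layer j x i) (layer (Suc j) x i) h))
      \<le> sqrt Q * (sqrt (index_count TYPE('n) j) * (K1 * norm h powr (\<beta> - real j) + B' * (norm h)\<^sup>2))"
      unfolding D_def
    proof (rule Qdist_tensor_le[OF \<tau>(1) \<sigma>(1)])
      fix i and "is" :: "'n list" assume i: "i < Q" "length is = j"
      let ?e = "C2 * M0 * scale H j"
      have 1: "norm (t (x + h) (\<tau> i) is - part is (p i) (x + h)) \<le> ?e"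
        using \<tau>(2)[of i "is"] i j by (simp add: norm_minus_commute)
      have "norm (part js (part is (p i)) x) \<le> \<bar>B\<bar>" for js
        using B[OF p i(1), of "js @ is"] by (simp add: part_append)
      then have 2: "norm (part is (p i) (x + h) - part is (p i) x
          - (\<Sum>a\<in>UNIV. (h $ a) *\<^sub>R part (a # is) (p i) x)) \<le> B' * (norm h)\<^sup>2"
        unfolding B'_def part.simps
        by (rule taylor_remainder_2[OF poly_fun_part'[OF pp[OF i(1)]] h(2)])
      have 3: "norm (part is (p i) x - t x (\<sigma> i) is) \<le> ?e"
        using \<sigma>(2)[of i "is"] i j by simp
      have 4: "norm ((\<Sum>a\<in>UNIV. (h $ a) *\<^sub>R part (a # is) (p i) x) - (\<Sum>a\<in>UNIV. (h $ a) *\<^sub>R t x (\<sigma> i) (a # is)))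
         \<le> real CARD('n) * ?e"
      proof -
        have "norm ((h $ a) *\<^sub>R (part (a # is) (p i) x - t x (\<sigma> i) (a # is))) \<le> ?e" for a
        proof -
          have "\<bar>h $ a\<bar> \<le> rad H" using component_le_norm_cart[of h a] H(1) by linarith
          moreover have "norm (part (a # is) (p i) x - t x (\<sigma> i) (a # is)) \<le> C2 * M0 * rad H powr (\<beta> - real (Suc j))"
            using \<sigma>(2)[of i "a # is"] i j by simp
          ultimately have "norm ((h $ a) *\<^sub>R (part (a # is) (p i) x - t x (\<sigma> i) (a # is)))
              \<le> rad H * (C2 * M0 * rad H powr (\<beta> - real (Suc j)))"
            unfolding norm_scaleR using rad(1)[of H] by (intro mult_mono) auto
          also have "\<dots> = ?e" using powr_mult_base[of "rad H" "\<beta> - real (Suc j)"] rad(1)[of H] by simp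
          finally show ?thesis .
        qed
        then have "(\<Sum>a\<in>UNIV. norm ((h $ a) *\<^sub>R (part (a # is) (p i) x - t x (\<sigma> i) (a # is)))) \<le> (\<Sum>a\<in>(UNIV::'n set). ?e)"
          by (intro sum_mono)
        then have "norm (\<Sum>a\<in>UNIV. (h $ a) *\<^sub>R (part (a # is) (p i) x - t x (\<sigma> i) (a # is))) \<le> (\<Sum>a\<in>(UNIV::'n set). ?e)"
          by (rule order_trans[OF norm_sum])
        then show ?thesis by (simp add: scaleR_diff_right sum_subtractf)
      qed
      have aff: "tensor_affine (layer j x (\<sigma> i)) (layer (Suc j) x (\<sigma> i)) h is
          = t x (\<sigma> i) is + (\<Sum>a\<in>UNIV. (h $ a) *\<^sub>R t x (\<sigma> i) (a # is))"
        using i by (simp add: tensor_affine_def layer_def)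
      have "t (x + h) (\<tau> i) is - (t x (\<sigma> i) is + (\<Sum>a\<in>UNIV. (h $ a) *\<^sub>R t x (\<sigma> i) (a # is)))
         = (t (x + h) (\<tau> i) is - part is (p i) (x + h))
          + (part is (p i) (x + h) - part is (p i) x - (\<Sum>a\<in>UNIV. (h $ a) *\<^sub>R part (a # is) (p i) x))
          + (part is (p i) x - t x (\<sigma> i) is)
          + ((\<Sum>a\<in>UNIV. (h $ a) *\<^sub>R part (a # is) (p i) x) - (\<Sum>a\<in>UNIV. (h $ a) *\<^sub>R t x (\<sigma> i) (a # is)))"
        by simp
      also have "norm \<dots> \<le> ?e + B' * (norm h)\<^sup>2 + ?e + real CARD('n) * ?e"
        using 1 2 3 4 by (intro norm_triangle_mono)
      also have "\<dots> = C2 * M0 * (2 + real CARD('n)) * scale H j + B' * (norm h)\<^sup>2"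
        by (simp add: algebra_simps)
      also have "\<dots> \<le> K1 * norm h powr (\<beta> - real j) + B' * (norm h)\<^sup>2"
      proof -
        have "scale H j \<le> (2 * norm h) powr (\<beta> - real j)"
          using H rad(1)[of H] top j by (intro powr_mono2) auto
        also have "\<dots> = 2 powr (\<beta> - real j) * norm h powr (\<beta> - real j)" by (simp add: powr_mult)
        finally have "C2 * M0 * (2 + real CARD('n)) * scale H j
            \<le> C2 * M0 * (2 + real CARD('n)) * (2 powr (\<beta> - real j) * norm h powr (\<beta> - real j))"
          using C2 M0p by (intro mult_left_mono) auto
        then show ?thesis by (simp add: K1_def mult.assoc)
      qed
      finally show "norm (layer j (x + h) (\<tau> i) is - tensor_affine (layer j x (\<sigma> i)) (layer (Suc j) x (\<sigma> i)) h is)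
          \<le> K1 * norm h powr (\<beta> - real j) + B' * (norm h)\<^sup>2"
        unfolding aff using i by (simp add: layer_def)
    qed (use C2 M0p B'0 in \<open>simp add: K1_def\<close>)
    also have "\<dots> \<le> sqrt Q * (sqrt (index_count TYPE('n) j) * (max K1 B' * norm h powr (\<beta> - real j) + max K1 B' * (norm h)\<^sup>2))"
      by (intro mult_left_mono add_mono mult_right_mono) auto
    finally show ?thesis by (simp add: K_def algebra_simps)
  qed
  then show ?thesis by (rule that)
qed

lemma has_derivative_D:
  assumes x: "x \<in> \<Omega>" and j: "j < k" and w: "\<And>y. y \<in> \<Omega> \<Longrightarrow> w y = D j y"
  shows "has_Qderiv Q j w x (D (Suc j) x)"
proof -
  let ?G = "\<lambda>h. Qdist (tensor_dist j) Q (w (x + h)) (tup Q (\<lambda>i. tensor_affine (layer j x i) (layer (Suc j) x i) h))"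
  obtain K where K: "\<And>h. h \<noteq> 0 \<Longrightarrow> norm h \<le> 1 \<Longrightarrow> norm h \<le> diameter \<Omega> \<Longrightarrow> x + h \<in> closure \<Omega> \<Longrightarrow>
    Qdist (tensor_dist j) Q (D j (x + h)) (tup Q (\<lambda>i. tensor_affine (layer j x i) (layer (Suc j) x i) h))
      \<le> K * (norm h powr (\<beta> - real j) + (norm h)\<^sup>2)"
    using derivative_estimate[OF in_closure[OF x] j] by blast
  interpret Mt: Metric_space "Qtuples Q (tensors j)" "Qdist (tensor_dist j) Q :: ('n, 'm) tensor multiset \<Rightarrow> _"
    by (rule Metric_space_Qtuples[OF Metric_space_tensors])
  obtain d where d: "d > 0" "ball x d \<subseteq> \<Omega>" using open_\<Omega> x by (meson open_contains_ball)
  have "((\<lambda>h. ?G h / norm h) \<longlongrightarrow> 0) (at 0)"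
  proof (rule Lim_null_comparison)
    have "eventually (\<lambda>h::real^'n. dist h 0 < min d (min 1 (diameter \<Omega>))) (at 0)"
      using d(1) diameter_pos
      by (auto simp: eventually_at intro!: exI[of _ "min d (min 1 (diameter \<Omega>))"])
    moreover have "eventually (\<lambda>h::real^'n. h \<noteq> 0) (at 0)" by (simp add: eventually_at_filter)
    ultimately show "eventually (\<lambda>h. norm (?G h / norm h) \<le> K * (norm h powr (\<beta> - real j - 1) + norm h)) (at 0)"
    proof eventually_elim
      case (elim h)
      then have xh: "x + h \<in> \<Omega>" using d(2) by (auto simp: dist_norm)
      have "?G h \<le> K * (norm h powr (\<beta> - real j) + (norm h)\<^sup>2)"
        using K[of h] elim xh in_closure[OF xh] w[OF xh] by simp
      then have "?G h / norm h \<le> K * (norm h powr (\<beta> - real j) + (norm h)\<^sup>2) / norm h"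
        by (intro divide_right_mono) auto
      also have "\<dots> = K * (norm h powr (\<beta> - real j - 1) + norm h)"
        using elim by (simp add: powr_diff power2_eq_square add_divide_distrib distrib_left)
      finally show ?case using Mt.nonneg by simp
    qed
    have "((\<lambda>h::real^'n. norm h powr (\<beta> - real j - 1)) \<longlongrightarrow> 0) (at 0)"
    proof (rule tendsto_zero_powrI)
      show "((\<lambda>h::real^'n. norm h) \<longlongrightarrow> 0) (at 0)" by (rule tendsto_norm_zero) (rule tendsto_ident_at)
      show "0 < \<beta> - real j - 1" using top j by linarith
    qed (auto simp: tendsto_const)
    then have "((\<lambda>h::real^'n. K * (norm h powr (\<beta> - real j - 1) + norm h)) \<longlongrightarrow> K * (0 + 0)) (at 0)"
      by (intro tendsto_intros tendsto_norm_zero)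
    then show "((\<lambda>h::real^'n. K * (norm h powr (\<beta> - real j - 1) + norm h)) \<longlongrightarrow> 0) (at 0)" by simp
  qed
  then show ?thesis unfolding has_Qderiv_def
    using w[OF x] layer_tensor by (intro exI[of _ "layer j x"] exI[of _ "layer (Suc j) x"]) (auto simp: D_def)
qed

lemma QD_v: "j \<le> k \<Longrightarrow> x \<in> \<Omega> \<Longrightarrow> QD Q j v x = D j x"
proof (induction j arbitrary: x)
  case 0
  have "(\<lambda>is. if is = [] then t x i [] else 0) = layer 0 x i" for i by (auto simp: layer_def)
  then show ?case by (simp add: v_def D_def sum_single_mset image_mset.compositionality comp_def)
next
  case (Suc j)
  have h: "has_Qderiv Q j (QD Q j v) x (D (Suc j) x)" using Suc by (intro has_derivative_D) auto
  have "V = D (Suc j) x" if "has_Qderiv Q j (QD Q j v) x V" for V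
    by (rule has_Qderiv_unique[OF that h open_\<Omega> Suc.prems(2)]) (use Suc D_in_Qtuples in auto)
  then have "(SOME V. has_Qderiv Q j (QD Q j v) x V) = D (Suc j) x" by (rule some_equality[where P = "\<lambda>V. has_Qderiv Q j (QD Q j v) x V", OF h])
  then show ?case by simp
qed

lemma continuous_map_D:
  assumes "j \<le> k"
  shows "continuous_map (top_of_set (closure \<Omega>)) (Qtopology (tensors j) (tensor_dist j) Q) (D j)"
proof -
  interpret Mt: Metric_space "Qtuples Q (tensors j)" "Qdist (tensor_dist j) Q :: ('n, 'm) tensor multiset \<Rightarrow> _"
    by (rule Metric_space_Qtuples[OF Metric_space_tensors])
  show ?thesis unfolding Mt.continuous_map_to_metric
  proof (intro ballI allI impI)
    fix x and e :: real assume "x \<in> topspace (top_of_set (closure \<Omega>))" and e: "e > 0"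
    then have x: "x \<in> closure \<Omega>" by simp
    obtain d where d: "d > 0" "\<forall>y\<in>closure \<Omega>. dist x y < d \<longrightarrow> Qdist (tensor_dist j) Q (D j x) (D j y) < e"
      using continuity_estimate[OF x assms e] by blast
    have "openin (top_of_set (closure \<Omega>)) (closure \<Omega> \<inter> ball x d)" by (simp add: openin_open_Int)
    then show "\<exists>U. openin (top_of_set (closure \<Omega>)) U \<and> x \<in> U \<and> (\<forall>y\<in>U. D j y \<in> Mt.mball (D j x) e)"
      using d x D_in_Qtuples by (intro exI[of _ "closure \<Omega> \<inter> ball x d"]) auto
  qed
qed

lemma v_Holder_space:
  assumes "Holder_seminorm Q \<Omega> k (\<beta> - real k) v < \<infinity>"
  shows "v \<in> Holder_space Q \<Omega> k (\<beta> - real k)"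
proof -
  have cont: "continuous_map (top_of_set \<Omega>) (Qtopology (tensors j) (tensor_dist j) Q) (QD Q j v)" if "j \<le> k" for j
  proof (rule continuous_map_eq)
    show "continuous_map (top_of_set \<Omega>) (Qtopology (tensors j) (tensor_dist j) Q) (D j)"
      using continuous_map_from_subtopology_mono[OF continuous_map_D[OF that] closure_subset] .
  qed (use QD_v that in auto)
  have "v \<in> C_space Q \<Omega> k"
    unfolding C_space_def
  proof (intro CollectI conjI allI impI ballI)
    show "v x \<in> Qtuples Q UNIV" for x unfolding v_def by (intro tup_in_Qtuples) simp
    show "\<exists>V. has_Qderiv Q j (QD Q j v) x V" if "j < k" "x \<in> \<Omega>" for j x
      using has_derivative_D[OF that(2,1)] QD_v[of j] that by (meson less_imp_le)
  qed (use cont in auto)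
  moreover have "\<exists>E. continuous_map (top_of_set (closure \<Omega>)) (Qtopology (tensors j) (tensor_dist j) Q) E \<and>
               (\<forall>x\<in>\<Omega>. E x = QD Q j v x)" if "j \<le> k" for j
    using continuous_map_D[OF that] QD_v[OF that] by (intro exI[of _ "D j"]) auto
  ultimately show ?thesis using assms by (auto simp: Holder_space_def)
qed

lemma v_Holder_seminorm:
  assumes M: "admissible M"
  shows "Holder_seminorm Q \<Omega> k (\<beta> - real k) v
    \<le> ennreal (sqrt Q * (sqrt (index_count TYPE('n) k) * (2 * C2 * 2 powr (\<beta> - real k))) * M)"
    (is "_ \<le> ennreal (?C3 * M)")
  unfolding Holder_seminorm_def
proof (rule SUP_least, clarify)
  fix x y assume xy: "x \<in> \<Omega>" "y \<in> \<Omega>" "x \<noteq> y"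
  have "Qdist (tensor_dist k) Q (D k x) (D k y) \<le> ?C3 * M * norm (x - y) powr (\<beta> - real k)"
    using holder_estimate[OF M in_closure in_closure] xy by blast
  then show "ennreal (Qdist (tensor_dist k) Q (QD Q k v x) (QD Q k v y) / norm (x - y) powr (\<beta> - real k)) \<le> ennreal (?C3 * M)"
    using xy by (intro ennreal_leI) (simp add: QD_v divide_le_eq)
qed

end

section \<open>Almost everywhere equality with the jet function\<close>

context campanato
begin

lemma lmeasurable_Int_ball: "\<Omega> \<inter> ball x \<rho> \<in> lmeasurable"
  using open_\<Omega> by (intro bounded_set_imp_lmeasurable) (auto simp: bounded_Int)

lemma \<Omega>_lmeasurable: "\<Omega> \<in> lmeasurable"
  using bounded_\<Omega> by (intro bounded_set_imp_lmeasurable) auto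

lemma measure_Int_ball_ge:
  "x \<in> closure \<Omega> \<Longrightarrow> 0 < \<rho> \<Longrightarrow> \<rho> \<le> diameter \<Omega> \<Longrightarrow> A * \<rho> ^ CARD('n) \<le> measure lebesgue (\<Omega> \<inter> ball x \<rho>)"
  using wd unfolding weighted_domain_def by auto

text \<open>
  The balls of half the radius about the points of a maximal separated set are disjoint, and each
  has its share of the measure of \<open>\<Omega>\<close>.
\<close>

lemma ball_cover:
  assumes \<rho>: "0 < \<rho>" "\<rho> \<le> diameter \<Omega>"
  obtains X where "finite X" "X \<subseteq> \<Omega>" "\<Omega> \<subseteq> (\<Union>x\<in>X. ball x \<rho>)"
    "real (card X) * (A * (\<rho>/2) ^ CARD('n)) \<le> measure lebesgue \<Omega>"
proof -
  define P where "P X \<longleftrightarrow> finite X \<and> X \<subseteq> \<Omega> \<and> (\<forall>x\<in>X. \<forall>y\<in>X. x \<noteq> y \<longrightarrow> \<rho> \<le> dist x y)" for X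
  define a where "a = A * (\<rho>/2) ^ CARD('n)"
  have a: "a > 0" using A \<rho> by (simp add: a_def)
  have fin: "emeasure lebesgue (\<Omega> \<inter> ball x r) \<noteq> top" for x r
    using lmeasurable_Int_ball[of x r] unfolding fmeasurable_def by auto
  have bound: "real (card X) * a \<le> measure lebesgue \<Omega>" if X: "P X" for X
  proof -
    have "disjoint_family_on (\<lambda>x. \<Omega> \<inter> ball x (\<rho>/2)) X"
      unfolding disjoint_family_on_def
    proof (intro ballI impI)
      fix x y assume xy: "x \<in> X" "y \<in> X" "x \<noteq> y"
      have False if "dist x z < \<rho>/2" "dist y z < \<rho>/2" for z
        using that X xy dist_triangle_half_l[of z x \<rho> y] unfolding P_def
        by (metis dist_commute dist_triangle_half_r not_le)
      then show "(\<Omega> \<inter> ball x (\<rho>/2)) \<inter> (\<Omega> \<inter> ball y (\<rho>/2)) = {}" by auto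
    qed
    then have "measure lebesgue (\<Union>x\<in>X. \<Omega> \<inter> ball x (\<rho>/2)) = (\<Sum>x\<in>X. measure lebesgue (\<Omega> \<inter> ball x (\<rho>/2)))"
      using X lmeasurable_Int_ball unfolding P_def
      by (intro measure_finite_Union) (auto simp: fin intro: fmeasurableD simp del: emeasure_completion)
    moreover have "(\<Sum>x\<in>X. a) \<le> (\<Sum>x\<in>X. measure lebesgue (\<Omega> \<inter> ball x (\<rho>/2)))"
      unfolding a_def using X \<rho> closure_subset[of \<Omega>] unfolding P_def
      by (intro sum_mono measure_Int_ball_ge) auto
    moreover have "measure lebesgue (\<Union>x\<in>X. \<Omega> \<inter> ball x (\<rho>/2)) \<le> measure lebesgue \<Omega>"
    proof (rule measure_mono_fmeasurable)
      have "open (\<Union>x\<in>X. \<Omega> \<inter> ball x (\<rho>/2))" using open_\<Omega> by (intro open_UN ballI open_Int open_ball)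
      then show "(\<Union>x\<in>X. \<Omega> \<inter> ball x (\<rho>/2)) \<in> sets lebesgue" by simp
    qed (use \<Omega>_lmeasurable in auto)
    ultimately show ?thesis by simp
  qed
  have "card X < Suc (nat \<lfloor>measure lebesgue \<Omega> / a\<rfloor>)" if "P X" for X
  proof -
    have "real (card X) \<le> measure lebesgue \<Omega> / a" using bound[OF that] a by (simp add: field_simps)
    then have "card X \<le> nat \<lfloor>measure lebesgue \<Omega> / a\<rfloor>" by (simp add: le_nat_floor)
    then show ?thesis by simp
  qed
  moreover have "P {}" by (simp add: P_def)
  ultimately obtain X where X: "P X" "\<And>Y. P Y \<Longrightarrow> card Y \<le> card X"
    using ex_has_greatest_nat[of P "{}" card "Suc (nat \<lfloor>measure lebesgue \<Omega> / a\<rfloor>)"] by blast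
  have "\<exists>x\<in>X. y \<in> ball x \<rho>" if y: "y \<in> \<Omega>" for y
  proof (rule ccontr)
    assume n: "\<not> ?thesis"
    then have "y \<notin> X" using \<rho> by auto
    moreover have "P (insert y X)" using X(1) y n unfolding P_def by (auto simp: not_less dist_commute)
    ultimately show False using X(2)[of "insert y X"] X(1) by (simp add: P_def)
  qed
  then show ?thesis using that[of X] X(1) bound[OF X(1)] unfolding P_def a_def by blast
qed

end

context campanato_jet_field
begin

text \<open>
  In a ball of radius \<open>\<rho>\<close> the set where u and v differ by more than e is a set of measure
  \<open>O(\<rho> powr lam)\<close>, since both are close to one Q-valued polynomial there. As the exponent exceeds the
  dimension, the sum over a cover of \<open>\<Omega>\<close> by \<open>O(\<rho> powr (- n))\<close> balls tends to 0.
\<close>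

lemma negligible_far:
  assumes e: "e > 0"
  shows "negligible {y \<in> \<Omega>. e < Qdist dist Q (u y) (v y)}" (is "negligible ?N")
  unfolding negligible_outer_le
proof (intro allI impI)
  fix \<epsilon> :: real assume \<epsilon>: "\<epsilon> > 0"
  interpret M: Metric_space "Qtuples Q UNIV" "Qdist dist Q :: (real^'m) multiset \<Rightarrow> _"
    by (rule Metric_space_Qtuples_UNIV)
  have M0p: "M0 > 0" using M0 by (simp add: admissible_def)
  define F where "F = measure lebesgue \<Omega> * 2 ^ CARD('n) / A * (M0 powr q / (e/2) powr q)"
  have "(\<lambda>h. sqrt Q * C2 * M0 * rad h powr \<beta>) \<longlonglongrightarrow> 0"
    by (rule rad_powr_tendsto_0) (rule \<beta>_pos)
  then have "eventually (\<lambda>h. sqrt Q * C2 * M0 * rad h powr \<beta> < e / 2) sequentially"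
    using e by (intro order_tendstoD(2)[of _ 0]) auto
  moreover have "(\<lambda>h. F * rad h powr (lam - real CARD('n))) \<longlonglongrightarrow> 0"
    by (rule rad_powr_tendsto_0) (use lam in simp)
  then have "eventually (\<lambda>h. F * rad h powr (lam - real CARD('n)) < \<epsilon>) sequentially"
    using \<epsilon> by (intro order_tendstoD(2)[of _ 0]) auto
  ultimately have "eventually (\<lambda>h. sqrt Q * C2 * M0 * rad h powr \<beta> < e / 2 \<and>
      F * rad h powr (lam - real CARD('n)) < \<epsilon>) sequentially" by (rule eventually_conj)
  then obtain h where h: "sqrt Q * C2 * M0 * rad h powr \<beta> < e / 2"
    "F * rad h powr (lam - real CARD('n)) < \<epsilon>" by (auto simp: eventually_sequentially)
  obtain X where X: "finite X" "X \<subseteq> \<Omega>" "\<Omega> \<subseteq> (\<Union>x\<in>X. ball x (rad h))"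
    "real (card X) * (A * (rad h/2) ^ CARD('n)) \<le> measure lebesgue \<Omega>"
    using ball_cover[OF rad(1,2)] .
  have "\<forall>x\<in>X. \<exists>p. approx M0 x (rad h) p" using ex_approx[OF M0] X(2) in_closure by (meson subsetD)
  then obtain p where p: "\<And>x. x \<in> X \<Longrightarrow> approx M0 x (rad h) (p x)" by metis
  define S where "S x = {y \<in> \<Omega>. e/2 < Qdist dist Q (u y) (tup Q (\<lambda>i. p x i y))} \<inter> ball x (rad h)" for x
  have S_leb: "S x \<in> lmeasurable" if "x \<in> X" for x
  proof (rule bounded_set_imp_lmeasurable)
    show "bounded (S x)" by (simp add: S_def bounded_Int)
    have "(\<lambda>y. Qdist dist Q (u y) (tup Q (\<lambda>i. p x i y))) \<in> borel_measurable (lebesgue_on \<Omega>)"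
      using p[OF that] by (intro Qdist_measurable[OF u]) (auto simp: approx_def intro: poly_fun_continuous)
    then have "{y \<in> space (lebesgue_on \<Omega>). e/2 < Qdist dist Q (u y) (tup Q (\<lambda>i. p x i y))} \<in> sets (lebesgue_on \<Omega>)"
      by measurable
    then have "{y \<in> \<Omega>. e/2 < Qdist dist Q (u y) (tup Q (\<lambda>i. p x i y))} \<in> sets lebesgue"
      by (simp add: sets_restrict_space_iff)
    then show "S x \<in> sets lebesgue" unfolding S_def by auto
  qed
  have S_measure: "measure lebesgue (S x) \<le> M0 powr q * rad h powr lam / (e/2) powr q" if x: "x \<in> X" for x
  proof -
    have "ennreal ((e/2) powr q * measure lebesgue (S x)) = (\<integral>\<^sup>+y. ennreal ((e/2) powr q) * indicator (S x) y \<partial>lebesgue)"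
      using S_leb[OF x] by (simp add: nn_integral_cmult_indicator emeasure_eq_measure2 fmeasurableD ennreal_mult del: emeasure_completion)
    also have "\<dots> \<le> excess (\<Omega> \<inter> ball x (rad h)) (p x)"
      unfolding deviation_def
    proof (rule nn_integral_mono)
      fix y
      show "ennreal ((e/2) powr q) * indicator (S x) y \<le> ennreal (Qdist dist Q (u y) (tup Q (\<lambda>i. p x i y)) powr q) *
          indicator (\<Omega> \<inter> ball x (rad h)) y"
      proof (cases "y \<in> S x")
        case True
        then have "(e/2) powr q \<le> Qdist dist Q (u y) (tup Q (\<lambda>i. p x i y)) powr q"
          using e q by (intro powr_mono2) (auto simp: S_def)
        then show ?thesis using True by (auto simp: S_def intro: ennreal_leI)
      qed simp
    qed
    also have "\<dots> \<le> ennreal (M0 powr q * rad h powr lam)" using p[OF x] by (simp add: approx_def)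
    finally have "(e/2) powr q * measure lebesgue (S x) \<le> M0 powr q * rad h powr lam"
      by (simp add: ennreal_le_iff)
    then show ?thesis using e by (simp add: field_simps)
  qed
  have "?N \<subseteq> (\<Union>x\<in>X. S x)"
  proof
    fix y assume y: "y \<in> ?N"
    then obtain x where x: "x \<in> X" "dist x y < rad h" using X(3) by auto
    have xy: "x \<in> closure \<Omega>" "y \<in> closure \<Omega>" using x X(2) y in_closure by auto
    obtain \<sigma> where \<sigma>: "\<sigma> permutes {..<Q}" "\<And>i is. i < Q \<Longrightarrow> length is \<le> k \<Longrightarrow>
      norm (part is (p x i) y - t y (\<sigma> i) is) \<le> C2 * M0 * scale h (length is)"
      using layer_match[OF M0 xy less_imp_le[OF x(2)] p[OF x(1)]] by blast
    have uy: "u y \<in> Qtuples Q UNIV" using measurable_space[OF u, of y] y by (simp add: space_Qborel)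
    have T: "tup Q (\<lambda>i. p x i y) \<in> Qtuples Q UNIV" "v y \<in> Qtuples Q UNIV"
      unfolding v_def by (auto intro: tup_in_Qtuples)
    have "Qdist dist Q (tup Q (\<lambda>i. p x i y)) (v y) \<le> sqrt Q * (C2 * M0 * rad h powr \<beta>)"
      unfolding v_def
    proof (rule Qdist_le_of_matching[OF \<sigma>(1)])
      show "\<bar>dist (p x i y) (t y (\<sigma> i) [])\<bar> \<le> C2 * M0 * rad h powr \<beta>" if "i < Q" for i
        using \<sigma>(2)[OF that, of "[]"] by (simp add: dist_norm)
    qed (use C2 M0p in simp)
    also have "\<dots> < e / 2" using h(1) by (simp add: mult.assoc)
    finally have "e/2 < Qdist dist Q (u y) (tup Q (\<lambda>i. p x i y))"
      using M.triangle[OF uy T] y by auto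
    then show "y \<in> (\<Union>x\<in>X. S x)" using x y by (auto simp: S_def)
  qed
  moreover have "(\<Union>x\<in>X. S x) \<in> lmeasurable" using X(1) S_leb by (intro fmeasurable.finite_UN) auto
  moreover have "measure lebesgue (\<Union>x\<in>X. S x) \<le> \<epsilon>"
  proof -
    have "measure lebesgue (\<Union>x\<in>X. S x) \<le> (\<Sum>x\<in>X. measure lebesgue (S x))"
      using X(1) S_leb by (intro measure_UNION_le) (auto intro: fmeasurableD)
    also have "\<dots> \<le> (\<Sum>x\<in>X. M0 powr q * rad h powr lam / (e/2) powr q)" by (intro sum_mono S_measure)
    also have "\<dots> = real (card X) * (M0 powr q * rad h powr lam / (e/2) powr q)" by simp
    also have "\<dots> \<le> (measure lebesgue \<Omega> / (A * (rad h/2) ^ CARD('n))) * (M0 powr q * rad h powr lam / (e/2) powr q)"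
      using X(4) A rad(1)[of h] by (intro mult_right_mono) (simp_all add: pos_le_divide_eq)
    also have "\<dots> = F * rad h powr (lam - real CARD('n))"
      using rad(1)[of h] A by (simp add: F_def powr_real_nat_diff[OF rad(1)] power_divide mult_ac)
    finally show ?thesis using h(2) by simp
  qed
  ultimately show "\<exists>T. ?N \<subseteq> T \<and> T \<in> lmeasurable \<and> measure lebesgue T \<le> \<epsilon>" by blast
qed

lemma v_eq_u: "AE x in lebesgue_on \<Omega>. v x = u x"
proof -
  interpret M: Metric_space "Qtuples Q UNIV" "Qdist dist Q :: (real^'m) multiset \<Rightarrow> _"
    by (rule Metric_space_Qtuples_UNIV)
  let ?N = "\<Union>m. {y \<in> \<Omega>. 1 / real (Suc m) < Qdist dist Q (u y) (v y)}"
  have "negligible ?N" by (intro negligible_countable_Union) (auto intro!: negligible_far)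
  then have "?N \<in> null_sets lebesgue" by (simp add: negligible_iff_null_sets)
  moreover have "v x = u x" if "x \<in> \<Omega>" "x \<notin> ?N" for x
  proof -
    have "Qdist dist Q (u x) (v x) \<le> 1 / real (Suc m)" for m using that by (auto simp: not_less)
    then have "Qdist dist Q (u x) (v x) \<le> 0"
      by (intro LIMSEQ_le_const[OF LIMSEQ_inverse_real_of_nat]) (auto simp: inverse_eq_divide)
    then have "Qdist dist Q (u x) (v x) = 0" using M.nonneg[of "u x" "v x"] by simp
    moreover have "u x \<in> Qtuples Q UNIV" using measurable_space[OF u, of x] that by (simp add: space_Qborel)
    moreover have "v x \<in> Qtuples Q UNIV" unfolding v_def by (intro tup_in_Qtuples) simp
    ultimately show ?thesis by simp
  qed
  ultimately have "AE x in lebesgue. x \<in> \<Omega> \<longrightarrow> v x = u x" by (intro AE_I'[of ?N]) auto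
  then show ?thesis by (simp add: AE_restrict_space_iff)
qed

end

section \<open>Lowering the degree of the approximating polynomials\<close>

lemma poly_fun_dir_prod: "poly_fun (length is) (\<lambda>y. dir_prod (y - x) is *\<^sub>R c)"
proof (induction "is")
  case Nil
  then show ?case by (simp add: poly_fun_const)
next
  case (Cons i "is")
  have "(\<lambda>y. dir_prod (y - x) (i # is) *\<^sub>R c)
     = (\<lambda>y. (y $ i) *\<^sub>R (dir_prod (y - x) is *\<^sub>R c) - (x $ i) *\<^sub>R (dir_prod (y - x) is *\<^sub>R c))"
    by (simp add: algebra_simps)
  then show ?case
    using poly_fun_diff[OF poly_fun_mult_coord[OF Cons, of i] poly_fun_mono[OF poly_fun_scaleR[OF Cons, of "x $ i"]]]
    by simp
qed

lemma taylor_truncation: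
  fixes f :: "real^'n::finite \<Rightarrow> real^'m::finite"
  assumes f: "poly_fun k f" and l: "l \<le> k" and \<rho>: "\<rho> \<ge> 0"
    and B: "\<And>is. l < length is \<Longrightarrow> length is \<le> k \<Longrightarrow> norm (part is f x) * \<rho> ^ length is \<le> B"
    and B0: "B \<ge> 0"
  obtains r where "poly_fun l r" "\<And>y. dist x y \<le> \<rho> \<Longrightarrow> norm (f y - r y) \<le> (\<Sum>j\<le>k. index_count TYPE('n) j) * B"
proof
  let ?g = "\<lambda>j y. (1 / fact j) *\<^sub>R (\<Sum>is | length is = j. dir_prod (y - x) is *\<^sub>R part is f x)"
  show "poly_fun l (\<lambda>y. \<Sum>j\<le>l. ?g j y)"
    by (intro poly_fun_sum poly_fun_scaleR) (use poly_fun_mono[OF poly_fun_dir_prod] in auto)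
  fix y assume y: "dist x y \<le> \<rho>"
  have "{..k} = {..l} \<union> {l<..k}" using l by auto
  then have "f y = (\<Sum>j\<le>l. ?g j y) + (\<Sum>j\<in>{l<..k}. ?g j y)"
    using poly_fun_taylor[OF f, of x "y - x"] by (simp add: sum.union_disjoint ivl_disj_int)
  then have "norm (f y - (\<Sum>j\<le>l. ?g j y)) = norm (\<Sum>j\<in>{l<..k}. ?g j y)" by simp
  also have "\<dots> \<le> (\<Sum>j\<in>{l<..k}. index_count TYPE('n) j * B)"
  proof (rule order_trans[OF norm_sum], rule sum_mono)
    fix j assume j: "j \<in> {l<..k}"
    have "norm (\<Sum>is | length is = j. dir_prod (y - x) is *\<^sub>R part is f x) \<le> (\<Sum>is :: 'n list | length is = j. B)"
    proof (rule order_trans[OF norm_sum], rule sum_mono)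
      fix js :: "'n list" assume "js \<in> {is. length is = j}"
      then have js: "length js = j" by simp
      have "norm (y - x) ^ j \<le> \<rho> ^ j" using y by (intro power_mono) (auto simp: dist_norm norm_minus_commute)
      then have "\<bar>dir_prod (y - x) js\<bar> \<le> \<rho> ^ j" using abs_dir_prod_le[of "y - x" js] js by simp
      then have "norm (dir_prod (y - x) js *\<^sub>R part js f x) \<le> \<rho> ^ j * norm (part js f x)"
        by (simp add: mult_right_mono)
      then show "norm (dir_prod (y - x) js *\<^sub>R part js f x) \<le> B" using B[of js] j js by (simp add: mult.commute)
    qed
    also have "\<dots> = index_count TYPE('n) j * B" by simp
    finally have 1: "norm (\<Sum>is | length is = j. dir_prod (y - x) is *\<^sub>R part is f x) \<le> index_count TYPE('n) j * B" .
    have "norm (?g j y) \<le> norm (\<Sum>is | length is = j. dir_prod (y - x) is *\<^sub>R part is f x)"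
      using mult_right_mono[of "1 / fact j" 1 "norm (\<Sum>is | length is = j. dir_prod (y - x) is *\<^sub>R part is f x)"]
        fact_ge_1[of j, where ?'a = real] by (simp add: divide_le_eq)
    then show "norm (?g j y) \<le> index_count TYPE('n) j * B" using 1 by linarith
  qed
  also have "\<dots> \<le> (\<Sum>j\<le>k. index_count TYPE('n) j * B)" using B0 by (intro sum_mono2) auto
  finally show "norm (f y - (\<Sum>j\<le>l. ?g j y)) \<le> (\<Sum>j\<le>k. index_count TYPE('n) j) * B"
    by (simp add: sum_distrib_right)
qed

lemma part_zero: "part is (\<lambda>x. 0) y = 0"
  using part_diff[of 0 "\<lambda>x. 0" "\<lambda>x. 0" "is" y] poly_fun_const by auto

context campanato
begin

text \<open>
  The first entry is the bound at the largest scale. The second one makes the induction over the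
  scales work: with \<open>s = 2 powr (l + 1 - \<beta>)\<close> it guarantees \<open>coeff_bound l + C \<le> s * coeff_bound l\<close>.
\<close>

definition coeff_bound :: "nat \<Rightarrow> real" where
  "coeff_bound l = max (C * max 1 (diameter \<Omega> powr (- lam / q))) (C / (2 powr (real l + 1 - \<beta>) - 1))"

text \<open>
  The derivatives of order above \<open>\<beta>\<close> may blow up as the scale shrinks, but no faster than the
  scaling suggests: from each scale to the next the permitted bound grows by a fixed factor, and this
  absorbs the change of the derivative. At the largest scale they are bounded by comparison
  with the zero polynomial, which is where the norm of u in \<open>L\<^sup>q\<close> enters.
\<close>

lemma high_derivative_bound:
  assumes l: "\<beta> < real l + 1" and N: "admissible N"
    and base: "excess \<Omega> (\<lambda>i x. 0) \<le> ennreal (N powr q)" and x: "x \<in> closure \<Omega>"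
  shows "approx N x (rad h) p \<Longrightarrow> i < Q \<Longrightarrow> l < length is \<Longrightarrow> length is \<le> k \<Longrightarrow>
    norm (part is (p i) x) \<le> coeff_bound l * N * scale h (length is)"
proof (induction h arbitrary: p i)
  case 0
  have N0: "N > 0" using N by (simp add: admissible_def)
  define e where "e = max 1 (diameter \<Omega> powr (- lam / q))"
  have e: "e \<ge> 1" "diameter \<Omega> powr (- lam / q) \<le> e" by (auto simp: e_def)
  have "N powr q = (N * diameter \<Omega> powr (- lam / q)) powr q * diameter \<Omega> powr lam"
    using N0 diameter_pos q by (simp add: powr_mult powr_powr powr_add[symmetric])
  also have "\<dots> \<le> (N * e) powr q * diameter \<Omega> powr lam"
    using N0 e diameter_pos q by (intro mult_right_mono powr_mono2 mult_left_mono) auto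
  finally have "excess \<Omega> (\<lambda>i x. 0) \<le> ennreal ((N * e) powr q * diameter \<Omega> powr lam)"
    using base by (meson ennreal_leI order_trans)
  then have "excess (\<Omega> \<inter> ball x (rad 0)) (\<lambda>i x. 0) \<le> ennreal ((N * e) powr q * rad 0 powr lam)"
    using excess_mono[of "\<Omega> \<inter> ball x (rad 0)" \<Omega> "\<lambda>i x. 0"] unfolding rad(3) by (meson Int_lower1 order_trans)
  then have z: "approx (N * e) x (rad 0) (\<lambda>i x. 0)" by (simp add: approx_def poly_fun_const)
  have p: "approx (N * e) x (rad 0) p"
    using approx_mono[OF 0(1), of "N * e"] N0 e(1) by simp
  have "dist x x \<le> rad 0" "N * e > 0" using rad(1)[of 0] N0 e by auto
  then obtain \<sigma> where \<sigma>: "\<sigma> permutes {..<Q}" "\<And>i is w. i < Q \<Longrightarrow> length is \<le> k \<Longrightarrow> w \<in> {x, x} \<Longrightarrow>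
       norm (part is (p i) w - part is (\<lambda>x. 0) w) \<le> C * (N * e) * rad 0 powr (\<beta> - real (length is))"
    by (rule approx_match[OF x x _ rad(1,2) _ p z]) blast
  have "norm (part is (p i) x) \<le> C * e * N * rad 0 powr (\<beta> - real (length is))"
    using \<sigma>(2)[OF 0(2,4), of x] by (simp add: part_zero mult_ac)
  also have "\<dots> \<le> coeff_bound l * N * rad 0 powr (\<beta> - real (length is))"
    using N0 unfolding coeff_bound_def e_def by (intro mult_right_mono) auto
  finally show ?case .
next
  case (Suc h)
  have N0: "N > 0" using N by (simp add: admissible_def)
  obtain r where r: "approx N x (rad h) r" using N x rad(1,2)[of h] unfolding admissible_def by blast
  obtain \<sigma> where \<sigma>: "\<sigma> permutes {..<Q}" "\<And>i is. i < Q \<Longrightarrow> length is \<le> k \<Longrightarrow>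
       norm (part is (r i) x - part is (p (\<sigma> i)) x) \<le> C * N * scale h (length is)"
    using approx_match_scale[OF x rad(1,2) N0 r, of p] Suc.prems(1) unfolding rad(4) by blast
  let ?g = "\<beta> - real (length is)" and ?K = "coeff_bound l"
  define i' where "i' = inv \<sigma> i"
  have i': "i' < Q" "\<sigma> i' = i"
    using permutes_in_image[OF permutes_inv[OF \<sigma>(1)], of i] Suc.prems(2) permutes_inverses[OF \<sigma>(1)]
    by (auto simp: i'_def)
  have "norm (part is (p i) x) \<le> norm (part is (r i') x) + C * N * rad h powr ?g"
    using \<sigma>(2)[OF i'(1) Suc.prems(4)] norm_triangle_sub[of "part is (p i) x" "part is (r i') x"]
    by (simp add: i' norm_minus_commute)
  also have "\<dots> \<le> ?K * N * rad h powr ?g + C * N * rad h powr ?g"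
    using Suc.IH[OF r i'(1) Suc.prems(3,4)] by simp
  also have "\<dots> = (?K + C) * (N * rad h powr ?g)" by (simp add: algebra_simps)
  also have "\<dots> \<le> (?K * 2 powr (- ?g)) * (N * rad h powr ?g)"
  proof (rule mult_right_mono)
    define s where "s = (2::real) powr (real l + 1 - \<beta>)"
    have s: "s > 1" using powr_less_mono[of 0 "real l + 1 - \<beta>" "2::real"] l by (simp add: s_def)
    have K: "C / (s - 1) \<le> ?K" by (simp add: coeff_bound_def s_def)
    moreover have "0 \<le> C / (s - 1)" using C s by simp
    ultimately have K': "0 \<le> ?K" by linarith
    have "s \<le> 2 powr (- ?g)" unfolding s_def using Suc.prems(3) by (intro powr_mono) auto
    then have "?K * s \<le> ?K * 2 powr (- ?g)" using K' by (intro mult_left_mono)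
    moreover have "C \<le> ?K * (s - 1)" using K s by (simp add: divide_le_eq)
    ultimately show "?K + C \<le> ?K * 2 powr (- ?g)" by (simp add: algebra_simps)
    show "0 \<le> N * rad h powr ?g" using N0 by simp
  qed
  also have "\<dots> = ?K * N * rad (Suc h) powr ?g"
  proof -
    have "(rad h / 2) powr ?g = rad h powr ?g / 2 powr ?g" using rad(1)[of h] by (simp add: powr_divide)
    then have "rad (Suc h) powr ?g = rad h powr ?g * 2 powr (- ?g)"
      by (simp only: rad(4) powr_minus divide_inverse)
    then show ?thesis by (simp only: mult_ac)
  qed
  finally show ?case .
qed

definition lower_const :: "nat \<Rightarrow> real" where
  "lower_const l = 2 * 2 powr (lam / q) * (1 + (sqrt Q * ((\<Sum>j\<le>k. real CARD('n) ^ j) * coeff_bound l)) powr q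
     * measure lborel (ball (0 :: real^'n) 1)) powr (1 / q)"

text \<open>
  The Taylor polynomials of degree l of the sheets, with centre x, still approximate u: by the previous
  bound each omitted term is \<open>O(\<rho> powr \<beta>)\<close>.
\<close>

lemma lower_degree:
  assumes l: "l \<le> k" "\<beta> < real l + 1" and N: "admissible N"
    and base: "excess \<Omega> (\<lambda>i x. 0) \<le> ennreal (N powr q)"
    and x: "x \<in> closure \<Omega>" and \<rho>: "0 < \<rho>" "\<rho> \<le> diameter \<Omega>"
  shows "\<exists>p. (\<forall>i<Q. poly_fun l (p i)) \<and>
    excess (\<Omega> \<inter> ball x \<rho>) p \<le> ennreal ((lower_const l * N) powr q * \<rho> powr lam)"
proof -
  interpret M: Metric_space "Qtuples Q UNIV" "Qdist dist Q :: (real^'m) multiset \<Rightarrow> _"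
    by (rule Metric_space_Qtuples_UNIV)
  have N0: "N > 0" using N by (simp add: admissible_def)
  have cnt: "index_count TYPE('n) j = real CARD('n) ^ j" for j
    using card_lists_length_eq[of "UNIV :: 'n set" j] by simp
  have K0: "coeff_bound l > 0" using C by (simp add: coeff_bound_def less_max_iff_disj)
  define c where "c = (\<Sum>j\<le>k. real CARD('n) ^ j) * coeff_bound l"
  have c0: "c \<ge> 0" unfolding c_def using K0 by (intro mult_nonneg_nonneg sum_nonneg) auto
  define \<omega> where "\<omega> = measure lborel (ball (0 :: real^'n) 1)"
  have \<omega>: "\<omega> \<ge> 0" by (simp add: \<omega>_def)
  obtain h where h: "\<rho> \<le> rad h" "rad h < 2 * \<rho>" using rad_sandwich[OF \<rho>] .
  define R where "R = rad h"
  have R: "R > 0" "\<rho> \<le> R" "R < 2 * \<rho>" using rad(1) h by (auto simp: R_def)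
  obtain P where P: "approx N x R P" using N x rad(1,2)[of h] unfolding admissible_def R_def by blast
  have "\<exists>r. poly_fun l r \<and> (\<forall>y. dist x y \<le> R \<longrightarrow> norm (P i y - r y) \<le> c * N * R powr \<beta>)" if i: "i < Q" for i
  proof -
    have Pi: "poly_fun k (P i)" using P i by (simp add: approx_def)
    have b: "norm (part is (P i) x) * R ^ length is \<le> coeff_bound l * N * R powr \<beta>"
      if "l < length is" "length is \<le> k" for "is"
    proof -
      have "norm (part is (P i) x) * R ^ length is \<le> coeff_bound l * N * R powr (\<beta> - real (length is)) * R ^ length is"
        using high_derivative_bound[OF l(2) N base x P[unfolded R_def] i that] R(1)
        by (intro mult_right_mono) (auto simp: R_def)
      also have "\<dots> = coeff_bound l * N * R powr \<beta>" using R(1) by (simp add: powr_real_nat_diff)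
      finally show ?thesis .
    qed
    have "0 \<le> coeff_bound l * N * R powr \<beta>" using K0 N0 by simp
    then obtain r where "poly_fun l r" "\<And>y. dist x y \<le> R \<Longrightarrow>
        norm (P i y - r y) \<le> (\<Sum>j\<le>k. index_count TYPE('n) j) * (coeff_bound l * N * R powr \<beta>)"
      using taylor_truncation[OF Pi l(1) less_imp_le[OF R(1)], of x] b by blast
    then show ?thesis by (intro exI[of _ r]) (simp add: c_def cnt mult.assoc)
  qed
  then obtain r where r: "\<And>i. i < Q \<Longrightarrow> poly_fun l (r i)"
    "\<And>i y. i < Q \<Longrightarrow> dist x y \<le> R \<Longrightarrow> norm (P i y - r i y) \<le> c * N * R powr \<beta>" by metis
  let ?E = "\<Omega> \<inter> ball x \<rho>"
  define b where "b = sqrt Q * c * N * R powr \<beta>"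
  have b0: "b \<ge> 0" using c0 N0 by (simp add: b_def)
  have pw: "Qdist dist Q (u y) (tup Q (\<lambda>i. r i y)) powr q
     \<le> 2 powr q * (Qdist dist Q (u y) (tup Q (\<lambda>i. P i y)) powr q + b powr q)" if y: "y \<in> ?E" for y
  proof -
    have uy: "u y \<in> Qtuples Q UNIV" using measurable_space[OF u, of y] y by (simp add: space_Qborel)
    have T: "tup Q (\<lambda>i. P i y) \<in> Qtuples Q UNIV" "tup Q (\<lambda>i. r i y) \<in> Qtuples Q UNIV"
      by (auto intro: tup_in_Qtuples)
    let ?a = "Qdist dist Q (u y) (tup Q (\<lambda>i. P i y))"
    have "Qdist dist Q (tup Q (\<lambda>i. P i y)) (tup Q (\<lambda>i. r i y)) \<le> sqrt Q * (c * N * R powr \<beta>)"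
      by (rule Qdist_le_of_matching[OF permutes_id])
        (use r(2)[of _ y] y R(2) c0 N0 in \<open>auto simp: dist_norm\<close>)
    then have "Qdist dist Q (u y) (tup Q (\<lambda>i. r i y)) \<le> ?a + b"
      using M.triangle[OF uy T] by (simp add: b_def mult.assoc)
    also have "\<dots> \<le> 2 * max ?a b" by linarith
    finally have "Qdist dist Q (u y) (tup Q (\<lambda>i. r i y)) powr q \<le> (2 * max ?a b) powr q"
      using q by (intro powr_mono2) auto
    also have "\<dots> = 2 powr q * (max ?a b) powr q" using b0 by (simp add: powr_mult)
    also have "(max ?a b) powr q \<le> ?a powr q + b powr q" by (simp add: max_def)
    finally show ?thesis by simp
  qed
  have "excess ?E r \<le> (\<integral>\<^sup>+y. ennreal (2 powr q) * (ennreal (Qdist dist Q (u y) (tup Q (\<lambda>i. P i y)) powr q) * indicator ?E y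
      + ennreal (b powr q) * indicator ?E y) \<partial>lebesgue)"
    unfolding deviation_def
  proof (rule nn_integral_mono)
    fix y
    show "ennreal (Qdist dist Q (u y) (tup Q (\<lambda>i. r i y)) powr q) * indicator ?E y
      \<le> ennreal (2 powr q) * (ennreal (Qdist dist Q (u y) (tup Q (\<lambda>i. P i y)) powr q) * indicator ?E y
      + ennreal (b powr q) * indicator ?E y)"
    proof (cases "y \<in> ?E")
      case True
      then show ?thesis using ennreal_leI[OF pw[OF True]]
        by (simp add: ennreal_mult ennreal_plus[symmetric] del: ennreal_plus)
    qed simp
  qed
  also have "\<dots> = ennreal (2 powr q) * (excess ?E P + ennreal (b powr q) * emeasure lebesgue ?E)"
  proof -
    have E: "?E \<in> sets lebesgue" using lmeasurable_Int_ball by (rule fmeasurableD)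
    have m: "(\<lambda>y. ennreal (Qdist dist Q (u y) (tup Q (\<lambda>i. P i y)) powr q) * indicator ?E y) \<in> borel_measurable lebesgue"
      using P E by (intro Qdist_powr_measurable[OF u]) (auto simp: approx_def intro: poly_fun_continuous)
    have m2: "(\<lambda>y. ennreal (b powr q) * indicator ?E y) \<in> borel_measurable lebesgue" using E by measurable
    show ?thesis
      unfolding deviation_def using m m2 E
      by (simp add: nn_integral_cmult nn_integral_add nn_integral_cmult_indicator del: emeasure_completion)
  qed
  also have "\<dots> \<le> ennreal (2 powr q) * (ennreal (N powr q * R powr lam) + ennreal (b powr q) * ennreal (R ^ CARD('n) * \<omega>))"
  proof (intro mult_left_mono add_mono)
    have "excess ?E P \<le> excess (\<Omega> \<inter> ball x R) P"
      using R by (intro excess_mono Int_mono order_refl subset_ball) auto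
    then show "excess ?E P \<le> ennreal (N powr q * R powr lam)"
      using P unfolding approx_def by (meson order_trans)
    have "emeasure lebesgue ?E \<le> emeasure lebesgue (ball x R)"
      using R by (intro emeasure_mono) auto
    also have "\<dots> = ennreal (measure lborel (ball x R))"
      using lmeasurable_ball[of x R] by (simp add: emeasure_eq_measure2)
    also have "\<dots> = ennreal (R ^ CARD('n) * \<omega>)"
      using content_ball_conv_unit_ball[of R x] R by (simp add: \<omega>_def)
    finally show "emeasure lebesgue ?E \<le> ennreal (R ^ CARD('n) * \<omega>)" .
  qed auto
  also have "\<dots> = ennreal (2 powr q * (N powr q * R powr lam + b powr q * (R ^ CARD('n) * \<omega>)))"
    using R(1) \<omega> by (simp add: ennreal_mult[symmetric] ennreal_plus[symmetric] del: ennreal_plus)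
  also have "\<dots> \<le> ennreal ((lower_const l * N) powr q * \<rho> powr lam)"
  proof (rule ennreal_leI)
    have "(R powr \<beta>) powr q * R ^ CARD('n) = R powr lam"
      using R(1) q by (simp add: powr_powr \<beta> powr_realpow[symmetric] powr_add[symmetric])
    then have "b powr q * (R ^ CARD('n) * \<omega>) = (sqrt Q * c) powr q * \<omega> * (N powr q * R powr lam)"
      using c0 N0 R(1) by (simp add: b_def powr_mult mult_ac)
    then have "2 powr q * (N powr q * R powr lam + b powr q * (R ^ CARD('n) * \<omega>))
        = 2 powr q * N powr q * (1 + (sqrt Q * c) powr q * \<omega>) * R powr lam"
      by (simp add: algebra_simps)
    also have "\<dots> \<le> 2 powr q * N powr q * (1 + (sqrt Q * c) powr q * \<omega>) * (2 powr lam * \<rho> powr lam)"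
    proof (rule mult_left_mono)
      have "R powr lam \<le> (2 * \<rho>) powr lam" using R lam by (intro powr_mono2) auto
      then show "R powr lam \<le> 2 powr lam * \<rho> powr lam" using \<rho> by (simp add: powr_mult)
    qed (use \<omega> in simp)
    also have "\<dots> = (lower_const l * N) powr q * \<rho> powr lam"
      using q N0 \<omega> by (simp add: lower_const_def c_def[symmetric] \<omega>_def[symmetric] powr_mult powr_powr add_nonneg_nonneg)
    finally show "2 powr q * (N powr q * R powr lam + b powr q * (R ^ CARD('n) * \<omega>))
       \<le> (lower_const l * N) powr q * \<rho> powr lam" .
  qed
  finally show ?thesis using r(1) by blast
qed

end

section \<open>Norms and the isomorphism\<close>

lemma ennpowr_ennreal: "0 \<le> x \<Longrightarrow> ennpowr (ennreal x) p = ennreal (x powr p)"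
  by (simp add: ennpowr_def)

lemma ennpowr_mono:
  assumes "x \<le> y" "0 \<le> p"
  shows "ennpowr x p \<le> ennpowr y p"
proof (cases "y = \<infinity>")
  case True
  then show ?thesis by (simp add: ennpowr_def)
next
  case False
  then obtain b where b: "y = ennreal b" "b \<ge> 0" by (cases y rule: ennreal_cases) auto
  then obtain a where a: "x = ennreal a" "a \<ge> 0"
    using assms(1) by (cases x rule: ennreal_cases) (auto simp: top_unique)
  have "a \<le> b" using assms(1) a b by (simp add: ennreal_le_iff)
  then show ?thesis using a b assms(2) by (simp add: ennpowr_ennreal ennreal_leI powr_mono2)
qed

lemma powr_powr_inverse: "0 \<le> x \<Longrightarrow> q > 0 \<Longrightarrow> (x powr q) powr (1 / q) = (x :: real)"
  by (simp add: powr_powr)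

text \<open>Estimates with every number above a norm pass to the norm itself.\<close>

lemma ennreal_le_of_gt:
  assumes K: "K \<ge> 0" and n: "n \<ge> 0" and le: "\<And>N::real. n < N \<Longrightarrow> x \<le> ennreal (K * N)"
  shows "x \<le> ennreal (K * n)"
proof (rule ennreal_le_epsilon)
  fix e :: real assume e: "e > 0"
  have "K * (n + e / (K + 1)) \<le> K * n + e"
    using K e by (simp add: distrib_left divide_le_eq)
  then have "x \<le> ennreal (K * n + e)"
    using le[of "n + e / (K + 1)"] K e by (meson ennreal_leI less_add_same_cancel1 order_trans divide_pos_pos add_nonneg_pos zero_less_one)
  then show "x \<le> ennreal (K * n) + ennreal e" using K n e by simp
qed

lemma Qpolys_mono: "l \<le> k \<Longrightarrow> Qpolys Q l \<subseteq> Qpolys Q k"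
  unfolding Qpolys_def using poly_fun_mono by blast

lemma campanato_seminorm_mono:
  assumes "l \<le> k" "q > 0"
  shows "campanato_seminorm Q \<Omega> k q lam u \<le> campanato_seminorm Q \<Omega> l q lam u"
  unfolding campanato_seminorm_def
  by (intro SUP_mono' ennpowr_mono mult_left_mono INF_superset_mono Qpolys_mono assms) (use assms in auto)

context campanato
begin

lemma admissible_of_seminorm:
  assumes M: "campanato_seminorm Q \<Omega> k q lam u < ennreal M"
  shows "admissible M"
  unfolding admissible_def
proof (intro conjI ballI allI impI)
  show M0: "M > 0" using M by (metis ennreal_neg not_le not_less_zero)
  fix x \<rho> assume x: "x \<in> closure \<Omega>" and \<rho>: "0 < \<rho> \<and> \<rho> \<le> diameter \<Omega>"
  let ?I = "INF P\<in>Qpolys Q k. \<integral>\<^sup>+y\<in>\<Omega> \<inter> ball x \<rho>. ennreal (Qdist dist Q (u y) (P y) powr q) \<partial>lebesgue"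
  have "ennpowr (ennreal (\<rho> powr (- lam)) * ?I) (1/q) \<le> campanato_seminorm Q \<Omega> k q lam u"
    unfolding campanato_seminorm_def by (rule SUP_upper2[OF x], rule SUP_upper2[of \<rho>]) (use \<rho> in auto)
  then have less: "ennpowr (ennreal (\<rho> powr (- lam)) * ?I) (1/q) < ennreal M" using M by (rule le_less_trans)
  have "?I < ennreal (M powr q * \<rho> powr lam)"
  proof (rule ccontr)
    assume "\<not> ?thesis"
    then have "ennreal (\<rho> powr (- lam)) * ennreal (M powr q * \<rho> powr lam) \<le> ennreal (\<rho> powr (- lam)) * ?I"
      by (intro mult_left_mono) auto
    moreover have "ennreal (\<rho> powr (- lam)) * ennreal (M powr q * \<rho> powr lam) = ennreal (M powr q)"
      using \<rho> by (simp add: ennreal_mult[symmetric] powr_minus)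
    ultimately have "ennpowr (ennreal (M powr q)) (1/q) \<le> ennpowr (ennreal (\<rho> powr (- lam)) * ?I) (1/q)"
      using q by (intro ennpowr_mono) auto
    moreover have "ennpowr (ennreal (M powr q)) (1/q) = ennreal M"
      using M0 q by (simp add: ennpowr_ennreal powr_powr_inverse)
    ultimately show False using less by simp
  qed
  then obtain P where P: "P \<in> Qpolys Q k"
    "(\<integral>\<^sup>+y\<in>\<Omega> \<inter> ball x \<rho>. ennreal (Qdist dist Q (u y) (P y) powr q) \<partial>lebesgue) < ennreal (M powr q * \<rho> powr lam)"
    by (auto simp: INF_less_iff)
  then obtain p where "P = (\<lambda>y. tup Q (\<lambda>i. p i y))" "\<forall>i<Q. poly_fun k (p i)" unfolding Qpolys_def by blast
  then have "approx M x \<rho> p" using P(2) by (simp add: approx_def deviation_def less_imp_le)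
  then show "\<exists>p. approx M x \<rho> p" by blast
qed

lemma seminorm_le:
  assumes M: "M \<ge> 0"
    and p: "\<And>x \<rho>. x \<in> closure \<Omega> \<Longrightarrow> 0 < \<rho> \<Longrightarrow> \<rho> \<le> diameter \<Omega> \<Longrightarrow>
      \<exists>p. (\<forall>i<Q. poly_fun l (p i)) \<and> excess (\<Omega> \<inter> ball x \<rho>) p \<le> ennreal (M powr q * \<rho> powr lam)"
  shows "campanato_seminorm Q \<Omega> l q lam u \<le> ennreal M"
  unfolding campanato_seminorm_def
proof (intro SUP_least)
  fix x \<rho> assume x: "x \<in> closure \<Omega>" and "\<rho> \<in> {0<..diameter \<Omega>}"
  then have \<rho>: "0 < \<rho>" "\<rho> \<le> diameter \<Omega>" by auto
  let ?I = "INF P\<in>Qpolys Q l. \<integral>\<^sup>+y\<in>\<Omega> \<inter> ball x \<rho>. ennreal (Qdist dist Q (u y) (P y) powr q) \<partial>lebesgue"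
  obtain p where p: "\<forall>i<Q. poly_fun l (p i)" "excess (\<Omega> \<inter> ball x \<rho>) p \<le> ennreal (M powr q * \<rho> powr lam)"
    using assms(2)[OF x \<rho>] by blast
  have "(\<lambda>y. tup Q (\<lambda>i. p i y)) \<in> Qpolys Q l" unfolding Qpolys_def using p(1) by blast
  then have "?I \<le> excess (\<Omega> \<inter> ball x \<rho>) p" unfolding deviation_def by (rule INF_lower2) simp
  then have "?I \<le> ennreal (M powr q * \<rho> powr lam)" using p(2) by (rule order_trans)
  then have "ennreal (\<rho> powr (- lam)) * ?I \<le> ennreal (\<rho> powr (- lam)) * ennreal (M powr q * \<rho> powr lam)"
    by (intro mult_left_mono) auto
  also have "\<dots> = ennreal (M powr q)" using \<rho> by (simp add: ennreal_mult[symmetric] powr_minus)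
  finally have "ennpowr (ennreal (\<rho> powr (- lam)) * ?I) (1/q) \<le> ennpowr (ennreal (M powr q)) (1/q)"
    using q by (intro ennpowr_mono) auto
  also have "\<dots> = ennreal M" using M q by (simp add: ennpowr_ennreal powr_powr_inverse)
  finally show "ennpowr (ennreal (\<rho> powr (- lam)) * ?I) (1/q) \<le> ennreal M" .
qed

lemma excess_zero_le:
  assumes N: "Lq_norm Q \<Omega> q u < ennreal N"
  shows "excess \<Omega> (\<lambda>i x. 0) \<le> ennreal (N powr q)"
proof (rule ccontr)
  assume "\<not> ?thesis"
  then have "ennpowr (ennreal (N powr q)) (1/q) \<le> ennpowr (excess \<Omega> (\<lambda>i x. 0)) (1/q)"
    using q by (intro ennpowr_mono) auto
  moreover have "ennpowr (excess \<Omega> (\<lambda>i x. 0)) (1/q) = Lq_norm Q \<Omega> q u"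
    by (simp add: Lq_norm_def deviation_def Qabs_def)
  moreover have "N > 0" using N by (metis ennreal_neg not_le not_less_zero)
  then have "ennpowr (ennreal (N powr q)) (1/q) = ennreal N"
    using q by (simp add: ennpowr_ennreal powr_powr_inverse)
  ultimately show False using N by simp
qed

lemma lower_const_pos: "lower_const l > 0"
proof -
  have "0 < 1 + (sqrt Q * ((\<Sum>j\<le>k. real CARD('n) ^ j) * coeff_bound l)) powr q
     * measure lborel (ball (0 :: real^'n) 1)"
    by (intro add_pos_nonneg mult_nonneg_nonneg) auto
  then show ?thesis unfolding lower_const_def by (intro mult_pos_pos) simp_all
qed

lemma lower_seminorm:
  assumes l: "l \<le> k" "\<beta> < real l + 1" and n: "n \<ge> 0"
    and u: "Lq_norm Q \<Omega> q u \<le> ennreal n" "campanato_seminorm Q \<Omega> k q lam u \<le> ennreal n"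
  shows "campanato_seminorm Q \<Omega> l q lam u \<le> ennreal (lower_const l * n)"
proof (rule ennreal_le_of_gt[OF less_imp_le[OF lower_const_pos] n])
  fix N assume N: "n < N"
  then have "ennreal n < ennreal N" using n by (simp add: ennreal_less_iff)
  then have "admissible N" "excess \<Omega> (\<lambda>i x. 0) \<le> ennreal (N powr q)"
    using u by (auto intro: admissible_of_seminorm excess_zero_le le_less_trans)
  then show "campanato_seminorm Q \<Omega> l q lam u \<le> ennreal (lower_const l * N)"
    using lower_degree[OF l] N n lower_const_pos[of l] by (intro seminorm_le) auto
qed

end

lemma campanato_norm_real:
  assumes "Lq_norm Q \<Omega> q u = ennreal a" "campanato_seminorm Q \<Omega> k q lam u = ennreal b" "a \<ge> 0" "b \<ge> 0"
  shows "campanato_norm Q \<Omega> k q lam u = ennreal ((a powr q + b powr q) powr (1/q))"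
  using assms by (simp add: campanato_norm_def ennpowr_ennreal ennreal_plus[symmetric] del: ennreal_plus)

lemma finite_ennreal_cases:
  assumes "x < (\<infinity> :: ennreal)"
  obtains a where "x = ennreal a" "a \<ge> 0"
  using assms by (cases x rule: ennreal_cases) auto

text \<open>
  The seminorm decreases as the degree grows, so the lowering of the degree is the only inequality
  with content.
\<close>

lemma campanato_isomorphic:
  fixes \<Omega> :: "(real^'n::finite) set"
  assumes q: "q \<ge> 1" and l: "l \<le> k" and K: "K > 0"
    and lower: "\<And>(u :: ('n, 'm::finite) Qfun) n. u \<in> Lq_space Q \<Omega> q \<Longrightarrow> n \<ge> 0 \<Longrightarrow> Lq_norm Q \<Omega> q u \<le> ennreal n \<Longrightarrow>
       campanato_seminorm Q \<Omega> k q lam u \<le> ennreal n \<Longrightarrow> campanato_seminorm Q \<Omega> l q lam u \<le> ennreal (K * n)"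
  shows "continuously_isomorphic (campanato_space Q \<Omega> k q lam :: ('n, 'm) Qfun set) (campanato_norm Q \<Omega> k q lam)
        (campanato_space Q \<Omega> l q lam) (campanato_norm Q \<Omega> l q lam)"
proof -
  define c where "c = (1 + K powr q) powr (1/q)"
  have "1 powr (1/q) \<le> (1 + K powr q) powr (1/q)" using q K by (intro powr_mono2) auto
  then have c: "c \<ge> 1" by (simp add: c_def)
  have q0: "q > 0" using q by simp
  have main: "u \<in> campanato_space Q \<Omega> l q lam \<and> campanato_norm Q \<Omega> k q lam u \<le> campanato_norm Q \<Omega> l q lam u \<and>
      campanato_norm Q \<Omega> l q lam u \<le> ennreal c * campanato_norm Q \<Omega> k q lam u"
    if u: "u \<in> campanato_space Q \<Omega> k q lam" for u :: "('n, 'm) Qfun"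
  proof -
    have uL: "u \<in> Lq_space Q \<Omega> q" and "campanato_seminorm Q \<Omega> k q lam u < \<infinity>"
      using u by (auto simp: campanato_space_def)
    then obtain b where b: "campanato_seminorm Q \<Omega> k q lam u = ennreal b" "b \<ge> 0"
      using finite_ennreal_cases by blast
    have "Lq_norm Q \<Omega> q u < \<infinity>" using uL by (simp add: Lq_space_def)
    then obtain a where a: "Lq_norm Q \<Omega> q u = ennreal a" "a \<ge> 0" using finite_ennreal_cases by blast
    define n where "n = (a powr q + b powr q) powr (1/q)"
    have nk: "campanato_norm Q \<Omega> k q lam u = ennreal n"
      unfolding n_def using campanato_norm_real a b by blast
    have n: "n \<ge> 0" "n powr q = a powr q + b powr q" using q0 by (auto simp: n_def powr_powr)
    have "(a powr q) powr (1/q) \<le> n" "(b powr q) powr (1/q) \<le> n"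
      unfolding n_def using q0 by (auto intro!: powr_mono2)
    then have ab: "a \<le> n" "b \<le> n" using a(2) b(2) q0 by (simp_all add: powr_powr_inverse)
    have sl: "campanato_seminorm Q \<Omega> l q lam u \<le> ennreal (K * n)"
      using lower[OF uL n(1)] a b ab by (simp add: ennreal_leI)
    then have slf: "campanato_seminorm Q \<Omega> l q lam u < \<infinity>" by (simp add: le_less_trans)
    then obtain b' where b': "campanato_seminorm Q \<Omega> l q lam u = ennreal b'" "b' \<ge> 0"
      using finite_ennreal_cases by blast
    have nl: "campanato_norm Q \<Omega> l q lam u = ennreal ((a powr q + b' powr q) powr (1/q))"
      using campanato_norm_real a b' by blast
    have "b \<le> b'" using campanato_seminorm_mono[OF l q0, of Q \<Omega> lam u] b b' by (simp add: ennreal_le_iff)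
    then have 1: "n \<le> (a powr q + b' powr q) powr (1/q)"
      unfolding n_def using q0 a(2) b(2) by (intro powr_mono2 add_mono) auto
    have "b' \<le> K * n" using sl b' K n(1) by (simp add: ennreal_le_iff)
    then have "b' powr q \<le> (K * n) powr q" using b'(2) q0 by (intro powr_mono2) auto
    then have "b' powr q \<le> K powr q * n powr q" using K n(1) by (simp add: powr_mult)
    moreover have "a powr q \<le> n powr q" using n(2) by simp
    ultimately have "a powr q + b' powr q \<le> (1 + K powr q) * n powr q" by (simp add: distrib_right)
    then have "(a powr q + b' powr q) powr (1/q) \<le> ((1 + K powr q) * n powr q) powr (1/q)"
      using q0 by (intro powr_mono2) auto
    also have "\<dots> = c * n" using n(1) q0 K by (simp add: c_def powr_mult powr_powr_inverse)
    finally have 2: "(a powr q + b' powr q) powr (1/q) \<le> c * n" .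
    show ?thesis
      using uL slf 1 2 n(1) c unfolding nk nl campanato_space_def
      by (simp add: ennreal_leI ennreal_mult[symmetric])
  qed
  have "campanato_space Q \<Omega> l q lam \<subseteq> (campanato_space Q \<Omega> k q lam :: ('n, 'm) Qfun set)"
    unfolding campanato_space_def by (auto intro: le_less_trans[OF campanato_seminorm_mono[OF l q0]])
  then have "campanato_space Q \<Omega> k q lam = (campanato_space Q \<Omega> l q lam :: ('n, 'm) Qfun set)"
    using main by blast
  moreover have "campanato_norm Q \<Omega> k q lam u \<le> ennreal c * campanato_norm Q \<Omega> l q lam u"
    if "u \<in> campanato_space Q \<Omega> k q lam" for u :: "('n, 'm) Qfun"
  proof -
    have "1 * campanato_norm Q \<Omega> l q lam u \<le> ennreal c * campanato_norm Q \<Omega> l q lam u"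
      using c by (intro mult_right_mono) auto
    then show ?thesis using main[OF that] by (metis mult_1 order_trans)
  qed
  ultimately show ?thesis
    unfolding continuously_isomorphic_def using main c by (intro conjI exI[of _ c]) auto
qed

theorem theorem2p1:
  fixes Q k l :: nat and q lam A \<alpha> :: real
  assumes "1 \<le> Q" and "1 \<le> q" and "0 < lam" and "0 < A"
    and "l \<le> k"
    and "real CARD('n::finite) + real l * q < lam"
    and "lam < real CARD('n) + (real l + 1) * q"
    and "\<alpha> = (lam - real CARD('n) - real l * q) / q"
  shows "\<exists>C::real. C > 0 \<and>
    (\<forall>\<Omega> :: (real^'n) set. convex \<Omega> \<and> weighted_domain A \<Omega> \<longrightarrow>
      (\<forall>u :: ('n, 'm::finite) Qfun. u \<in> campanato_space Q \<Omega> k q lam \<longrightarrow>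
        (\<exists>v. (AE x in lebesgue_on \<Omega>. v x = u x) \<and> v \<in> Holder_space Q \<Omega> l \<alpha> \<and>
             Holder_seminorm Q \<Omega> l \<alpha> v \<le> ennreal C * campanato_seminorm Q \<Omega> l q lam u)) \<and>
      continuously_isomorphic
        (campanato_space Q \<Omega> k q lam :: ('n, 'm) Qfun set) (campanato_norm Q \<Omega> k q lam)
        (campanato_space Q \<Omega> l q lam) (campanato_norm Q \<Omega> l q lam))"
proof -
  define \<beta> where "\<beta> = (lam - real CARD('n)) / q"
  have q0: "q > 0" using assms(2) by simp
  have "0 \<le> real l * q" using q0 by simp
  then have lam: "real CARD('n) < lam" using assms(6) by linarith
  have l\<beta>: "real l < \<beta>" "\<beta> < real l + 1"
    using assms(6,7) q0 by (auto simp: \<beta>_def less_divide_eq divide_less_eq algebra_simps)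
  have \<alpha>: "\<alpha> = \<beta> - real l" using assms(8) q0 by (simp add: \<beta>_def diff_divide_distrib)
  \<comment> \<open>Degree k serves for the isomorphism; the regularity then uses approximation of degree l only.\<close>
  obtain Ck where Ck: "Ck > 0" "\<And>\<Omega> (u :: ('n, 'm) Qfun). convex \<Omega> \<Longrightarrow> weighted_domain A \<Omega> \<Longrightarrow>
    u \<in> measurable (lebesgue_on \<Omega>) (Qborel Q) \<Longrightarrow> campanato Q k q lam \<beta> A Ck \<Omega> u"
    using campanato_axioms_hold[OF assms(2,4) lam, of Q k, where 'm='m] unfolding \<beta>_def by blast
  obtain Cl where Cl: "Cl > 0" "\<And>\<Omega> (u :: ('n, 'm) Qfun). convex \<Omega> \<Longrightarrow> weighted_domain A \<Omega> \<Longrightarrow>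
    u \<in> measurable (lebesgue_on \<Omega>) (Qborel Q) \<Longrightarrow> campanato Q l q lam \<beta> A Cl \<Omega> u"
    using campanato_axioms_hold[OF assms(2,4) lam, of Q l, where 'm='m] unfolding \<beta>_def by blast
  define C where "C = sqrt Q * (sqrt (index_count TYPE('n) l)
    * (2 * (Cl + Cl / (1 - 2 powr (real l - \<beta>))) * 2 powr (\<beta> - real l)))"
  have "(2::real) powr (real l - \<beta>) < 1" using powr_less_mono[of "real l - \<beta>" 0 "2::real"] l\<beta> by simp
  moreover have "index_count TYPE('n) l > 0"
    using card_lists_length_eq[of "UNIV :: 'n set" l] by simp
  ultimately have C_pos: "C > 0"
    unfolding C_def using Cl(1) assms(1) by (intro mult_pos_pos add_pos_pos divide_pos_pos) auto
  show ?thesis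
  proof (intro exI[of _ C] conjI C_pos allI impI)
    fix \<Omega> :: "(real^'n) set" assume "convex \<Omega> \<and> weighted_domain A \<Omega>"
    then have \<Omega>: "convex \<Omega>" "weighted_domain A \<Omega>" by auto
    show iso: "continuously_isomorphic
        (campanato_space Q \<Omega> k q lam :: ('n, 'm) Qfun set) (campanato_norm Q \<Omega> k q lam)
        (campanato_space Q \<Omega> l q lam) (campanato_norm Q \<Omega> l q lam)"
    proof (rule campanato_isomorphic[OF assms(2,5)])
      show "max 1 (campanato.lower_const Q k q lam \<beta> Ck \<Omega> l) > 0" by simp
      fix u :: "('n, 'm) Qfun" and n assume uL: "u \<in> Lq_space Q \<Omega> q" and n: "n \<ge> 0"
        "Lq_norm Q \<Omega> q u \<le> ennreal n" "campanato_seminorm Q \<Omega> k q lam u \<le> ennreal n"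
      interpret campanato Q k q lam \<beta> A Ck \<Omega> u using Ck(2)[OF \<Omega>] uL by (simp add: Lq_space_def)
      have "campanato_seminorm Q \<Omega> l q lam u \<le> ennreal (lower_const l * n)"
        by (rule lower_seminorm[OF assms(5) l\<beta>(2) n])
      also have "\<dots> \<le> ennreal (max 1 (lower_const l) * n)"
        using n(1) by (intro ennreal_leI mult_right_mono) auto
      finally show "campanato_seminorm Q \<Omega> l q lam u \<le> ennreal (max 1 (lower_const l) * n)" .
    qed
    fix u :: "('n, 'm) Qfun" assume "u \<in> campanato_space Q \<Omega> k q lam"
    then have u: "u \<in> campanato_space Q \<Omega> l q lam" using iso by (simp add: continuously_isomorphic_def)
    then have uL: "u \<in> Lq_space Q \<Omega> q" and "campanato_seminorm Q \<Omega> l q lam u < \<infinity>"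
      by (auto simp: campanato_space_def)
    then obtain s where s: "campanato_seminorm Q \<Omega> l q lam u = ennreal s" "s \<ge> 0"
      using finite_ennreal_cases by blast
    interpret campanato_jets Q l q lam \<beta> A Cl \<Omega> u
      by (intro campanato_jets.intro campanato_jets_axioms.intro Cl(2) \<Omega> l\<beta>(1)) (use uL in \<open>simp add: Lq_space_def\<close>)
    have adm: "admissible M" if "s < M" for M
      using that s by (intro admissible_of_seminorm) (simp add: ennreal_less_iff)
    have adm1: "admissible (s + 1)" by (rule adm) simp
    obtain t where t: "\<And>y M. y \<in> closure \<Omega> \<Longrightarrow> admissible M \<Longrightarrow> is_jet M y (t y)" by (rule jet_field[OF adm1]) blast
    interpret J: campanato_jet_field Q l q lam \<beta> A Cl \<Omega> u t "s + 1"
      by unfold_locales (use adm1 t in auto)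
    have C_eq: "sqrt Q * (sqrt (index_count TYPE('n) l) * (2 * J.C2 * 2 powr (\<beta> - real l))) = C"
      by (simp add: C_def J.C2_def C1_def)
    have "Holder_seminorm Q \<Omega> l \<alpha> J.v \<le> ennreal (C * s)"
    proof (rule ennreal_le_of_gt)
      show "Holder_seminorm Q \<Omega> l \<alpha> J.v \<le> ennreal (C * M)" if "s < M" for M
        using J.v_Holder_seminorm[OF adm[OF that]] unfolding C_eq \<alpha> .
    qed (use C_pos s in auto)
    then have "Holder_seminorm Q \<Omega> l \<alpha> J.v \<le> ennreal C * campanato_seminorm Q \<Omega> l q lam u"
      unfolding s using C_pos s(2) by (simp add: ennreal_mult)
    moreover have "Holder_seminorm Q \<Omega> l \<alpha> J.v < \<infinity>"
      using \<open>Holder_seminorm Q \<Omega> l \<alpha> J.v \<le> ennreal (C * s)\<close> by (simp add: le_less_trans)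
    then have "J.v \<in> Holder_space Q \<Omega> l \<alpha>" unfolding \<alpha> by (rule J.v_Holder_space)
    ultimately show "\<exists>v. (AE x in lebesgue_on \<Omega>. v x = u x) \<and> v \<in> Holder_space Q \<Omega> l \<alpha> \<and>
             Holder_seminorm Q \<Omega> l \<alpha> v \<le> ennreal C * campanato_seminorm Q \<Omega> l q lam u"
      using J.v_eq_u by blast
  qed
qed

end
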